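(* Consider the memristive and diffusive Hindmarsh–Rose neural network system and its solution semiflow $\{S(t)\}_{t\ge 0}$ on $E = [L^2(\Omega,\mathbb{R}^4)]^m$, as described in the context. Then the ball $$B^* = \{h \in E : \|h\|_E^2 \le K\}, \qquad K = \left[\frac{M}{\lambda \min\{C_1,1\}} + \sqrt{\frac{M}{\lambda\min\{C_1,1\}}}\,\right]|\Omega| + 1,$$ is a bounded absorbing set for $\{S(t)\}_{t\ge0}$ in $E$, where $C_1 = \frac{1}{b}\left(\frac{\beta^2}{2} + \frac{1}{2k_2^3} + 4\right)$, $C_2 = \frac14\left[C_1 k_1\left(|c| + \frac{\gamma^2}{\delta}\right) + \frac14\right]^2$, $\lambda = \frac12 \min\{1, r, k_2\}$, and $$M = m\left[C_2 + (C_1 a)^4 + C_1 J_e^2 + \left[C_1^2\left(2 + \frac1r\right) + C_1\right]^2 + 2\alpha^2 + \frac{q^2 u_e^2}{r} + \frac{q^4}{r^2}\right].$$ That is, for every bounded set $B\subset E$ there is a finite time $T_B \ge 0$ such that $S(t)B \subset B^*$ for all $t > T_B$.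
   Context: Let $m \ge 2$ be an integer and let $\Omega \subset \mathbb{R}^n$, $n \le 3$, be a bounded domain with locally Lipschitz continuous boundary; $|\Omega|$ denotes its measure. The parameters $a, b, \eta_1, \eta_2, \alpha, \beta, q, r, \delta, k_1, k_2, P, Q, J_e$ are positive constants, and $u_e, c, \gamma$ are real constants. For $1 \le i \le m$, $t>0$, $x \in \Omega$, the system is $$\partial_t u_i = \eta_1 \Delta u_i + a u_i^2 - b u_i^3 + v_i - w_i + J_e - k_1 (c + \gamma\rho_i + \delta\rho_i^2) u_i + \sum_{j=1}^m P(u_j - u_i),$$ $$\partial_t v_i = \alpha - \beta u_i^2 - v_i, \qquad \partial_t w_i = q(u_i - u_e) - r w_i,$$ $$\partial_t \rho_i = \eta_2 \Delta \rho_i + u_i - k_2 \rho_i + \sum_{j=1}^m Q(\rho_j - \rho_i),$$ with homogeneous Neumann boundary conditions $\partial u_i/\partial\nu = \partial\rho_i/\partial\nu = 0$ on $\partial\Omega$ and initial data $g^0 = \mathrm{col}(u_i^0,v_i^0,w_i^0,\rho_i^0: 1\le i\le m) \in E = [L^2(\Omega,\mathbb{R}^4)]^m$. For each $g^0\in E$ this problem has a unique global weak solution $g(t;g^0)$, $t\ge 0$, depending continuously on $g^0$ (weak solutions in the sense: $g \in C([0,\tau];E)$, $C^1$ in time on $(0,\tau)$ with values in $[H^1(\Omega)\times L^2(\Omega,\mathbb{R}^2)\times H^1(\Omega)]^m$, satisfying the equations in the weak/dual sense); the solution semiflow is $S(t)g^0 = g(t;g^0)$. The norm $\|\cdot\|_E$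 is the $L^2$ norm on $E$. A bounded set $B^*\subset E$ is an absorbing set for the semiflow if for every bounded $B \subset E$ there is a finite $T_B\ge0$ with $S(t)B\subset B^*$ for all $t>T_B$. *)

theory Defs
  imports "HOL-Analysis.Analysis"
begin

text \<open>Bounded domain (open, connected, bounded) with locally Lipschitz boundary:
  near every boundary point, after choosing a unit direction e, the domain is the
  subgraph of a Lipschitz function of the coordinates orthogonal to e.\<close>

definition lipschitz_boundary :: "(real^'n) set \<Rightarrow> bool" where
  "lipschitz_boundary \<Omega> \<longleftrightarrow>
     (\<forall>p \<in> frontier \<Omega>. \<exists>e U L h. norm e = 1 \<and> open U \<and> p \<in> U \<and>
        L-lipschitz_on UNIV h \<and>
        (\<forall>y. h y = h (y - (y \<bullet> e) *\<^sub>R e)) \<and>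
        \<Omega> \<inter> U = {y \<in> U. y \<bullet> e < h y})"

definition bounded_lipschitz_domain :: "(real^'n) set \<Rightarrow> bool" where
  "bounded_lipschitz_domain \<Omega> \<longleftrightarrow>
     open \<Omega> \<and> connected \<Omega> \<and> \<Omega> \<noteq> {} \<and> bounded \<Omega> \<and> lipschitz_boundary \<Omega>"

definition L2 :: "(real^'n) set \<Rightarrow> (real^'n \<Rightarrow> real) \<Rightarrow> bool" where
  "L2 \<Omega> f \<longleftrightarrow> f \<in> borel_measurable (lebesgue_on \<Omega>) \<and>
                 integrable (lebesgue_on \<Omega>) (\<lambda>x. (f x)^2)"

definition L2sq :: "(real^'n) set \<Rightarrow> (real^'n \<Rightarrow> real) \<Rightarrow> real" where
  "L2sq \<Omega> f = (\<integral>x. (f x)^2 \<partial>lebesgue_on \<Omega>)"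

definition partial :: "'n \<Rightarrow> (real^'n \<Rightarrow> real) \<Rightarrow> real^'n \<Rightarrow> real" where
  "partial k \<phi> x = frechet_derivative \<phi> (at x) (axis k 1)"

definition test_fun :: "(real^'n) set \<Rightarrow> (real^'n \<Rightarrow> real) \<Rightarrow> bool" where
  "test_fun \<Omega> \<phi> \<longleftrightarrow> (\<forall>x. \<phi> differentiable (at x)) \<and>
     (\<forall>k. continuous_on UNIV (partial k \<phi>)) \<and>
     (\<exists>C. compact C \<and> C \<subseteq> \<Omega> \<and> (\<forall>x. x \<notin> C \<longrightarrow> \<phi> x = 0))"

definition weak_grad :: "(real^'n) set \<Rightarrow> (real^'n \<Rightarrow> real) \<Rightarrow> (real^'n \<Rightarrow> real^'n) \<Rightarrow> bool" where
  "weak_grad \<Omega> u G \<longleftrightarrow> L2 \<Omega> u \<and> (\<forall>k. L2 \<Omega> (\<lambda>x. G x $ k)) \<and>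
     (\<forall>\<phi>. test_fun \<Omega> \<phi> \<longrightarrow> (\<forall>k.
        (\<integral>x. u x * partial k \<phi> x \<partial>lebesgue_on \<Omega>) = - (\<integral>x. G x $ k * \<phi> x \<partial>lebesgue_on \<Omega>)))"

definition H1 :: "(real^'n) set \<Rightarrow> (real^'n \<Rightarrow> real) \<Rightarrow> bool" where
  "H1 \<Omega> u \<longleftrightarrow> (\<exists>G. weak_grad \<Omega> u G)"

definition gradsq :: "(real^'n) set \<Rightarrow> (real^'n \<Rightarrow> real^'n) \<Rightarrow> real" where
  "gradsq \<Omega> G = (\<integral>x. (norm (G x))^2 \<partial>lebesgue_on \<Omega>)"

definition cont_L2 :: "(real^'n) set \<Rightarrow> (real \<Rightarrow> real^'n \<Rightarrow> real) \<Rightarrow> bool" where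
  "cont_L2 \<Omega> f \<longleftrightarrow> (\<forall>t\<ge>0. ((\<lambda>s. L2sq \<Omega> (\<lambda>x. f s x - f t x)) \<longlongrightarrow> 0) (at t within {0..}))"

definition C1_L2 :: "(real^'n) set \<Rightarrow> (real \<Rightarrow> real^'n \<Rightarrow> real) \<Rightarrow> (real \<Rightarrow> real^'n \<Rightarrow> real) \<Rightarrow> bool" where
  "C1_L2 \<Omega> f f' \<longleftrightarrow> (\<forall>t>0. L2 \<Omega> (f t) \<and> L2 \<Omega> (f' t) \<and>
     ((\<lambda>s. L2sq \<Omega> (\<lambda>x. (f s x - f t x) / (s - t) - f' t x)) \<longlongrightarrow> 0) (at t) \<and>
     ((\<lambda>s. L2sq \<Omega> (\<lambda>x. f' s x - f' t x)) \<longlongrightarrow> 0) (at t))"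

definition C1_H1 :: "(real^'n) set \<Rightarrow> (real \<Rightarrow> real^'n \<Rightarrow> real) \<Rightarrow> (real \<Rightarrow> real^'n \<Rightarrow> real^'n)
     \<Rightarrow> (real \<Rightarrow> real^'n \<Rightarrow> real) \<Rightarrow> (real \<Rightarrow> real^'n \<Rightarrow> real^'n) \<Rightarrow> bool" where
  "C1_H1 \<Omega> f G f' G' \<longleftrightarrow> (\<forall>t>0. weak_grad \<Omega> (f t) (G t) \<and> weak_grad \<Omega> (f' t) (G' t) \<and>
     ((\<lambda>s. L2sq \<Omega> (\<lambda>x. (f s x - f t x) / (s - t) - f' t x)
          + gradsq \<Omega> (\<lambda>x. (1 / (s - t)) *\<^sub>R (G s x - G t x) - G' t x)) \<longlongrightarrow> 0) (at t) \<and>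
     ((\<lambda>s. L2sq \<Omega> (\<lambda>x. f' s x - f' t x) + gradsq \<Omega> (\<lambda>x. G' s x - G' t x)) \<longlongrightarrow> 0) (at t))"

text \<open>An element h of E: h i x :: real^4 for neuron i < m, with components
  1 = u, 2 = v, 3 = w, 4 = \<rho>.\<close>

definition inE :: "(real^'n) set \<Rightarrow> nat \<Rightarrow> (nat \<Rightarrow> real^'n \<Rightarrow> real^4) \<Rightarrow> bool" where
  "inE \<Omega> m h \<longleftrightarrow> (\<forall>i<m. h i \<in> borel_measurable (lebesgue_on \<Omega>) \<and>
                      integrable (lebesgue_on \<Omega>) (\<lambda>x. (norm (h i x))^2))"

definition normE2 :: "(real^'n) set \<Rightarrow> nat \<Rightarrow> (nat \<Rightarrow> real^'n \<Rightarrow> real^4) \<Rightarrow> real" where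
  "normE2 \<Omega> m h = (\<Sum>i<m. \<integral>x. (norm (h i x))^2 \<partial>lebesgue_on \<Omega>)"

definition bounded_in_E :: "(real^'n) set \<Rightarrow> nat \<Rightarrow> (nat \<Rightarrow> real^'n \<Rightarrow> real^4) set \<Rightarrow> bool" where
  "bounded_in_E \<Omega> m B \<longleftrightarrow> (\<forall>h\<in>B. inE \<Omega> m h) \<and> (\<exists>R. \<forall>h\<in>B. normE2 \<Omega> m h \<le> R)"

definition hr_weak_solution ::
  "(real^'n) set \<Rightarrow> nat \<Rightarrow> real \<Rightarrow> real \<Rightarrow> real \<Rightarrow> real \<Rightarrow> real \<Rightarrow> real \<Rightarrow> real \<Rightarrow> real
   \<Rightarrow> real \<Rightarrow> real \<Rightarrow> real \<Rightarrow> real \<Rightarrow> real \<Rightarrow> real \<Rightarrow> real \<Rightarrow> real \<Rightarrow> real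
   \<Rightarrow> (nat \<Rightarrow> real^'n \<Rightarrow> real^4) \<Rightarrow> (real \<Rightarrow> nat \<Rightarrow> real^'n \<Rightarrow> real^4) \<Rightarrow> bool" where
  "hr_weak_solution \<Omega> m a b \<eta>1 \<eta>2 \<alpha> \<beta> q r \<delta> k1 k2 P Q Je ue c \<gamma> g0 g \<longleftrightarrow>
    (let u = (\<lambda>i t x. g t i x $ 1); v = (\<lambda>i t x. g t i x $ 2);
         w = (\<lambda>i t x. g t i x $ 3); \<rho> = (\<lambda>i t x. g t i x $ 4) in
     (\<forall>t\<ge>0. inE \<Omega> m (g t)) \<and>
     (\<forall>i<m. cont_L2 \<Omega> (u i) \<and> cont_L2 \<Omega> (v i) \<and> cont_L2 \<Omega> (w i) \<and> cont_L2 \<Omega> (\<rho> i)) \<and>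
     (\<forall>i<m. (\<integral>x. (norm (g 0 i x - g0 i x))^2 \<partial>lebesgue_on \<Omega>) = 0) \<and>
     (\<exists>Gu Gr u' v' w' r' Gu' Gr'.
        (\<forall>i<m. C1_H1 \<Omega> (u i) (Gu i) (u' i) (Gu' i) \<and> C1_L2 \<Omega> (v i) (v' i) \<and>
               C1_L2 \<Omega> (w i) (w' i) \<and> C1_H1 \<Omega> (\<rho> i) (Gr i) (r' i) (Gr' i)) \<and>
        (\<forall>i<m. \<forall>t>0. \<forall>\<psi> G\<psi>. weak_grad \<Omega> \<psi> G\<psi> \<longrightarrow>
           (\<integral>x. u' i t x * \<psi> x \<partial>lebesgue_on \<Omega>) =
             - \<eta>1 * (\<integral>x. Gu i t x \<bullet> G\<psi> x \<partial>lebesgue_on \<Omega>)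
             + (\<integral>x. (a * (u i t x)^2 - b * (u i t x)^3 + v i t x - w i t x + Je
                       - k1 * (c + \<gamma> * \<rho> i t x + \<delta> * (\<rho> i t x)^2) * u i t x
                       + (\<Sum>j<m. P * (u j t x - u i t x))) * \<psi> x \<partial>lebesgue_on \<Omega>)) \<and>
        (\<forall>i<m. \<forall>t>0. AE x in lebesgue_on \<Omega>.
           v' i t x = \<alpha> - \<beta> * (u i t x)^2 - v i t x) \<and>
        (\<forall>i<m. \<forall>t>0. AE x in lebesgue_on \<Omega>.
           w' i t x = q * (u i t x - ue) - r * w i t x) \<and>
        (\<forall>i<m. \<forall>t>0. \<forall>\<psi> G\<psi>. weak_grad \<Omega> \<psi> G\<psi> \<longrightarrow>
           (\<integral>x. r' i t x * \<psi> x \<partial>lebesgue_on \<Omega>) =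
             - \<eta>2 * (\<integral>x. Gr i t x \<bullet> G\<psi> x \<partial>lebesgue_on \<Omega>)
             + (\<integral>x. (u i t x - k2 * \<rho> i t x
                       + (\<Sum>j<m. Q * (\<rho> j t x - \<rho> i t x))) * \<psi> x \<partial>lebesgue_on \<Omega>))))"

end

theory Submission
  imports Defs
begin

text \<open>
  With \<open>\<nu> = \<alpha> - v\<close>, \<open>\<omega> = w + q u\<^sub>e / r\<close> and \<open>c\<^sub>0 = min C\<^sub>1 1\<close>, the energy
  \<open>\<Phi> = \<Sum>\<^sub>i \<integral> 3/2 C\<^sub>1 u\<^sup>2 + \<nu>\<^sup>2 + w\<^sup>2 + 3 C\<^sub>1 / (2 q) \<omega>\<^sup>2 + c\<^sub>0 \<rho>\<^sup>2\<close> decays at rate \<open>2 \<lambda>\<close> up to a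
  constant. The \<open>\<omega>\<^sup>2\<close> term cancels the coupling \<open>- u w\<close> exactly. Using \<open>\<nu>\<close> instead of \<open>v\<close>
  removes \<open>\<alpha>\<close> from the equation of \<open>v\<close>; one returns to \<open>v\<^sup>2 = \<nu>\<^sup>2 - 2 \<alpha> \<nu> + \<alpha>\<^sup>2\<close> because
  \<open>\<integral> \<nu>\<close> is asymptotically nonnegative. This leaves enough room to reach the constant \<open>M / (\<lambda> c\<^sub>0)\<close>;
  the square root in \<open>K\<close> is not needed.

  Testing the equation of \<open>u\<close> with \<open>u\<close> requires \<open>u\<^sup>4\<close> and \<open>\<rho>\<^sup>2 u\<^sup>2\<close> to be integrable. No Sobolev
  embedding is used: the equation of \<open>v\<close> shows that \<open>u\<^sup>2\<close> is in \<open>L\<^sup>2\<close>, and bounded functions of \<open>u\<close>,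
  which are admissible by the chain rule for weak gradients, control \<open>\<rho>\<^sup>2 u\<^sup>2\<close>.
\<close>

section \<open>Continuity of translations in the mean\<close>

text \<open>The weights of the energy are forced by the size of \<open>C1\<close>. With weight 1 on
  \<open>C1 * u^2\<close>, the part \<open>\<beta>^2 / 2\<close> of \<open>b * C1\<close> would
  absorb \<open>\<nu> * \<beta> * u^2\<close> at the price of \<open>\<nu>^2 / 2\<close>; since
  \<open>lam\<close> may equal 1/2, the decay rate takes the other half of the damping and nothing
  is left for the linear coupling of \<open>u\<close> and \<open>\<nu>\<close>. The weight 3/2
  lowers the price to \<open>\<nu>^2 / 3\<close> and leaves \<open>\<nu>^2 / 6\<close>.

  The constant bounding half the time derivative stays below \<open>M\<close> by
  \<open>\<alpha>^2 / 2\<close> per neuron and unit volume. As \<open>lam * c0\<close> is at most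
  1/2, this reserve covers the \<open>\<alpha>^2\<close> that the return from \<open>\<nu>\<close>
  to \<open>v\<close> costs. The integral of \<open>\<nu>\<close> is controlled from below because
  \<open>\<nu>' = - \<nu> + \<beta> u^2 \<ge> - \<nu>\<close>, so its negative part dies out like
  \<open>exp (- t)\<close>.

  On the analytic side, weak gradients are defined by duality with compactly supported C1 functions
  alone. The chain rule has to be derived from that duality, by mollifying near the support of a
  test function, and this rests on continuity of translations in L1.\<close>

lemma nn_integral_lborel_translation:
  fixes f :: "'a::euclidean_space \<Rightarrow> ennreal"
  assumes "f \<in> borel_measurable borel"
  shows "(\<integral>\<^sup>+x. f (x + h) \<partial>lborel) = (\<integral>\<^sup>+x. f x \<partial>lborel)"
proof -
  have "(\<integral>\<^sup>+x. f x \<partial>lborel) = (\<integral>\<^sup>+x. f x \<partial>distr lborel borel ((+) h))"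
    by (simp add: lborel_distr_plus)
  also have "\<dots> = (\<integral>\<^sup>+x. f (h + x) \<partial>lborel)"
    using assms by (subst nn_integral_distr) auto
  finally show ?thesis by (simp add: add.commute)
qed

lemma integrable_lborel_translation:
  fixes f :: "'a::euclidean_space \<Rightarrow> real"
  assumes "integrable lborel f"
  shows "integrable lborel (\<lambda>x. f (x + h))"
    and "(\<integral>x. f (x + h) \<partial>lborel) = (\<integral>x. f x \<partial>lborel)"
proof -
  have *: "integrable (distr lborel borel ((+) h)) f"
    using assms by (simp add: lborel_distr_plus)
  have m: "f \<in> borel_measurable borel" using assms by auto
  show "integrable lborel (\<lambda>x. f (x + h))"
    using * m by (subst (asm) integrable_distr_eq) (auto simp: add.commute)
  have "(\<integral>x. f x \<partial>lborel) = (\<integral>x. f x \<partial>distr lborel borel ((+) h))"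
    by (simp add: lborel_distr_plus)
  also have "\<dots> = (\<integral>x. f (h + x) \<partial>lborel)"
    using m by (subst integral_distr) auto
  finally show "(\<integral>x. f (x + h) \<partial>lborel) = (\<integral>x. f x \<partial>lborel)" by (simp add: add.commute)
qed

lemma ennreal_le_add:
  assumes "a \<le> b + c" "0 \<le> b" "0 \<le> c"
  shows "ennreal a \<le> ennreal b + ennreal c"
  using assms by (metis ennreal_leI ennreal_plus)

text \<open>Continuity at 0 of the translation group in L1. The nonnegative integral is meaningful
  for every measurable \<open>f\<close>, so closure under scaling and sums carries no integrability
  side conditions.\<close>

definition L1_translation_continuous :: "('a::euclidean_space \<Rightarrow> real) \<Rightarrow> bool" where
  "L1_translation_continuous f \<longleftrightarrow>
     (\<forall>e>0. \<exists>d>0. \<forall>h. norm h < d \<longrightarrow> (\<integral>\<^sup>+x. ennreal \<bar>f (x + h) - f x\<bar> \<partial>lborel) \<le> ennreal e)"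

text \<open>An epsilon/3 argument: translation invariance of \<open>lborel\<close> makes the shifted
  error \<open>f - g\<close> as small as the unshifted one.\<close>

lemma L1_translation_continuous_approx:
  fixes f :: "'a::euclidean_space \<Rightarrow> real"
  assumes f: "f \<in> borel_measurable borel"
    and approx: "\<And>e. e > 0 \<Longrightarrow> \<exists>g \<in> borel_measurable borel. L1_translation_continuous g \<and>
        (\<integral>\<^sup>+x. ennreal \<bar>f x - g x\<bar> \<partial>lborel) \<le> ennreal e"
  shows "L1_translation_continuous f"
  unfolding L1_translation_continuous_def
proof (intro allI impI)
  fix e :: real assume "e > 0"
  then obtain g where [measurable]: "g \<in> borel_measurable borel" and g: "L1_translation_continuous g"
    and fg: "(\<integral>\<^sup>+x. ennreal \<bar>f x - g x\<bar> \<partial>lborel) \<le> ennreal (e/3)"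
    using approx[of "e/3"] by auto
  note f[measurable]
  from g \<open>e > 0\<close> obtain d where "d > 0"
    and d: "\<And>h. norm h < d \<Longrightarrow> (\<integral>\<^sup>+x. ennreal \<bar>g (x + h) - g x\<bar> \<partial>lborel) \<le> ennreal (e/3)"
    unfolding L1_translation_continuous_def by (meson divide_pos_pos zero_less_numeral)
  show "\<exists>d>0. \<forall>h. norm h < d \<longrightarrow> (\<integral>\<^sup>+x. ennreal \<bar>f (x + h) - f x\<bar> \<partial>lborel) \<le> ennreal e"
  proof (intro exI conjI allI impI)
    fix h :: 'a assume h: "norm h < d"
    have "(\<integral>\<^sup>+x. ennreal \<bar>f (x + h) - f x\<bar> \<partial>lborel) \<le>
        (\<integral>\<^sup>+x. (ennreal \<bar>f (x + h) - g (x + h)\<bar> + ennreal \<bar>g (x + h) - g x\<bar>) + ennreal \<bar>f x - g x\<bar> \<partial>lborel)"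
    proof (intro nn_integral_mono)
      fix x
      have "ennreal \<bar>f (x + h) - f x\<bar> \<le> ennreal (\<bar>f (x + h) - g (x + h)\<bar> + \<bar>g (x + h) - g x\<bar>) + ennreal \<bar>f x - g x\<bar>"
        by (rule ennreal_le_add) arith+
      then show "ennreal \<bar>f (x + h) - f x\<bar> \<le>
        (ennreal \<bar>f (x + h) - g (x + h)\<bar> + ennreal \<bar>g (x + h) - g x\<bar>) + ennreal \<bar>f x - g x\<bar>"
        by simp
    qed
    also have "\<dots> = (\<integral>\<^sup>+x. ennreal \<bar>f (x + h) - g (x + h)\<bar> \<partial>lborel) + (\<integral>\<^sup>+x. ennreal \<bar>g (x + h) - g x\<bar> \<partial>lborel)
        + (\<integral>\<^sup>+x. ennreal \<bar>f x - g x\<bar> \<partial>lborel)"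
      by (simp add: nn_integral_add)
    also have "(\<integral>\<^sup>+x. ennreal \<bar>f (x + h) - g (x + h)\<bar> \<partial>lborel) = (\<integral>\<^sup>+x. ennreal \<bar>f x - g x\<bar> \<partial>lborel)"
      by (rule nn_integral_lborel_translation[of "\<lambda>x. ennreal \<bar>f x - g x\<bar>"]) measurable
    also have "\<dots> + (\<integral>\<^sup>+x. ennreal \<bar>g (x + h) - g x\<bar> \<partial>lborel) + (\<integral>\<^sup>+x. ennreal \<bar>f x - g x\<bar> \<partial>lborel)
        \<le> ennreal (e/3) + ennreal (e/3) + ennreal (e/3)"
      by (intro add_mono fg d h)
    also have "\<dots> = ennreal e" using \<open>e > 0\<close> by (simp flip: ennreal_plus)
    finally show "(\<integral>\<^sup>+x. ennreal \<bar>f (x + h) - f x\<bar> \<partial>lborel) \<le> ennreal e" .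
  qed (use \<open>d > 0\<close> in auto)
qed

text \<open>The bound \<open>2 * \<bar>f x\<bar>\<close> is the one that
  \<open>integrable_induct\<close> supplies for its simple approximations; it dominates the error by
  \<open>3 * \<bar>f x\<bar>\<close>.\<close>

lemma L1_translation_continuous_dominated_limit:
  fixes f :: "'a::euclidean_space \<Rightarrow> real" and s :: "nat \<Rightarrow> 'a \<Rightarrow> real"
  assumes s: "\<And>i. s i \<in> borel_measurable borel" "\<And>i. L1_translation_continuous (s i)"
    and lim: "\<And>x. (\<lambda>i. s i x) \<longlonglongrightarrow> f x" and bound: "\<And>i x. \<bar>s i x\<bar> \<le> 2 * \<bar>f x\<bar>"
    and f: "integrable lborel f"
  shows "L1_translation_continuous f"
proof (rule L1_translation_continuous_approx)
  note s(1)[measurable]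
  show [measurable]: "f \<in> borel_measurable borel" using f by auto
  fix e :: real assume "e > 0"
  have "(\<lambda>i. \<integral>\<^sup>+x. ennreal \<bar>f x - s i x\<bar> \<partial>lborel) \<longlonglongrightarrow> (\<integral>\<^sup>+x. 0 \<partial>(lborel::'a measure))"
  proof (rule nn_integral_dominated_convergence[where w = "\<lambda>x. ennreal (3 * \<bar>f x\<bar>)"])
    show "AE x in lborel. ennreal \<bar>f x - s i x\<bar> \<le> ennreal (3 * \<bar>f x\<bar>)" for i
    proof (rule AE_I2, rule ennreal_leI)
      fix x show "\<bar>f x - s i x\<bar> \<le> 3 * \<bar>f x\<bar>" using bound[of i x] by arith
    qed
    show "(\<integral>\<^sup>+ x. ennreal (3 * \<bar>f x\<bar>) \<partial>lborel) < \<infinity>"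
    proof -
      have "integrable lborel (\<lambda>x. 3 * \<bar>f x\<bar>)" using f by auto
      from integrableD(2)[OF this] show ?thesis by (simp add: abs_mult top.not_eq_extremum)
    qed
    show "AE x in lborel. (\<lambda>i. ennreal \<bar>f x - s i x\<bar>) \<longlonglongrightarrow> 0"
    proof (rule AE_I2)
      fix x
      have "(\<lambda>i. \<bar>f x - s i x\<bar>) \<longlonglongrightarrow> \<bar>f x - f x\<bar>" by (intro tendsto_intros lim)
      then have "(\<lambda>i. \<bar>f x - s i x\<bar>) \<longlonglongrightarrow> 0" by simp
      then show "(\<lambda>i. ennreal \<bar>f x - s i x\<bar>) \<longlonglongrightarrow> 0"
        using tendsto_ennrealI by fastforce
    qed
  qed measurable
  then have "\<forall>\<^sub>F i in sequentially. (\<integral>\<^sup>+x. ennreal \<bar>f x - s i x\<bar> \<partial>lborel) < ennreal e"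
    using \<open>e > 0\<close> by (intro order_tendstoD) (auto simp: zero_less_iff_neq_zero[symmetric])
  then obtain i where "(\<integral>\<^sup>+x. ennreal \<bar>f x - s i x\<bar> \<partial>lborel) < ennreal e"
    by (auto simp: eventually_sequentially)
  then show "\<exists>g\<in>borel_measurable borel. L1_translation_continuous g \<and>
        (\<integral>\<^sup>+ x. ennreal \<bar>f x - g x\<bar> \<partial>lborel) \<le> ennreal e"
    using s by (auto intro!: bexI[of _ "s i"])
qed

text \<open>Regularity squeezes \<open>A\<close> between a closed \<open>K\<close> and an open
  \<open>U\<close> with \<open>U - K\<close> small. Boundedness of \<open>A\<close> makes
  \<open>K\<close> compact, hence at positive distance from the complement of \<open>U\<close>. For
  shorter shifts the indicator can differ at \<open>x\<close> and \<open>x + h\<close> only if one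
  of these points lies in \<open>U - K\<close>.\<close>

lemma L1_translation_continuous_indicator:
  fixes A :: "'a::euclidean_space set"
  assumes A: "A \<in> sets borel" "bounded A"
  shows "L1_translation_continuous (indicator A)"
  unfolding L1_translation_continuous_def
proof (intro allI impI)
  fix e :: real assume "e > 0"
  have A': "A \<in> sets lebesgue" using A by auto
  have e4: "e / 4 > 0" using \<open>e > 0\<close> by simp
  obtain U where U: "open U" "A \<subseteq> U" "U - A \<in> lmeasurable" "emeasure lebesgue (U - A) < ennreal (e/4)"
    by (rule sets_lebesgue_outer_open[OF A' e4])
  obtain K where K: "closed K" "K \<subseteq> A" "A - K \<in> lmeasurable" "emeasure lebesgue (A - K) < ennreal (e/4)"
    by (rule sets_lebesgue_inner_closed[OF A' e4])
  have cK: "compact K" using K A by (meson bounded_subset compact_eq_bounded_closed)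
  obtain d where "d > 0" and d: "(\<Union>x\<in>K. cball x d) \<subseteq> U"
    using compact_subset_open_imp_cball_epsilon_subset[OF cK \<open>open U\<close> subset_trans[OF K(2) U(2)]] by metis
  note [measurable] = A(1) borel_open[OF U(1)] borel_closed[OF K(1)]
  have UK: "emeasure lborel (U - K) \<le> ennreal (e/2)"
  proof -
    have "U - K = (U - A) \<union> (A - K)" using U(2) K(2) by blast
    moreover have "emeasure lborel ((U - A) \<union> (A - K)) \<le> emeasure lborel (U - A) + emeasure lborel (A - K)"
      by (rule emeasure_subadditive) measurable
    ultimately have "emeasure lborel (U - K) \<le> emeasure lborel (U - A) + emeasure lborel (A - K)" by simp
    also have "\<dots> \<le> ennreal (e/4) + ennreal (e/4)"
      using U(4) K(4) by (intro add_mono) (simp_all add: less_imp_le)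
    also have "\<dots> = ennreal (e/2)" using \<open>e > 0\<close> by (simp flip: ennreal_plus)
    finally show ?thesis .
  qed
  show "\<exists>d>0. \<forall>h. norm h < d \<longrightarrow>
      (\<integral>\<^sup>+x. ennreal \<bar>indicator A (x + h) - indicator A x :: real\<bar> \<partial>lborel) \<le> ennreal e"
  proof (intro exI conjI allI impI)
    fix h :: 'a assume h: "norm h < d"
    have "(\<integral>\<^sup>+x. ennreal \<bar>indicator A (x + h) - indicator A x :: real\<bar> \<partial>lborel)
        \<le> (\<integral>\<^sup>+x. indicator (U - K) (x + h) + indicator (U - K) x \<partial>lborel)"
    proof (rule nn_integral_mono)
      fix x :: 'a
      have d': "z \<in> U" if "y \<in> K" "dist y z \<le> d" for y z
        using d that by (meson UN_I mem_cball subsetD)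
      have 1: "x + h \<in> K \<Longrightarrow> x \<in> U"
        using d'[of "x + h" x] h by (simp add: dist_norm)
      have 2: "x \<in> K \<Longrightarrow> x + h \<in> U"
        using d'[of x "x + h"] h by (simp add: dist_norm)
      show "ennreal \<bar>indicator A (x + h) - indicator A x :: real\<bar> 
        \<le> indicator (U - K) (x + h) + indicator (U - K) x"
        using 1 2 subsetD[OF K(2), of x] subsetD[OF K(2), of "x + h"] subsetD[OF U(2), of x] subsetD[OF U(2), of "x + h"]
        by (cases "x \<in> A"; cases "x + h \<in> A"; cases "x \<in> K"; cases "x + h \<in> K"; simp)
    qed
    also have "\<dots> = (\<integral>\<^sup>+x. indicator (U - K) (x + h) \<partial>lborel) + (\<integral>\<^sup>+x. indicator (U - K) x \<partial>lborel)"
      by (rule nn_integral_add) measurable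
    also have "(\<integral>\<^sup>+x. indicator (U - K) (x + h) \<partial>lborel) = (\<integral>\<^sup>+x. indicator (U - K) x \<partial>lborel)"
      by (rule nn_integral_lborel_translation) measurable
    also have "(\<integral>\<^sup>+x. indicator (U - K) x \<partial>lborel) + (\<integral>\<^sup>+x. indicator (U - K) x \<partial>lborel) \<le> ennreal (e/2) + ennreal (e/2)"
      using UK by (intro add_mono) auto
    also have "\<dots> = ennreal e" using \<open>e > 0\<close> by (simp flip: ennreal_plus)
    finally show "(\<integral>\<^sup>+x. ennreal \<bar>indicator A (x + h) - indicator A x :: real\<bar> \<partial>lborel) \<le> ennreal e" .
  qed (use \<open>d > 0\<close> in auto)
qed

lemma L1_translation_continuous_scale:
  fixes f :: "'a::euclidean_space \<Rightarrow> real"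
  assumes f: "f \<in> borel_measurable borel" and "L1_translation_continuous f"
  shows "L1_translation_continuous (\<lambda>x. f x * c)"
  unfolding L1_translation_continuous_def
proof (intro allI impI)
  fix e :: real assume "e > 0"
  note f[measurable]
  have "e / (\<bar>c\<bar> + 1) > 0" using \<open>e > 0\<close> by (simp add: divide_pos_pos)
  then obtain d where "d > 0"
    and d: "\<And>h. norm h < d \<Longrightarrow> (\<integral>\<^sup>+x. ennreal \<bar>f (x + h) - f x\<bar> \<partial>lborel) \<le> ennreal (e / (\<bar>c\<bar> + 1))"
    using assms(2) unfolding L1_translation_continuous_def by meson
  show "\<exists>d>0. \<forall>h. norm h < d \<longrightarrow> (\<integral>\<^sup>+x. ennreal \<bar>f (x + h) * c - f x * c\<bar> \<partial>lborel) \<le> ennreal e"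
  proof (intro exI conjI allI impI)
    fix h :: 'a assume h: "norm h < d"
    have "(\<integral>\<^sup>+x. ennreal \<bar>f (x + h) * c - f x * c\<bar> \<partial>lborel) = (\<integral>\<^sup>+x. ennreal \<bar>c\<bar> * ennreal \<bar>f (x + h) - f x\<bar> \<partial>lborel)"
    proof (rule nn_integral_cong)
      fix x
      have "\<bar>f (x + h) * c - f x * c\<bar> = \<bar>c\<bar> * \<bar>f (x + h) - f x\<bar>"
        by (metis abs_mult left_diff_distrib mult.commute)
      then show "ennreal \<bar>f (x + h) * c - f x * c\<bar> = ennreal \<bar>c\<bar> * ennreal \<bar>f (x + h) - f x\<bar>"
        by (simp add: ennreal_mult)
    qed
    also have "\<dots> = ennreal \<bar>c\<bar> * (\<integral>\<^sup>+x. ennreal \<bar>f (x + h) - f x\<bar> \<partial>lborel)"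
      by (rule nn_integral_cmult) measurable
    also have "\<dots> \<le> ennreal \<bar>c\<bar> * ennreal (e / (\<bar>c\<bar> + 1))"
      by (intro mult_left_mono d h) auto
    also have "\<dots> = ennreal (\<bar>c\<bar> * (e / (\<bar>c\<bar> + 1)))"
      using \<open>e > 0\<close> by (intro ennreal_mult[symmetric]) auto
    also have "\<dots> \<le> ennreal e"
      using \<open>e > 0\<close> by (intro ennreal_leI) (simp add: field_simps)
    finally show "(\<integral>\<^sup>+x. ennreal \<bar>f (x + h) * c - f x * c\<bar> \<partial>lborel) \<le> ennreal e" .
  qed (use \<open>d > 0\<close> in auto)
qed

lemma L1_translation_continuous_add:
  fixes f g :: "'a::euclidean_space \<Rightarrow> real"
  assumes fg: "f \<in> borel_measurable borel" "g \<in> borel_measurable borel"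
    and "L1_translation_continuous f" "L1_translation_continuous g"
  shows "L1_translation_continuous (\<lambda>x. f x + g x)"
  unfolding L1_translation_continuous_def
proof (intro allI impI)
  fix e :: real assume "e > 0"
  note fg[measurable]
  have "e / 2 > 0" using \<open>e > 0\<close> by simp
  from \<open>e / 2 > 0\<close> obtain d1 where "d1 > 0"
    and d1: "\<And>h. norm h < d1 \<Longrightarrow> (\<integral>\<^sup>+x. ennreal \<bar>f (x + h) - f x\<bar> \<partial>lborel) \<le> ennreal (e / 2)"
    using assms(3) unfolding L1_translation_continuous_def by meson
  from \<open>e / 2 > 0\<close> obtain d2 where "d2 > 0"
    and d2: "\<And>h. norm h < d2 \<Longrightarrow> (\<integral>\<^sup>+x. ennreal \<bar>g (x + h) - g x\<bar> \<partial>lborel) \<le> ennreal (e / 2)"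
    using assms(4) unfolding L1_translation_continuous_def by meson
  show "\<exists>d>0. \<forall>h. norm h < d \<longrightarrow> (\<integral>\<^sup>+x. ennreal \<bar>f (x + h) + g (x + h) - (f x + g x)\<bar> \<partial>lborel) \<le> ennreal e"
  proof (intro exI conjI allI impI)
    fix h :: 'a assume h: "norm h < min d1 d2"
    have "(\<integral>\<^sup>+x. ennreal \<bar>f (x + h) + g (x + h) - (f x + g x)\<bar> \<partial>lborel)
      \<le> (\<integral>\<^sup>+x. ennreal \<bar>f (x + h) - f x\<bar> + ennreal \<bar>g (x + h) - g x\<bar> \<partial>lborel)"
      by (rule nn_integral_mono, rule ennreal_le_add) arith+
    also have "\<dots> = (\<integral>\<^sup>+x. ennreal \<bar>f (x + h) - f x\<bar> \<partial>lborel) + (\<integral>\<^sup>+x. ennreal \<bar>g (x + h) - g x\<bar> \<partial>lborel)"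
      by (rule nn_integral_add) measurable
    also have "\<dots> \<le> ennreal (e/2) + ennreal (e/2)"
      using h by (intro add_mono d1 d2) auto
    also have "\<dots> = ennreal e" using \<open>e > 0\<close> by (simp flip: ennreal_plus)
    finally show "(\<integral>\<^sup>+x. ennreal \<bar>f (x + h) + g (x + h) - (f x + g x)\<bar> \<partial>lborel) \<le> ennreal e" .
  qed (use \<open>d1 > 0\<close> \<open>d2 > 0\<close> in auto)
qed

lemma integrable_imp_L1_translation_continuous:
  fixes f :: "'a::euclidean_space \<Rightarrow> real"
  assumes "integrable lborel f"
  shows "L1_translation_continuous f"
  using assms
proof (induction rule: integrable_induct)
  case (base A c)
  have [measurable]: "A \<in> sets borel" using base by auto
  \<comment> \<open>\<open>A\<close> has finite measure but may be unbounded, so it is exhausted by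
    its intersections with balls.\<close>
  have "L1_translation_continuous (indicator A :: 'a \<Rightarrow> real)"
  proof (rule L1_translation_continuous_dominated_limit)
    show "L1_translation_continuous (indicator (A \<inter> cball 0 (real i)))" for i
      by (rule L1_translation_continuous_indicator) auto
    show "(\<lambda>i. indicator (A \<inter> cball 0 (real i)) x) \<longlonglongrightarrow> (indicator A x :: real)" for x :: 'a
    proof (rule tendsto_eventually)
      obtain n where "norm x \<le> real n" using real_arch_simple by blast
      then show "\<forall>\<^sub>F i in sequentially. indicator (A \<inter> cball 0 (real i)) x = (indicator A x :: real)"
        by (auto simp: eventually_sequentially indicator_def intro!: exI[of _ n])
    qed
    show "integrable lborel (indicator A :: 'a \<Rightarrow> real)" using base by auto
  next
    show "(indicator (A \<inter> cball 0 (real i)) :: 'a \<Rightarrow> real) \<in> borel_measurable borel" for i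
      by (intro borel_measurable_indicator sets.Int) auto
  qed (auto simp: indicator_def)
  then show ?case using L1_translation_continuous_scale[of "indicator A" c] by simp
next
  case (add f g)
  then show ?case by (intro L1_translation_continuous_add) auto
next
  case (lim f s)
  then show ?case by (intro L1_translation_continuous_dominated_limit[of s f]) auto
qed

section \<open>Mollification and the chain rule for weak gradients\<close>

lemma has_real_derivative_axis:
  fixes f :: "real^'n \<Rightarrow> real"
  assumes "f differentiable (at (x + s *\<^sub>R axis j 1))"
  shows "((\<lambda>s. f (x + s *\<^sub>R axis j 1)) has_real_derivative partial j f (x + s *\<^sub>R axis j 1)) (at s)"
proof -
  let ?D = "frechet_derivative f (at (x + s *\<^sub>R axis j 1))"
  have 1: "(f has_derivative ?D) (at (x + s *\<^sub>R axis j 1))"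
    using assms by (simp add: frechet_derivative_works)
  have 2: "((\<lambda>s. x + s *\<^sub>R axis j 1) has_derivative (\<lambda>h. h *\<^sub>R axis j (1::real))) (at s)"
    by (auto intro!: derivative_eq_intros)
  have "((\<lambda>s. f (x + s *\<^sub>R axis j 1)) has_derivative (\<lambda>h. ?D (h *\<^sub>R axis j 1))) (at s)"
    using diff_chain_at[OF 2 1] by (simp add: o_def)
  moreover have "?D (h *\<^sub>R axis j 1) = h * ?D (axis j 1)" for h
    using has_derivative_linear[OF 1] by (simp add: linear_cmul)
  ultimately show ?thesis
    by (simp add: has_field_derivative_def partial_def mult.commute[of _ "frechet_derivative f _ _"])
qed

lemma partial_eq_0_outside:
  assumes "closed C" "\<And>x. x \<notin> C \<Longrightarrow> f x = 0" "x \<notin> C"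
  shows "partial j f x = 0"
proof -
  have "(f has_derivative (\<lambda>h. 0)) (at x)"
  proof (rule has_derivative_transform_within_open[where f = "\<lambda>x. 0" and s = "- C"])
    show "open (- C)" "x \<in> - C" using assms by auto
  qed (use assms in auto)
  then show ?thesis unfolding partial_def by (metis frechet_derivative_at)
qed

text \<open>The Lipschitz bound is the mean value inequality on coordinate lines. One constant
  serves all three bounds, so that later estimates carry a single letter.\<close>

lemma C1_compact_support_bounds:
  fixes f :: "real^'n \<Rightarrow> real"
  assumes d: "\<And>x. f differentiable (at x)" and c: "continuous_on UNIV (partial j f)"
    and C: "compact C" "\<And>x. x \<notin> C \<Longrightarrow> f x = 0"
  obtains B where "B > 0" "\<And>x. \<bar>f x\<bar> \<le> B" "\<And>x. \<bar>partial j f x\<bar> \<le> B"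
    "\<And>(x::real^'n) s. \<bar>f (x + s *\<^sub>R axis j 1) - f x\<bar> \<le> B * \<bar>s\<bar>"
proof -
  have cf: "continuous_on UNIV f"
    by (simp add: continuous_at_imp_continuous_on d differentiable_imp_continuous_within)
  have "bounded (f ` C)" "bounded (partial j f ` C)"
    using C(1) by (auto intro!: compact_imp_bounded compact_continuous_image continuous_on_subset[OF cf] continuous_on_subset[OF c])
  then obtain B1 B2 where "\<forall>y\<in>f ` C. norm y \<le> B1" "\<forall>y\<in>partial j f ` C. norm y \<le> B2"
    unfolding bounded_iff by blast
  then have B1: "\<And>x. x \<in> C \<Longrightarrow> \<bar>f x\<bar> \<le> B1" and B2: "\<And>x. x \<in> C \<Longrightarrow> \<bar>partial j f x\<bar> \<le> B2"
    by auto
  define B where "B = \<bar>B1\<bar> + \<bar>B2\<bar> + 1"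
  have b1: "\<bar>f x\<bar> \<le> B" for x using B1[of x] C(2)[of x] by (cases "x \<in> C") (auto simp: B_def)
  have b2: "\<bar>partial j f x\<bar> \<le> B" for x
    using B2[of x] partial_eq_0_outside[of C f x j, OF compact_imp_closed[OF C(1)] C(2)]
    by (cases "x \<in> C") (auto simp: B_def)
  have b3: "\<bar>f (x + s *\<^sub>R axis j 1) - f x\<bar> \<le> B * \<bar>s\<bar>" for x :: "real^'n" and s :: real
    using field_differentiable_bound[of UNIV "\<lambda>s. f (x + s *\<^sub>R axis j 1)" "\<lambda>s. partial j f (x + s *\<^sub>R axis j 1)" B s 0]
      has_real_derivative_axis[OF d] b2 by (auto simp: real_norm_def)
  have "B > 0" by (auto simp: B_def)
  with b1 b2 b3 show thesis using that by blast
qed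

text \<open>Squaring the positive part removes its kink: at 0 the difference quotient is at most
  \<open>\<bar>h\<bar>\<close>. This makes the kernel below differentiable across the sphere that
  bounds its support.\<close>

lemma has_real_derivative_max_0_power2: "((\<lambda>s::real. (max 0 s)^2) has_real_derivative 2 * max 0 s) (at s)"
proof -
  consider "s > 0" | "s < 0" | "s = 0" by linarith
  then show ?thesis
  proof cases
    case 1
    have "((\<lambda>s::real. s^2) has_real_derivative 2 * s) (at s)"
      by (auto intro!: derivative_eq_intros)
    then have "((\<lambda>s::real. (max 0 s)^2) has_real_derivative 2 * s) (at s)"
      by (rule has_field_derivative_transform_within_open[where S = "{0<..}"]) (use 1 in auto)
    then show ?thesis using 1 by (simp add: max_def)
  next
    case 2
    have "((\<lambda>s::real. 0) has_real_derivative 0) (at s)" by simp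
    then have "((\<lambda>s::real. (max 0 s)^2) has_real_derivative 0) (at s)"
      by (rule has_field_derivative_transform_within_open[where S = "{..<0}"]) (use 2 in auto)
    then show ?thesis using 2 by (simp add: max_def)
  next
    case 3
    have "((\<lambda>h. (max 0 h)\<^sup>2 / h) \<longlongrightarrow> 0) (at (0::real))"
    proof (rule Lim_null_comparison)
      show "\<forall>\<^sub>F x in at (0::real). norm ((max 0 x)\<^sup>2 / x) \<le> \<bar>x\<bar>"
        by (auto simp: eventually_at_filter max_def power2_eq_square)
      show "((\<lambda>x::real. \<bar>x\<bar>) \<longlongrightarrow> 0) (at 0)" by (rule tendsto_rabs_zero) (rule tendsto_ident_at)
    qed
    then show ?thesis using 3 by (simp add: DERIV_def)
  qed
qed

text \<open>Since \<open>test_fun\<close> asks for C1 only, the squared positive part of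
  \<open>e^2 - x \<bullet> x\<close>, divided by its integral, can take the place of the usual
  exponential bump.\<close>

lemma C1_kernel_exists:
  fixes e :: real
  assumes "e > 0"
  obtains k :: "real^'n \<Rightarrow> real" where "\<And>x. k x \<ge> 0" "\<And>x. k differentiable (at x)"
    "\<And>j. continuous_on UNIV (partial j k)" "\<And>x. norm x > e \<Longrightarrow> k x = 0"
    "integrable lborel k" "(\<integral>x. k x \<partial>lborel) = 1"
proof -
  define k0 where "k0 = (\<lambda>x::real^'n. (max 0 (e^2 - x \<bullet> x))^2)"
  have der: "(k0 has_derivative (\<lambda>h. 2 * max 0 (e^2 - x \<bullet> x) * (- (2 * (x \<bullet> h))))) (at x)" for x
  proof -
    have "((\<lambda>x. e^2 - x \<bullet> x) has_derivative (\<lambda>h. - (2 * (x \<bullet> h)))) (at x)"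
      by (auto intro!: derivative_eq_intros simp: inner_commute)
    from diff_chain_at[OF this has_real_derivative_max_0_power2[unfolded has_field_derivative_def]]
    show ?thesis by (simp add: o_def k0_def)
  qed
  have cont: "continuous_on UNIV k0"
    by (auto simp: k0_def intro!: continuous_intros)
  have supp: "k0 x = 0" if "norm x > e" for x
  proof -
    have "e^2 \<le> (norm x)^2" using that assms by (intro power_mono) auto
    then show ?thesis by (simp add: k0_def power2_norm_eq_inner max_def)
  qed
  have "integrable lborel (\<lambda>x. indicator (cball 0 e) x *\<^sub>R k0 x)"
    by (rule borel_integrable_compact) (use cont in \<open>auto intro: continuous_on_subset\<close>)
  moreover have "(\<lambda>x. indicator (cball 0 e) x *\<^sub>R k0 x) = k0"
    by (rule ext) (use supp in \<open>auto simp: indicator_def\<close>)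
  ultimately have int: "integrable lborel k0" by simp
  define Z where "Z = (\<integral>x. k0 x \<partial>lborel)"
  \<comment> \<open>With zero integral the nonnegative \<open>k0\<close> would vanish almost
    everywhere, although it is positive on the whole open ball, which is not negligible.\<close>
  have "Z \<noteq> 0"
  proof
    assume "Z = 0"
    then have "AE x in lborel. k0 x = 0"
      using integral_nonneg_eq_0_iff_AE[OF int] by (simp add: Z_def k0_def)
    then have "AE x in lborel. x \<notin> ball (0::real^'n) e"
    proof eventually_elim
      case (elim x)
      show "x \<notin> ball 0 e"
      proof
        assume "x \<in> ball 0 e"
        then have "(norm x)^2 < e^2" by (intro power_strict_mono) auto
        then show False using elim by (simp add: k0_def power2_norm_eq_inner max_def)
      qed
    qed
    then have "AE x in lebesgue. x \<notin> ball (0::real^'n) e" by (rule AE_completion)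
    moreover have "ball (0::real^'n) e \<in> sets lebesgue" by (rule fmeasurableD) (rule lmeasurable_ball)
    ultimately have "ball (0::real^'n) e \<in> null_sets lebesgue"
      by (subst AE_iff_null_sets)
    then have "negligible (ball (0::real^'n) e)"
      by (simp add: negligible_iff_null_sets)
    then show False using open_not_negligible[of "ball (0::real^'n) e"] assms by auto
  qed
  moreover have "Z \<ge> 0" unfolding Z_def by (rule integral_nonneg_AE) (auto simp: k0_def)
  ultimately have "Z > 0" by simp
  define k where "k = (\<lambda>x. k0 x / Z)"
  have derk: "(k has_derivative (\<lambda>h. 2 * max 0 (e^2 - x \<bullet> x) * (- (2 * (x \<bullet> h))) / Z)) (at x)" for x
    unfolding k_def divide_inverse by (rule has_derivative_mult_left[OF der])
  have "partial j k = (\<lambda>x. 2 * max 0 (e^2 - x \<bullet> x) * (- (2 * (x \<bullet> axis j 1))) / Z)" for j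
    by (rule ext) (simp add: partial_def frechet_derivative_at[OF derk, symmetric])
  then have "continuous_on UNIV (partial j k)" for j
    using \<open>Z > 0\<close> by (auto intro!: continuous_intros)
  moreover have "(\<integral>x. k x \<partial>lborel) = 1" using \<open>Z > 0\<close> by (simp add: k_def flip: Z_def)
  moreover have "k x \<ge> 0" for x using \<open>Z > 0\<close> by (simp add: k_def k0_def)
  moreover have "k differentiable (at x)" for x using derk by (rule differentiableI)
  moreover have "k x = 0" if "norm x > e" for x using supp[OF that] by (simp add: k_def)
  moreover have "integrable lborel k" unfolding k_def using int by simp
  ultimately show thesis by (intro that[of k])
qed

section \<open>Approximation in L1 by mollification\<close>

text \<open>As \<open>k\<close> has integral 1, the error at \<open>x\<close> is the average of
  \<open>f (y + x) - f x\<close> against \<open>k y\<close>. Exchanging the integrals turns its L1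
  norm into an average of translation moduli of \<open>f\<close>, each at most \<open>c\<close> on
  the support of \<open>k\<close>.\<close>

lemma mollify_L1_close:
  fixes f :: "'a::euclidean_space \<Rightarrow> real"
  assumes f: "integrable lborel f" and k0: "\<And>x. k x \<ge> 0" and kb: "\<And>x. k x \<le> B"
    and km: "continuous_on UNIV k" and ki: "integrable lborel k" "(\<integral>x. k x \<partial>lborel) = 1"
    and ks: "\<And>x. norm x > d \<Longrightarrow> k x = 0"
    and close: "\<And>h. norm h \<le> d \<Longrightarrow> (\<integral>\<^sup>+x. ennreal \<bar>f (x + h) - f x\<bar> \<partial>lborel) \<le> ennreal c"
  shows "(\<lambda>x. \<integral>y. f y * k (y - x) \<partial>lborel) \<in> borel_measurable borel"
    and "(\<integral>\<^sup>+x. ennreal \<bar>(\<integral>y. f y * k (y - x) \<partial>lborel) - f x\<bar> \<partial>lborel) \<le> ennreal c"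
proof -
  have fm[measurable]: "f \<in> borel_measurable borel" using f by auto
  have km[measurable]: "k \<in> borel_measurable borel" using km by (rule borel_measurable_continuous_onI)
  show "(\<lambda>x. \<integral>y. f y * k (y - x) \<partial>lborel) \<in> borel_measurable borel"
    by measurable
  have i1: "integrable lborel (\<lambda>y. f y * k (y - x))" for x
    by (rule Bochner_Integration.integrable_bound[where f = "\<lambda>y. B * f y"])
       (use f k0 kb in \<open>auto simp: abs_mult mult.commute[of "\<bar>f _\<bar>"] intro!: mult_right_mono AE_I2 order_trans[OF kb abs_ge_self]\<close>)
  have i2: "integrable lborel (\<lambda>y. f (y + x) * k y)" for x
    using integrable_lborel_translation(1)[OF i1[of x], of x] by simp
  have eq: "(\<integral>y. f y * k (y - x) \<partial>lborel) - f x = (\<integral>y. (f (y + x) - f x) * k y \<partial>lborel)" for x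
  proof -
    have "(\<integral>y. f y * k (y - x) \<partial>lborel) = (\<integral>y. f (y + x) * k y \<partial>lborel)"
      using integrable_lborel_translation(2)[OF i1[of x], of x] by simp
    moreover have "f x = (\<integral>y. f x * k y \<partial>lborel)" using ki by simp
    ultimately show ?thesis using i2[of x] ki by (simp add: left_diff_distrib)
  qed
  have "(\<integral>\<^sup>+x. ennreal \<bar>(\<integral>y. f y * k (y - x) \<partial>lborel) - f x\<bar> \<partial>lborel)
    \<le> (\<integral>\<^sup>+x. \<integral>\<^sup>+y. ennreal (\<bar>f (y + x) - f x\<bar> * k y) \<partial>lborel \<partial>lborel)"
  proof (rule nn_integral_mono)
    fix x
    have "integrable lborel (\<lambda>y. (f (y + x) - f x) * k y)"
      using i2[of x] ki by (simp add: left_diff_distrib)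
    from integral_norm_bound_ennreal[OF this]
    show "ennreal \<bar>(\<integral>y. f y * k (y - x) \<partial>lborel) - f x\<bar> \<le> (\<integral>\<^sup>+y. ennreal (\<bar>f (y + x) - f x\<bar> * k y) \<partial>lborel)"
      using k0 by (simp add: eq abs_mult)
  qed
  also have "\<dots> = (\<integral>\<^sup>+y. \<integral>\<^sup>+x. ennreal (\<bar>f (y + x) - f x\<bar> * k y) \<partial>lborel \<partial>lborel)"
    by (rule lborel_pair.Fubini') simp
  also have "\<dots> = (\<integral>\<^sup>+y. ennreal (k y) * (\<integral>\<^sup>+x. ennreal \<bar>f (x + y) - f x\<bar> \<partial>lborel) \<partial>lborel)"
  proof (rule nn_integral_cong)
    fix y
    show "(\<integral>\<^sup>+x. ennreal (\<bar>f (y + x) - f x\<bar> * k y) \<partial>lborel) = ennreal (k y) * (\<integral>\<^sup>+x. ennreal \<bar>f (x + y) - f x\<bar> \<partial>lborel)"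
      using k0 by (simp add: nn_integral_cmult[symmetric] ennreal_mult add.commute mult.commute)
  qed
  also have "\<dots> \<le> (\<integral>\<^sup>+y. ennreal (k y) * ennreal c \<partial>lborel)"
  proof (rule nn_integral_mono)
    fix y
    show "ennreal (k y) * (\<integral>\<^sup>+x. ennreal \<bar>f (x + y) - f x\<bar> \<partial>lborel) \<le> ennreal (k y) * ennreal c"
      using close[of y] ks[of y] by (cases "norm y \<le> d") (auto intro: mult_left_mono)
  qed
  also have "\<dots> = (\<integral>\<^sup>+y. ennreal (k y) \<partial>lborel) * ennreal c"
    by (rule nn_integral_multc) simp
  also have "(\<integral>\<^sup>+y. ennreal (k y) \<partial>lborel) = 1"
    using ki k0 by (subst nn_integral_eq_integral) auto
  finally show "(\<integral>\<^sup>+x. ennreal \<bar>(\<integral>y. f y * k (y - x) \<partial>lborel) - f x\<bar> \<partial>lborel) \<le> ennreal c"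
    by simp
qed

text \<open>Dominated convergence of the difference quotients along sequences. A Lipschitz bound
  relative to the base point 0, with integrable constant \<open>w x\<close>, is the
  domination.\<close>

lemma has_real_derivative_under_integral:
  fixes f :: "real \<Rightarrow> 'a \<Rightarrow> real"
  assumes int: "\<And>s. \<bar>s\<bar> \<le> 1 \<Longrightarrow> integrable M (f s)" and w: "integrable M w"
    and lip: "\<And>s x. \<bar>s\<bar> \<le> 1 \<Longrightarrow> x \<in> space M \<Longrightarrow> \<bar>f s x - f 0 x\<bar> \<le> \<bar>s\<bar> * w x"
    and der: "\<And>x. x \<in> space M \<Longrightarrow> ((\<lambda>s. f s x) has_real_derivative f' x) (at 0)"
    and f'm: "f' \<in> borel_measurable M"
  shows "((\<lambda>s. \<integral>x. f s x \<partial>M) has_real_derivative (\<integral>x. f' x \<partial>M)) (at 0)"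
proof -
  have "((\<lambda>h. ((\<integral>x. f h x \<partial>M) - (\<integral>x. f 0 x \<partial>M)) / h) \<longlongrightarrow> (\<integral>x. f' x \<partial>M)) (at 0)"
    unfolding tendsto_at_iff_sequentially
  proof (intro allI impI)
    fix X :: "nat \<Rightarrow> real" assume X: "\<forall>i. X i \<in> UNIV - {0}" "X \<longlonglongrightarrow> 0"
    then have "\<forall>\<^sub>F n in sequentially. \<bar>X n\<bar> < 1"
      using order_tendstoD(2)[OF tendsto_rabs[OF X(2)], of 1] by simp
    then obtain N where N: "\<And>n. n \<ge> N \<Longrightarrow> \<bar>X n\<bar> \<le> 1"
      unfolding eventually_sequentially using less_imp_le by blast
    define Y where "Y = (\<lambda>n. X (n + N))"
    have Y: "Y \<longlonglongrightarrow> 0" "\<And>n. \<bar>Y n\<bar> \<le> 1" "\<And>n. Y n \<noteq> 0"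
      using X N by (auto simp: Y_def intro: LIMSEQ_ignore_initial_segment)
    have "(\<lambda>n. \<integral>x. (f (Y n) x - f 0 x) / Y n \<partial>M) \<longlonglongrightarrow> (\<integral>x. f' x \<partial>M)"
    proof (rule integral_dominated_convergence[OF f'm _ w])
      show "(\<lambda>x. (f (Y n) x - f 0 x) / Y n) \<in> borel_measurable M" for n
        using int[OF Y(2)[of n]] int[of 0] by (auto dest: borel_measurable_integrable)
      show "AE x in M. (\<lambda>n. (f (Y n) x - f 0 x) / Y n) \<longlonglongrightarrow> f' x"
      proof (rule AE_I2)
        fix x assume "x \<in> space M"
        then have "((\<lambda>h. (f h x - f 0 x) / h) \<longlongrightarrow> f' x) (at 0)"
          using der[of x] by (simp add: DERIV_def)
        then show "(\<lambda>n. (f (Y n) x - f 0 x) / Y n) \<longlonglongrightarrow> f' x"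
          using Y unfolding tendsto_at_iff_sequentially by (auto simp: o_def)
      qed
      show "AE x in M. norm ((f (Y n) x - f 0 x) / Y n) \<le> w x" for n
        using lip[OF Y(2)[of n]] Y(3)[of n]
        by (intro AE_I2) (simp add: abs_mult divide_le_eq mult.commute)
    qed
    moreover have "(\<integral>x. (f (Y n) x - f 0 x) / Y n \<partial>M) = ((\<integral>x. f (Y n) x \<partial>M) - (\<integral>x. f 0 x \<partial>M)) / Y n" for n
      using int[OF Y(2)[of n]] int[of 0] by (simp del: divide_eq_eq div_by_0)
    ultimately have "(\<lambda>n. ((\<integral>x. f (Y n) x \<partial>M) - (\<integral>x. f 0 x \<partial>M)) / Y n) \<longlonglongrightarrow> (\<integral>x. f' x \<partial>M)"
      by (simp only:)
    then have "(\<lambda>n. ((\<lambda>h. ((\<integral>x. f h x \<partial>M) - (\<integral>x. f 0 x \<partial>M)) / h) \<circ> X) (n + N)) \<longlonglongrightarrow> (\<integral>x. f' x \<partial>M)"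
      by (simp add: Y_def)
    then show "((\<lambda>h. ((\<integral>x. f h x \<partial>M) - (\<integral>x. f 0 x \<partial>M)) / h) \<circ> X) \<longlonglongrightarrow> (\<integral>x. f' x \<partial>M)"
      by (rule LIMSEQ_offset)
  qed
  then show ?thesis by (simp add: DERIV_def)
qed

text \<open>A local Meyers-Serrin approximation. For \<open>x\<close> in \<open>C\<close> the
  shifted kernel is supported in a ball inside \<open>\<Omega>\<close>, hence is a test function,
  and the weak identity says that the classical derivative \<open>D\<close> of the mollified
  \<open>U\<close> is the mollified \<open>g\<close>. The constant \<open>L\<close> may blow up as
  \<open>e\<close> tends to 0; it is only used for one approximant at a time.\<close>

lemma weak_derivative_mollify:
  fixes U g :: "real^'n \<Rightarrow> real"
  assumes U: "integrable lborel U" and g: "integrable lborel g" and "e > 0"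
    and C: "compact C" "C \<subseteq> \<Omega>" "open \<Omega>"
    and weak: "\<And>\<psi>. test_fun \<Omega> \<psi> \<Longrightarrow> (\<integral>x. U x * partial j \<psi> x \<partial>lborel) = - (\<integral>x. g x * \<psi> x \<partial>lborel)"
  shows "\<exists>u G D L. u \<in> borel_measurable borel \<and> G \<in> borel_measurable borel \<and>
      (\<integral>\<^sup>+x. ennreal \<bar>u x - U x\<bar> \<partial>lborel) \<le> ennreal e \<and>
      (\<integral>\<^sup>+x. ennreal \<bar>G x - g x\<bar> \<partial>lborel) \<le> ennreal e \<and>
      (\<forall>x. ((\<lambda>s. u (x + s *\<^sub>R axis j 1)) has_real_derivative D x) (at 0)) \<and>
      (\<forall>x\<in>C. D x = G x) \<and> (\<forall>x s. \<bar>u (x + s *\<^sub>R axis j 1) - u x\<bar> \<le> L * \<bar>s\<bar>)"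
proof -
  obtain d0 where "d0 > 0" and d0: "(\<Union>x\<in>C. cball x d0) \<subseteq> \<Omega>"
    using compact_subset_open_imp_cball_epsilon_subset[OF C(1) C(3) C(2)] by metis
  from integrable_imp_L1_translation_continuous[OF U] \<open>e > 0\<close> obtain d1 where "d1 > 0"
    and d1: "\<And>h. norm h < d1 \<Longrightarrow> (\<integral>\<^sup>+x. ennreal \<bar>U (x + h) - U x\<bar> \<partial>lborel) \<le> ennreal e"
    unfolding L1_translation_continuous_def by meson
  from integrable_imp_L1_translation_continuous[OF g] \<open>e > 0\<close> obtain d2 where "d2 > 0"
    and d2: "\<And>h. norm h < d2 \<Longrightarrow> (\<integral>\<^sup>+x. ennreal \<bar>g (x + h) - g x\<bar> \<partial>lborel) \<le> ennreal e"
    unfolding L1_translation_continuous_def by meson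
  \<comment> \<open>The kernel lives on a closed ball while the translation estimates ask for strict
    inequality; halving gives \<open>d < d1\<close> and \<open>d < d2\<close>.\<close>
  define d where "d = min d0 (min d1 d2) / 2"
  have d: "d > 0" "d \<le> d0" "d < d1" "d < d2" using \<open>d0 > 0\<close> \<open>d1 > 0\<close> \<open>d2 > 0\<close> by (auto simp: d_def)
  obtain k :: "real^'n \<Rightarrow> real" where k: "\<And>x. k x \<ge> 0" "\<And>x. k differentiable (at x)"
    "\<And>j. continuous_on UNIV (partial j k)" "\<And>x. norm x > d \<Longrightarrow> k x = 0"
    "integrable lborel k" "(\<integral>x. k x \<partial>lborel) = 1"
    using C1_kernel_exists[OF d(1)] by metis
  have k0: "k x = 0" if "x \<notin> cball 0 d" for x using k(4)[of x] that by auto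
  obtain B where "B > 0" and B: "\<And>x. \<bar>k x\<bar> \<le> B" "\<And>x. \<bar>partial j k x\<bar> \<le> B"
    "\<And>x s. \<bar>k (x + s *\<^sub>R axis j 1) - k x\<bar> \<le> B * \<bar>s\<bar>"
    by (rule C1_compact_support_bounds[where f = k and j = j, OF k(2) k(3) compact_cball k0]) blast+
  have kc: "continuous_on UNIV k"
    by (simp add: continuous_at_imp_continuous_on k(2) differentiable_imp_continuous_within)
  have km[measurable]: "k \<in> borel_measurable borel" "partial j k \<in> borel_measurable borel"
    using kc k(3) by (auto intro: borel_measurable_continuous_onI)
  have Um[measurable]: "U \<in> borel_measurable borel" using U by auto
  have kB: "k x \<le> B" for x using B(1)[of x] by simp
  define u where "u = (\<lambda>x. \<integral>y. U y * k (y - x) \<partial>lborel)"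
  define G where "G = (\<lambda>x. \<integral>y. g y * k (y - x) \<partial>lborel)"
  \<comment> \<open>Differentiating \<open>k (y - x)\<close> in \<open>x\<close> brings a minus
    sign, which cancels the one in the weak identity.\<close>
  define D where "D = (\<lambda>x. \<integral>y. U y * (- partial j k (y - x)) \<partial>lborel)"
  define L where "L = B * (\<integral>y. \<bar>U y\<bar> \<partial>lborel)"
  have u: "u \<in> borel_measurable borel" "(\<integral>\<^sup>+x. ennreal \<bar>u x - U x\<bar> \<partial>lborel) \<le> ennreal e"
    unfolding u_def using d by (auto intro!: mollify_L1_close[OF U k(1) kB kc k(5,6,4)] d1)
  have G: "G \<in> borel_measurable borel" "(\<integral>\<^sup>+x. ennreal \<bar>G x - g x\<bar> \<partial>lborel) \<le> ennreal e"
    unfolding G_def using d by (auto intro!: mollify_L1_close[OF g k(1) kB kc k(5,6,4)] d2)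
  have int: "integrable lborel (\<lambda>y. U y * k (y - x))" for x
    by (rule Bochner_Integration.integrable_bound[where f = "\<lambda>y. B * U y"])
       (use U B \<open>B > 0\<close> in \<open>auto simp: abs_mult mult.commute[of "\<bar>U _\<bar>"] intro!: mult_right_mono AE_I2\<close>)
  have lip: "\<bar>U y * k (y - (x + s *\<^sub>R axis j 1)) - U y * k (y - x)\<bar> \<le> \<bar>s\<bar> * (B * \<bar>U y\<bar>)" for x y s
  proof -
    have "\<bar>k (y - (x + s *\<^sub>R axis j 1)) - k (y - x)\<bar> \<le> B * \<bar>s\<bar>"
      using B(3)[of "y - x" "-s"] by (simp add: algebra_simps)
    then have "\<bar>U y\<bar> * \<bar>k (y - (x + s *\<^sub>R axis j 1)) - k (y - x)\<bar> \<le> \<bar>U y\<bar> * (B * \<bar>s\<bar>)"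
      by (rule mult_left_mono) simp
    then show ?thesis by (simp add: abs_mult mult_ac flip: right_diff_distrib)
  qed
  have iw: "integrable lborel (\<lambda>y. B * \<bar>U y\<bar>)" using U by auto
  have der: "((\<lambda>s. u (x + s *\<^sub>R axis j 1)) has_real_derivative D x) (at 0)" for x
    unfolding u_def D_def
  proof (rule has_real_derivative_under_integral[OF int iw])
    show "\<bar>U y * k (y - (x + s *\<^sub>R axis j 1)) - U y * k (y - (x + 0 *\<^sub>R axis j 1))\<bar> \<le> \<bar>s\<bar> * (B * \<bar>U y\<bar>)" for s y
      using lip[of y x s] by simp
    show "((\<lambda>s. U y * k (y - (x + s *\<^sub>R axis j 1))) has_real_derivative U y * - partial j k (y - x)) (at 0)" for y
    proof -
      have 1: "((\<lambda>s. k ((y - x) + s *\<^sub>R axis j 1)) has_real_derivative partial j k (y - x)) (at (- 0))"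
        using has_real_derivative_axis[of k "y - x" 0 j] k(2) by simp
      have "((\<lambda>s. k ((y - x) + (- s) *\<^sub>R axis j 1)) has_real_derivative - partial j k (y - x)) (at 0)"
        by (rule DERIV_mirror[THEN iffD1, OF 1])
      from DERIV_cmult[OF this, of "U y"] show ?thesis by (simp add: algebra_simps)
    qed
  qed measurable
  have DG: "D x = G x" if "x \<in> C" for x
  proof -
    let ?\<psi> = "\<lambda>y. k (y - x)"
    have hd: "(?\<psi> has_derivative frechet_derivative k (at (y - x))) (at y)" for y
    proof -
      have "((\<lambda>y. y - x) has_derivative (\<lambda>h. h)) (at y)" by (auto intro!: derivative_eq_intros)
      from diff_chain_at[OF this, of k] k(2)[of "y - x"] show ?thesis
        by (simp add: frechet_derivative_works o_def)
    qed
    then have p: "partial i ?\<psi> y = partial i k (y - x)" for i y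
      unfolding partial_def by (metis frechet_derivative_at)
    have "test_fun \<Omega> ?\<psi>"
      unfolding test_fun_def
    proof (intro conjI allI exI)
      show "?\<psi> differentiable (at y)" for y using hd by (auto simp: differentiable_def)
      show "continuous_on UNIV (partial i ?\<psi>)" for i
      proof -
        have "partial i ?\<psi> = (\<lambda>y. partial i k (y - x))" using p by auto
        moreover have "continuous_on UNIV (\<lambda>y. partial i k (y - x))"
          by (rule continuous_on_compose2[OF k(3)[of i]]) (auto intro!: continuous_intros)
        ultimately show ?thesis by simp
      qed
      show "compact (cball x d)" by simp
      show "cball x d \<subseteq> \<Omega>"
      proof
        fix y assume "y \<in> cball x d"
        then have "y \<in> cball x d0" using d by auto
        then show "y \<in> \<Omega>" using d0 that by blast
      qed
      show "y \<notin> cball x d \<longrightarrow> ?\<psi> y = 0" for y using k(4)[of "y - x"] by (auto simp: dist_norm norm_minus_commute)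
    qed
    from weak[OF this] show ?thesis by (simp add: D_def G_def p)
  qed
  have L: "\<bar>u (x + s *\<^sub>R axis j 1) - u x\<bar> \<le> L * \<bar>s\<bar>" for x s
  proof -
    have "\<bar>u (x + s *\<^sub>R axis j 1) - u x\<bar> = \<bar>\<integral>y. U y * k (y - (x + s *\<^sub>R axis j 1)) - U y * k (y - x) \<partial>lborel\<bar>"
      using int by (simp add: u_def)
    also have "\<dots> \<le> (\<integral>y. \<bar>U y * k (y - (x + s *\<^sub>R axis j 1)) - U y * k (y - x)\<bar> \<partial>lborel)"
      by (rule integral_abs_bound)
    also have "\<dots> \<le> (\<integral>y. \<bar>s\<bar> * (B * \<bar>U y\<bar>) \<partial>lborel)"
      using lip int iw by (intro integral_mono) auto
    also have "\<dots> = L * \<bar>s\<bar>" by (simp add: L_def)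
    finally show ?thesis .
  qed
  show ?thesis using u G der DG L by blast
qed

section \<open>Integration by parts and the chain rule on the whole space\<close>

text \<open>The integral of a translate of \<open>H\<close> does not depend on the shift.
  Differentiating it under the integral at shift 0 yields the integral of \<open>H'\<close>, which
  is therefore 0. Applied to a product this is integration by parts.\<close>

lemma integral_derivative_along_axis_eq_0:
  fixes H :: "real^'n \<Rightarrow> real"
  assumes m: "H \<in> borel_measurable borel" and C: "compact C" "\<And>x. x \<notin> C \<Longrightarrow> H x = 0"
    and bounded: "\<And>x. \<bar>H x\<bar> \<le> L"
    and lip: "\<And>x s. \<bar>H (x + s *\<^sub>R axis j 1) - H x\<bar> \<le> L * \<bar>s\<bar>"
    and der: "\<And>x. ((\<lambda>s. H (x + s *\<^sub>R axis j 1)) has_real_derivative H' x) (at 0)"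
    and H': "H' \<in> borel_measurable borel"
  shows "(\<integral>x. H' x \<partial>lborel) = 0"
proof -
  have "bounded C" using C by (simp add: compact_imp_bounded)
  then obtain R where R: "\<And>x. x \<in> C \<Longrightarrow> norm x \<le> R" unfolding bounded_iff by blast
  have Hint: "integrable lborel H"
  proof (rule Bochner_Integration.integrable_bound[where f = "\<lambda>x. L * indicator C x"])
    show "integrable lborel (\<lambda>x. L * indicator C x)"
      using emeasure_bounded_finite[OF \<open>bounded C\<close>] C(1)
      by (intro integrable_mult_right integrable_real_indicator) (simp_all add: borel_compact)
    show "H \<in> borel_measurable lborel" using m by simp
    show "AE x in lborel. norm (H x) \<le> norm (L * indicator C x)"
    proof (rule AE_I2)
      fix x show "norm (H x) \<le> norm (L * indicator C x)"
        using bounded[of x] C(2)[of x] by (cases "x \<in> C") auto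
    qed
  qed
  \<comment> \<open>For shifts of length at most 1, both points lie outside \<open>C\<close> once
    \<open>norm x > R + 1\<close>; hence a multiple of the indicator of a ball dominates the
    differences.\<close>
  have zero: "H (x + s *\<^sub>R axis j 1) - H x = 0" if "norm x > R + 1" "\<bar>s\<bar> \<le> 1" for x s
  proof -
    have "norm (s *\<^sub>R axis j (1::real)) \<le> 1" using that by (simp add: norm_axis_1)
    then have "norm (x + s *\<^sub>R axis j 1) > R" using that norm_triangle_ineq2[of x "- (s *\<^sub>R axis j 1)"] by simp
    then have "x + s *\<^sub>R axis j 1 \<notin> C" "x \<notin> C" using R[of "x + s *\<^sub>R axis j 1"] R[of x] that by auto
    then show ?thesis by (simp add: C)
  qed
  have "((\<lambda>s. \<integral>x. H (x + s *\<^sub>R axis j 1) \<partial>lborel) has_real_derivative (\<integral>x. H' x \<partial>lborel)) (at 0)"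
  proof (rule has_real_derivative_under_integral)
    show "integrable lborel (\<lambda>x. H (x + s *\<^sub>R axis j 1))" for s
      by (rule integrable_lborel_translation(1)[OF Hint])
    show "integrable lborel (\<lambda>x. L * indicator (cball (0::real^'n) (R + 1)) x)"
      using emeasure_bounded_finite[of "cball (0::real^'n) (R + 1)"]
      by (intro integrable_mult_right integrable_real_indicator) simp_all
    show "\<bar>H (x + s *\<^sub>R axis j 1) - H (x + 0 *\<^sub>R axis j 1)\<bar> \<le> \<bar>s\<bar> * (L * indicator (cball 0 (R + 1)) x)"
      if "\<bar>s\<bar> \<le> 1" for s x
      using zero[of x s] that lip[of x s] by (cases "norm x > R + 1") (auto simp: indicator_def mult.commute)
  qed (use der H' in auto)
  moreover have "(\<lambda>s. \<integral>x. H (x + s *\<^sub>R axis j 1) \<partial>lborel) = (\<lambda>s. \<integral>x. H x \<partial>lborel)"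
    using integrable_lborel_translation(2)[OF Hint] by auto
  ultimately show ?thesis using DERIV_unique[OF _ DERIV_const] by simp
qed

lemma integral_le_if_nn_integral_le:
  fixes f :: "'a \<Rightarrow> real"
  assumes "f \<in> borel_measurable M" "(\<integral>\<^sup>+x. ennreal \<bar>f x\<bar> \<partial>M) \<le> ennreal e" "e \<ge> 0"
  shows "integrable M f" "(\<integral>x. \<bar>f x\<bar> \<partial>M) \<le> e"
proof -
  show int: "integrable M f"
    using assms(1,2) by (intro integrableI_bounded) (auto intro: le_less_trans)
  then have "ennreal (\<integral>x. \<bar>f x\<bar> \<partial>M) \<le> ennreal e"
    using assms(2) by (subst (asm) nn_integral_eq_integral) auto
  then show "(\<integral>x. \<bar>f x\<bar> \<partial>M) \<le> e" using assms(3) by simp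
qed

text \<open>For the mollified functions the classical chain rule and integration by parts apply; the
  identity then passes to the limit. The bounds on \<open>\<phi>\<close> and \<open>\<phi>'\<close>
  provide the integrable majorants.\<close>

lemma weak_derivative_compose_lborel:
  fixes U g :: "real^'n \<Rightarrow> real" and \<phi> \<phi>' :: "real \<Rightarrow> real"
  assumes U: "integrable lborel U" and g: "integrable lborel g" and "open \<Omega>"
    and weak: "\<And>\<psi>. test_fun \<Omega> \<psi> \<Longrightarrow> (\<integral>x. U x * partial j \<psi> x \<partial>lborel) = - (\<integral>x. g x * \<psi> x \<partial>lborel)"
    and \<phi>: "\<And>s. (\<phi> has_real_derivative \<phi>' s) (at s)" "continuous_on UNIV \<phi>'"
    and B: "\<And>s. \<bar>\<phi> s\<bar> \<le> B" "\<And>s. \<bar>\<phi>' s\<bar> \<le> B"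
    and \<eta>: "test_fun \<Omega> \<eta>"
  shows "(\<integral>x. \<phi> (U x) * partial j \<eta> x \<partial>lborel) = - (\<integral>x. \<phi>' (U x) * g x * \<eta> x \<partial>lborel)"
proof -
  have \<eta>d: "\<And>x. \<eta> differentiable (at x)" and \<eta>c: "\<And>j. continuous_on UNIV (partial j \<eta>)"
    using \<eta> by (auto simp: test_fun_def)
  obtain C where C: "compact C" "C \<subseteq> \<Omega>" "\<And>x. x \<notin> C \<Longrightarrow> \<eta> x = 0"
    using \<eta> unfolding test_fun_def by blast
  have p0: "partial j \<eta> x = 0" if "x \<notin> C" for x
    by (rule partial_eq_0_outside[OF compact_imp_closed[OF C(1)] C(3) that])
  obtain N where "N > 0" and N: "\<And>x. \<bar>\<eta> x\<bar> \<le> N" "\<And>x. \<bar>partial j \<eta> x\<bar> \<le> N"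
    "\<And>(x::real^'n) s. \<bar>\<eta> (x + s *\<^sub>R axis j 1) - \<eta> x\<bar> \<le> N * \<bar>s\<bar>"
    by (rule C1_compact_support_bounds[where f = \<eta> and j = j, OF \<eta>d \<eta>c C(1) C(3)]) blast+
  have [measurable]: "U \<in> borel_measurable borel" "g \<in> borel_measurable borel" using U g by auto
  have \<eta>cont: "continuous_on UNIV \<eta>"
    by (simp add: continuous_at_imp_continuous_on \<eta>d differentiable_imp_continuous_within)
  have \<phi>cont: "continuous_on UNIV \<phi>"
    using \<phi>(1) by (meson DERIV_isCont continuous_at_imp_continuous_on)
  have [measurable]: "\<eta> \<in> borel_measurable borel" "partial j \<eta> \<in> borel_measurable borel"
    "\<phi> \<in> borel_measurable borel" "\<phi>' \<in> borel_measurable borel"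
    using \<eta>cont \<eta>c \<phi>cont \<phi>(2) by (auto intro: borel_measurable_continuous_onI)
  have B0: "B \<ge> 0" using B(1)[of 0] by simp
  have \<phi>lip: "\<bar>\<phi> s - \<phi> t\<bar> \<le> B * \<bar>s - t\<bar>" for s t
    using field_differentiable_bound[of UNIV \<phi> \<phi>' B s t] \<phi>(1) B(2) by simp
  \<comment> \<open>\<open>Q\<close> bundles everything a mollification at precision
    \<open>1 / (n + 1)\<close> provides, so that one use of choice yields the whole
    sequence.\<close>
  define Q where "Q n u G D L \<longleftrightarrow> u \<in> borel_measurable borel \<and> G \<in> borel_measurable borel \<and>
      (\<integral>\<^sup>+x. ennreal \<bar>u x - U x\<bar> \<partial>lborel) \<le> ennreal (1 / real (Suc n)) \<and>
      (\<integral>\<^sup>+x. ennreal \<bar>G x - g x\<bar> \<partial>lborel) \<le> ennreal (1 / real (Suc n)) \<and>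
      (\<forall>x. ((\<lambda>s. u (x + s *\<^sub>R axis j 1)) has_real_derivative D x) (at 0)) \<and>
      (\<forall>x\<in>C. D x = G x) \<and> (\<forall>x s. \<bar>u (x + s *\<^sub>R axis j 1) - u x\<bar> \<le> L * \<bar>s\<bar>)"
    for n u G D L
  have "\<forall>n. \<exists>u G D L. Q n u G D L"
    using weak_derivative_mollify[OF U g _ C(1,2) \<open>open \<Omega>\<close> weak] unfolding Q_def by simp
  then obtain u G D L where Q: "\<forall>n. Q n (u n) (G n) (D n) (L n)"
    by (simp only: choice_iff) (elim exE)
  have um[measurable]: "u n \<in> borel_measurable borel" and Gm[measurable]: "G n \<in> borel_measurable borel"
    and uU: "(\<integral>\<^sup>+x. ennreal \<bar>u n x - U x\<bar> \<partial>lborel) \<le> ennreal (1 / real (Suc n))"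
    and Gg: "(\<integral>\<^sup>+x. ennreal \<bar>G n x - g x\<bar> \<partial>lborel) \<le> ennreal (1 / real (Suc n))" for n
    using spec[OF Q, of n] unfolding Q_def by simp_all
  have du: "((\<lambda>s. u n (x + s *\<^sub>R axis j 1)) has_real_derivative D n x) (at 0)" for n x
    using spec[OF Q, of n] unfolding Q_def by simp
  have DG: "D n x = G n x" if "x \<in> C" for n x
    using spec[OF Q, of n] that unfolding Q_def by simp
  have uL: "\<bar>u n (x + s *\<^sub>R axis j 1) - u n x\<bar> \<le> L n * \<bar>s\<bar>" for n x s
    using spec[OF Q, of n] unfolding Q_def by simp
  have int_uU: "integrable lborel (\<lambda>x. u n x - U x)" "(\<integral>x. \<bar>u n x - U x\<bar> \<partial>lborel) \<le> 1 / real (Suc n)" for n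
    by (rule integral_le_if_nn_integral_le[OF _ uU[of n]]; simp)+
  have int_Gg: "integrable lborel (\<lambda>x. G n x - g x)" "(\<integral>x. \<bar>G n x - g x\<bar> \<partial>lborel) \<le> 1 / real (Suc n)" for n
    by (rule integral_le_if_nn_integral_le[OF _ Gg[of n]]; simp)+
  have intC: "integrable lborel (\<lambda>x. K * indicator C x)" for K :: real
    using emeasure_bounded_finite[OF compact_imp_bounded[OF C(1)]] C(1)
    by (intro integrable_mult_right integrable_real_indicator) (simp_all add: borel_compact)
  have int1: "integrable lborel (\<lambda>x. \<phi> (f x) * partial j \<eta> x)" if [measurable]: "f \<in> borel_measurable borel" for f
  proof (rule Bochner_Integration.integrable_bound[OF intC[of "B * N"]])
    show "AE x in lborel. norm (\<phi> (f x) * partial j \<eta> x) \<le> norm (B * N * indicator C x)"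
    proof (rule AE_I2)
      fix x show "norm (\<phi> (f x) * partial j \<eta> x) \<le> norm (B * N * indicator C x)"
        using mult_mono[OF B(1)[of "f x"] N(2)[of x]] B0 \<open>N > 0\<close> p0[of x]
        by (cases "x \<in> C") (auto simp: abs_mult)
    qed
  qed simp
  have le2: "\<bar>\<phi>' (f x) * h x * \<eta> x\<bar> \<le> B * N * \<bar>h x\<bar>" for f h :: "real^'n \<Rightarrow> real" and x
  proof -
    have "\<bar>\<phi>' (f x)\<bar> * \<bar>\<eta> x\<bar> \<le> B * N" using B0 by (intro mult_mono B N) auto
    then have "\<bar>\<phi>' (f x)\<bar> * \<bar>\<eta> x\<bar> * \<bar>h x\<bar> \<le> B * N * \<bar>h x\<bar>" by (rule mult_right_mono) simp
    then show ?thesis by (simp add: abs_mult mult_ac)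
  qed
  have int2: "integrable lborel (\<lambda>x. \<phi>' (f x) * h x * \<eta> x)"
    if [measurable]: "f \<in> borel_measurable borel" and h: "integrable lborel h" for f h
  proof (rule Bochner_Integration.integrable_bound[where f = "\<lambda>x. B * N * \<bar>h x\<bar>"])
    have [measurable]: "h \<in> borel_measurable borel" using h by auto
    show "(\<lambda>x. \<phi>' (f x) * h x * \<eta> x) \<in> borel_measurable lborel" by simp
    show "integrable lborel (\<lambda>x. B * N * \<bar>h x\<bar>)" using h by auto
    show "AE x in lborel. norm (\<phi>' (f x) * h x * \<eta> x) \<le> norm (B * N * \<bar>h x\<bar>)"
      using le2[of f _ h] B0 \<open>N > 0\<close> by (intro AE_I2) (simp add: abs_mult)
  qed
  have int_G: "integrable lborel (G n)" for n
    using Bochner_Integration.integrable_add[OF int_Gg(1)[of n] g] by simp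
  have parts: "(\<integral>x. \<phi> (u n x) * partial j \<eta> x \<partial>lborel) + (\<integral>x. \<phi>' (u n x) * G n x * \<eta> x \<partial>lborel) = 0" for n
  proof -
    have "(\<integral>x. \<phi> (u n x) * partial j \<eta> x + \<phi>' (u n x) * G n x * \<eta> x \<partial>lborel) = 0"
    proof (rule integral_derivative_along_axis_eq_0[where H = "\<lambda>x. \<phi> (u n x) * \<eta> x" and L = "B * N + B * \<bar>L n\<bar> * N" and j = j])
      show "compact C" by fact
      have e1: "B * \<bar>L n\<bar> * N \<ge> 0" using B0 \<open>N > 0\<close> by simp
      show "\<bar>\<phi> (u n x) * \<eta> x\<bar> \<le> B * N + B * \<bar>L n\<bar> * N" for x
        using mult_mono[OF B(1)[of "u n x"] N(1)[of x]] B0 e1 by (simp add: abs_mult)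
      show "\<bar>\<phi> (u n (x + s *\<^sub>R axis j 1)) * \<eta> (x + s *\<^sub>R axis j 1) - \<phi> (u n x) * \<eta> x\<bar>
          \<le> (B * N + B * \<bar>L n\<bar> * N) * \<bar>s\<bar>" for x s
      proof -
        let ?y = "x + s *\<^sub>R axis j 1"
        have a: "\<bar>\<phi> (u n ?y) - \<phi> (u n x)\<bar> \<le> B * (\<bar>L n\<bar> * \<bar>s\<bar>)"
        proof -
          have "\<bar>u n ?y - u n x\<bar> \<le> \<bar>L n\<bar> * \<bar>s\<bar>"
            using uL[of n x s] mult_right_mono[OF abs_ge_self[of "L n"], of "\<bar>s\<bar>"] by linarith
          then show ?thesis using \<phi>lip[of "u n ?y" "u n x"] mult_left_mono[OF _ B0] by (meson order_trans)
        qed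
        have "\<phi> (u n ?y) * \<eta> ?y - \<phi> (u n x) * \<eta> x
            = (\<phi> (u n ?y) - \<phi> (u n x)) * \<eta> ?y + \<phi> (u n x) * (\<eta> ?y - \<eta> x)"
          by (simp add: algebra_simps)
        then have "\<bar>\<phi> (u n ?y) * \<eta> ?y - \<phi> (u n x) * \<eta> x\<bar>
            \<le> \<bar>\<phi> (u n ?y) - \<phi> (u n x)\<bar> * \<bar>\<eta> ?y\<bar> + \<bar>\<phi> (u n x)\<bar> * \<bar>\<eta> ?y - \<eta> x\<bar>"
          by (metis abs_mult abs_triangle_ineq)
        also have "\<dots> \<le> B * (\<bar>L n\<bar> * \<bar>s\<bar>) * N + B * (N * \<bar>s\<bar>)"
          using a N(1)[of ?y] B(1)[of "u n x"] N(3)[of x s] B0 by (intro add_mono mult_mono) auto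
        also have "\<dots> = (B * N + B * \<bar>L n\<bar> * N) * \<bar>s\<bar>" by (simp add: algebra_simps)
        finally show ?thesis .
      qed
      show "((\<lambda>s. \<phi> (u n (x + s *\<^sub>R axis j 1)) * \<eta> (x + s *\<^sub>R axis j 1)) has_real_derivative
          \<phi> (u n x) * partial j \<eta> x + \<phi>' (u n x) * G n x * \<eta> x) (at 0)" for x
      proof -
        have 1: "((\<lambda>s. \<phi> (u n (x + s *\<^sub>R axis j 1))) has_real_derivative \<phi>' (u n x) * D n x) (at 0)"
          using DERIV_chain2[OF _ du[of n x], of \<phi> "\<phi>' (u n x)"] \<phi>(1)[of "u n x"] by simp
        have 2: "((\<lambda>s. \<eta> (x + s *\<^sub>R axis j 1)) has_real_derivative partial j \<eta> x) (at 0)"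
          using has_real_derivative_axis[of \<eta> x 0 j] \<eta>d by simp
        \<comment> \<open>Off \<open>C\<close> the derivative of \<open>u n\<close> need not be
          \<open>G n\<close>, but there the factor \<open>\<eta>\<close> vanishes.\<close>
        have "\<eta> x = 0 \<or> D n x = G n x" using DG[of x n] C(3)[of x] by blast
        then show ?thesis by (intro DERIV_cong[OF DERIV_mult[OF 1 2]]) auto
      qed
    qed (use C(3) in auto)
    then show ?thesis
      using int1[of "u n"] int2[OF _ int_G[of n], of "u n"] by simp
  qed
  have lim0: "(\<lambda>n. 1 / real (Suc n)) \<longlonglongrightarrow> 0" by (rule LIMSEQ_Suc[OF lim_1_over_n])
  have "(\<lambda>n. \<integral>x. norm (u n x - U x) \<partial>lborel) \<longlonglongrightarrow> 0"
    by (rule Lim_null_comparison[OF _ lim0]) (use int_uU(2) in auto)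
  \<comment> \<open>The nonlinear compositions need pointwise convergence, which L1 convergence
    gives along a subsequence. Since the identity holds for every index, a subsequence determines
    the limit.\<close>
  from tendsto_L1_AE_subseq[OF int_uU(1) this] obtain r :: "nat \<Rightarrow> nat" where "strict_mono r"
    and r0: "AE x in lborel. (\<lambda>n. u (r n) x - U x) \<longlonglongrightarrow> 0" by auto
  have r: "AE x in lborel. (\<lambda>n. u (r n) x) \<longlonglongrightarrow> U x"
    using r0 by eventually_elim (simp add: LIM_zero_iff)
  have L1: "(\<lambda>n. \<integral>x. \<phi> (u (r n) x) * partial j \<eta> x \<partial>lborel) \<longlonglongrightarrow> (\<integral>x. \<phi> (U x) * partial j \<eta> x \<partial>lborel)"
  proof (rule integral_dominated_convergence[OF _ _ intC[of "B * N"]])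
    show "AE x in lborel. (\<lambda>n. \<phi> (u (r n) x) * partial j \<eta> x) \<longlonglongrightarrow> \<phi> (U x) * partial j \<eta> x"
      using r by eventually_elim
        (intro tendsto_mult tendsto_const continuous_on_tendsto_compose[OF \<phi>cont], auto)
    show "AE x in lborel. norm (\<phi> (u (r n) x) * partial j \<eta> x) \<le> B * N * indicator C x" for n
    proof (rule AE_I2)
      fix x show "norm (\<phi> (u (r n) x) * partial j \<eta> x) \<le> B * N * indicator C x"
        using mult_mono[OF B(1)[of "u (r n) x"] N(2)[of x]] B0 p0[of x]
        by (cases "x \<in> C") (auto simp: abs_mult)
    qed
  qed simp_all
  have L2: "(\<lambda>n. \<integral>x. \<phi>' (u (r n) x) * g x * \<eta> x \<partial>lborel) \<longlonglongrightarrow> (\<integral>x. \<phi>' (U x) * g x * \<eta> x \<partial>lborel)"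
  proof (rule integral_dominated_convergence[where w = "\<lambda>x. B * N * \<bar>g x\<bar>"])
    show "AE x in lborel. (\<lambda>n. \<phi>' (u (r n) x) * g x * \<eta> x) \<longlonglongrightarrow> \<phi>' (U x) * g x * \<eta> x"
      using r by eventually_elim
        (intro tendsto_mult tendsto_const continuous_on_tendsto_compose[OF \<phi>(2)], auto)
    show "AE x in lborel. norm (\<phi>' (u (r n) x) * g x * \<eta> x) \<le> B * N * \<bar>g x\<bar>" for n
      using le2[of "u (r n)" _ g] by (intro AE_I2) simp
    show "integrable lborel (\<lambda>x. B * N * \<bar>g x\<bar>)" using g by auto
  qed simp_all
  have L3: "(\<lambda>n. \<integral>x. \<phi>' (u (r n) x) * (G (r n) x - g x) * \<eta> x \<partial>lborel) \<longlonglongrightarrow> 0"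
  proof (rule Lim_null_comparison)
    show "\<forall>\<^sub>F n in sequentially. norm (\<integral>x. \<phi>' (u (r n) x) * (G (r n) x - g x) * \<eta> x \<partial>lborel)
        \<le> B * N * (1 / real (Suc (r n)))"
    proof (rule always_eventually, rule allI)
      fix n
      have "norm (\<integral>x. \<phi>' (u (r n) x) * (G (r n) x - g x) * \<eta> x \<partial>lborel)
          \<le> (\<integral>x. \<bar>\<phi>' (u (r n) x) * (G (r n) x - g x) * \<eta> x\<bar> \<partial>lborel)"
        unfolding real_norm_def by (rule integral_abs_bound)
      also have "\<dots> \<le> (\<integral>x. B * N * \<bar>G (r n) x - g x\<bar> \<partial>lborel)"
        using int2[OF _ int_Gg(1)[of "r n"], of "u (r n)"] int_Gg(1)[of "r n"]
          le2[of "u (r n)" _ "\<lambda>x. G (r n) x - g x"]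
        by (intro integral_mono) auto
      also have "\<dots> = B * N * (\<integral>x. \<bar>G (r n) x - g x\<bar> \<partial>lborel)" by simp
      also have "\<dots> \<le> B * N * (1 / real (Suc (r n)))"
        using int_Gg(2)[of "r n"] B0 \<open>N > 0\<close> by (intro mult_left_mono) auto
      finally show "norm (\<integral>x. \<phi>' (u (r n) x) * (G (r n) x - g x) * \<eta> x \<partial>lborel)
        \<le> B * N * (1 / real (Suc (r n)))" .
    qed
    show "(\<lambda>n. B * N * (1 / real (Suc (r n)))) \<longlonglongrightarrow> 0"
      using tendsto_mult_right_zero[OF LIMSEQ_subseq_LIMSEQ[OF lim0 \<open>strict_mono r\<close>], of "B * N"]
      by (simp only: o_def)
  qed
  \<comment> \<open>In the first part only the bounded factor \<open>\<phi>' (u (r n) x)\<close>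
    varies, so dominated convergence applies; the second is a bounded factor times a function that
    is small in L1.\<close>
  have split: "(\<integral>x. \<phi>' (u (r n) x) * G (r n) x * \<eta> x \<partial>lborel)
      = (\<integral>x. \<phi>' (u (r n) x) * g x * \<eta> x \<partial>lborel) + (\<integral>x. \<phi>' (u (r n) x) * (G (r n) x - g x) * \<eta> x \<partial>lborel)" for n
  proof -
    have "(\<integral>x. \<phi>' (u (r n) x) * g x * \<eta> x \<partial>lborel) + (\<integral>x. \<phi>' (u (r n) x) * (G (r n) x - g x) * \<eta> x \<partial>lborel)
      = (\<integral>x. \<phi>' (u (r n) x) * g x * \<eta> x + \<phi>' (u (r n) x) * (G (r n) x - g x) * \<eta> x \<partial>lborel)"
      using int2[OF _ g, of "u (r n)"] int2[OF _ int_Gg(1)[of "r n"], of "u (r n)"]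
      by (intro Bochner_Integration.integral_add[symmetric]) auto
    also have "\<dots> = (\<integral>x. \<phi>' (u (r n) x) * G (r n) x * \<eta> x \<partial>lborel)"
      by (rule Bochner_Integration.integral_cong) (auto simp: algebra_simps)
    finally show ?thesis by simp
  qed
  have "(\<lambda>n. (\<integral>x. \<phi> (u (r n) x) * partial j \<eta> x \<partial>lborel) + (\<integral>x. \<phi>' (u (r n) x) * G (r n) x * \<eta> x \<partial>lborel))
      \<longlonglongrightarrow> (\<integral>x. \<phi> (U x) * partial j \<eta> x \<partial>lborel) + ((\<integral>x. \<phi>' (U x) * g x * \<eta> x \<partial>lborel) + 0)"
    unfolding split by (intro tendsto_add L1 L2 L3)
  then have "(\<lambda>n. 0) \<longlonglongrightarrow> (\<integral>x. \<phi> (U x) * partial j \<eta> x \<partial>lborel) + ((\<integral>x. \<phi>' (U x) * g x * \<eta> x \<partial>lborel) + 0)"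
    unfolding parts .
  then have "0 = (\<integral>x. \<phi> (U x) * partial j \<eta> x \<partial>lborel) + ((\<integral>x. \<phi>' (U x) * g x * \<eta> x \<partial>lborel) + 0)"
    by (rule LIMSEQ_unique[OF tendsto_const])
  then show ?thesis by linarith
qed

section \<open>Algebra of square integrable functions\<close>

lemma L2_measurable: "L2 \<Omega> f \<Longrightarrow> f \<in> borel_measurable (lebesgue_on \<Omega>)"
  by (simp add: L2_def)

lemma L2_integrable_power2: "L2 \<Omega> f \<Longrightarrow> integrable (lebesgue_on \<Omega>) (\<lambda>x. (f x)^2)"
  by (simp add: L2_def)

lemma L2_integrable_mult:
  assumes "L2 \<Omega> f" "L2 \<Omega> g"
  shows "integrable (lebesgue_on \<Omega>) (\<lambda>x. f x * g x)"
proof (rule Bochner_Integration.integrable_bound[where f = "\<lambda>x. (f x)^2 + (g x)^2"])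
  show "integrable (lebesgue_on \<Omega>) (\<lambda>x. (f x)^2 + (g x)^2)"
    using assms by (simp add: L2_def)
  show "(\<lambda>x. f x * g x) \<in> borel_measurable (lebesgue_on \<Omega>)"
    using assms by (auto simp: L2_def)
  have "\<bar>a * b\<bar> \<le> a^2 + b^2" for a b :: real
  proof -
    have "0 \<le> (\<bar>a\<bar> - \<bar>b\<bar>)^2" "0 \<le> \<bar>a\<bar> * \<bar>b\<bar>" by simp_all
    moreover have "(\<bar>a\<bar> - \<bar>b\<bar>)^2 = a^2 + b^2 - 2 * (\<bar>a\<bar> * \<bar>b\<bar>)" by (simp add: power2_diff)
    ultimately show ?thesis unfolding abs_mult by linarith
  qed
  then show "AE x in lebesgue_on \<Omega>. norm (f x * g x) \<le> norm ((f x)^2 + (g x)^2)"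
    by (intro AE_I2) (simp add: order_trans[OF _ abs_ge_self])
qed

lemma L2_add: "L2 \<Omega> f \<Longrightarrow> L2 \<Omega> g \<Longrightarrow> L2 \<Omega> (\<lambda>x. f x + g x)"
  using L2_integrable_mult[of \<Omega> f g]
  by (auto simp: L2_def power2_sum mult.assoc)

lemma L2_cmult: "L2 \<Omega> f \<Longrightarrow> L2 \<Omega> (\<lambda>x. c * f x)"
  by (auto simp: L2_def power_mult_distrib)

lemma L2_minus: "L2 \<Omega> f \<Longrightarrow> L2 \<Omega> (\<lambda>x. - f x)"
  by (auto simp: L2_def)

lemma L2_diff: "L2 \<Omega> f \<Longrightarrow> L2 \<Omega> g \<Longrightarrow> L2 \<Omega> (\<lambda>x. f x - g x)"
  using L2_add[of \<Omega> f "\<lambda>x. - g x"] L2_minus[of \<Omega> g] by simp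

lemma L2_zero: "L2 \<Omega> (\<lambda>x. 0)"
  by (simp add: L2_def)

lemma L2_sum: "(\<And>i. i \<in> I \<Longrightarrow> L2 \<Omega> (f i)) \<Longrightarrow> L2 \<Omega> (\<lambda>x. \<Sum>i\<in>I. f i x)"
  by (induction I rule: infinite_finite_induct) (auto simp: L2_zero intro: L2_add)

lemma L2_const:
  assumes "\<Omega> \<in> lmeasurable"
  shows "L2 \<Omega> (\<lambda>x. c)"
proof -
  interpret finite_measure "lebesgue_on \<Omega>"
    using assms by (rule finite_measure_lebesgue_on)
  show ?thesis by (simp add: L2_def)
qed

lemma L2_integrable:
  assumes "\<Omega> \<in> lmeasurable" "L2 \<Omega> f"
  shows "integrable (lebesgue_on \<Omega>) f"
  using L2_integrable_mult[OF assms(2) L2_const[OF assms(1), of 1]] by simp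

lemma L2_bounded_mult:
  assumes f: "f \<in> borel_measurable (lebesgue_on \<Omega>)" "\<And>x. \<bar>f x\<bar> \<le> B" and g: "L2 \<Omega> g"
  shows "L2 \<Omega> (\<lambda>x. f x * g x)"
proof -
  have "integrable (lebesgue_on \<Omega>) (\<lambda>x. (f x * g x)^2)"
  proof (rule Bochner_Integration.integrable_bound[where f = "\<lambda>x. B^2 * (g x)^2"])
    show "integrable (lebesgue_on \<Omega>) (\<lambda>x. B^2 * (g x)^2)" using g by (simp add: L2_def)
    show "(\<lambda>x. (f x * g x)^2) \<in> borel_measurable (lebesgue_on \<Omega>)"
      using f g by (auto simp: L2_def)
    have "(f x)^2 \<le> B^2" for x using power_mono[OF f(2)[of x], of 2] by simp
    then show "AE x in lebesgue_on \<Omega>. norm ((f x * g x)^2) \<le> norm (B^2 * (g x)^2)"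
      by (intro AE_I2) (simp add: power_mult_distrib mult_right_mono)
  qed
  then show ?thesis using f g by (auto simp: L2_def)
qed

section \<open>Transfer of the chain rule from Borel functions to the domain\<close>

text \<open>Weak gradients live on \<open>lebesgue_on \<Omega>\<close>, whereas the translation and
  Fubini arguments use \<open>lborel\<close>. The bridge is a Borel function equal almost everywhere
  to the extension by zero.\<close>

lemma lebesgue_on_borel_version:
  fixes f :: "'a::euclidean_space \<Rightarrow> real"
  assumes \<Omega>: "\<Omega> \<in> sets lebesgue" and f: "integrable (lebesgue_on \<Omega>) f"
  obtains F where "integrable lborel F" "AE x in lebesgue. indicator \<Omega> x * f x = F x"
proof -
  have *: "integrable lebesgue (\<lambda>x. indicator \<Omega> x * f x)"
    using f \<Omega> by (simp add: integrable_restrict_space)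
  then have "(\<lambda>x. indicator \<Omega> x * f x) \<in> borel_measurable (completion lborel)" by auto
  from completion_ex_borel_measurable_real[OF this] obtain F where
    F: "F \<in> borel_measurable lborel" and "AE x in lborel. indicator \<Omega> x * f x = F x" by blast
  then have ae: "AE x in lebesgue. indicator \<Omega> x * f x = F x" by (blast intro: AE_completion)
  have "integrable lebesgue F"
    by (rule integrable_cong_AE_imp[OF *]) (use F ae in \<open>auto intro: measurable_completion\<close>)
  then have "integrable lborel F" using F by (simp add: integrable_completion)
  then show thesis using ae that by blast
qed

lemma integral_borel_version:
  fixes f F h :: "'a::euclidean_space \<Rightarrow> real"
  assumes \<Omega>: "\<Omega> \<in> sets lebesgue" and f: "f \<in> borel_measurable (lebesgue_on \<Omega>)"
    and F: "F \<in> borel_measurable borel" and h: "h \<in> borel_measurable borel"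
    and ae: "AE x in lebesgue. indicator \<Omega> x * f x = F x * h x"
  shows "(\<integral>x. f x \<partial>lebesgue_on \<Omega>) = (\<integral>x. F x * h x \<partial>lborel)"
proof -
  have m: "(\<lambda>x. indicator \<Omega> x * f x) \<in> borel_measurable lebesgue"
    using f \<Omega> by (simp add: borel_measurable_restrict_space_iff)
  have m2: "(\<lambda>x. F x * h x) \<in> borel_measurable lborel" using F h by simp
  have "(\<integral>x. f x \<partial>lebesgue_on \<Omega>) = (\<integral>x. indicator \<Omega> x * f x \<partial>lebesgue)"
    using \<Omega> by (simp add: integral_restrict_space)
  also have "\<dots> = (\<integral>x. F x * h x \<partial>lebesgue)"
    by (rule integral_cong_AE[OF m measurable_completion[OF m2] ae])
  also have "\<dots> = (\<integral>x. F x * h x \<partial>lborel)"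
    by (rule integral_completion[OF m2])
  finally show ?thesis .
qed

text \<open>Boundedness of \<open>\<phi>\<close> on a domain of finite measure puts
  \<open>\<phi> (u x)\<close> into L2, and boundedness of \<open>\<phi>'\<close> does the same for
  the new gradient. The integral identity is carried over from the Borel versions of
  \<open>u\<close> and of the components of \<open>G\<close>.\<close>

lemma weak_grad_compose:
  fixes u :: "real^'n \<Rightarrow> real" and \<phi> \<phi>' :: "real \<Rightarrow> real"
  assumes \<Omega>: "open \<Omega>" "bounded \<Omega>" and u: "weak_grad \<Omega> u G"
    and \<phi>: "\<And>s. (\<phi> has_real_derivative \<phi>' s) (at s)" "continuous_on UNIV \<phi>'"
    and B: "\<And>s. \<bar>\<phi> s\<bar> \<le> B" "\<And>s. \<bar>\<phi>' s\<bar> \<le> B"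
  shows "weak_grad \<Omega> (\<lambda>x. \<phi> (u x)) (\<lambda>x. \<phi>' (u x) *\<^sub>R G x)"
proof -
  have lm: "\<Omega> \<in> lmeasurable" using \<Omega> by (simp add: lmeasurable_open)
  then have ls: "\<Omega> \<in> sets lebesgue" by auto
  have \<phi>cont: "continuous_on UNIV \<phi>"
    using \<phi>(1) by (meson DERIV_isCont continuous_at_imp_continuous_on)
  have [measurable]: "\<phi> \<in> borel_measurable borel" "\<phi>' \<in> borel_measurable borel"
    using \<phi>cont \<phi>(2) by (auto intro: borel_measurable_continuous_onI)
  have uL2: "L2 \<Omega> u" and GL2: "\<And>k. L2 \<Omega> (\<lambda>x. G x $ k)"
    and weak: "\<And>\<eta> k. test_fun \<Omega> \<eta> \<Longrightarrow>
      (\<integral>x. u x * partial k \<eta> x \<partial>lebesgue_on \<Omega>) = - (\<integral>x. G x $ k * \<eta> x \<partial>lebesgue_on \<Omega>)"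
    using u unfolding weak_grad_def by blast+
  have um[measurable]: "u \<in> borel_measurable (lebesgue_on \<Omega>)" using uL2 by (rule L2_measurable)
  have Gm[measurable]: "(\<lambda>x. G x $ k) \<in> borel_measurable (lebesgue_on \<Omega>)" for k
    using GL2 by (rule L2_measurable)
  obtain U where U: "integrable lborel U" "AE x in lebesgue. indicator \<Omega> x * u x = U x"
    by (rule lebesgue_on_borel_version[OF ls L2_integrable[OF lm uL2]])
  have Um[measurable]: "U \<in> borel_measurable borel" using U(1) by auto
  have L2\<phi>: "L2 \<Omega> (\<lambda>x. \<phi> (u x))"
    using L2_bounded_mult[of "\<lambda>x. \<phi> (u x)" \<Omega> B "\<lambda>x. 1"] L2_const[OF lm] B(1) by simp
  have L2\<phi>': "L2 \<Omega> (\<lambda>x. \<phi>' (u x) * G x $ k)" for k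
    using L2_bounded_mult[of "\<lambda>x. \<phi>' (u x)" \<Omega> B] GL2 B(2) by simp
  have "(\<integral>x. \<phi> (u x) * partial k \<eta> x \<partial>lebesgue_on \<Omega>) = - (\<integral>x. \<phi>' (u x) * G x $ k * \<eta> x \<partial>lebesgue_on \<Omega>)"
    if \<eta>: "test_fun \<Omega> \<eta>" for \<eta> k
  proof -
    obtain g where g: "integrable lborel g" "AE x in lebesgue. indicator \<Omega> x * G x $ k = g x"
      by (rule lebesgue_on_borel_version[OF ls L2_integrable[OF lm GL2[of k]]])
    have gm[measurable]: "g \<in> borel_measurable borel" using g(1) by auto
    have test: "\<psi> \<in> borel_measurable borel" "partial k \<psi> \<in> borel_measurable borel"
      "\<And>x. x \<notin> \<Omega> \<Longrightarrow> \<psi> x = 0" "\<And>x. x \<notin> \<Omega> \<Longrightarrow> partial k \<psi> x = 0" if T: "test_fun \<Omega> \<psi>" for \<psi>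
    proof -
      have d: "\<And>x. \<psi> differentiable (at x)" and c: "continuous_on UNIV (partial k \<psi>)"
        using T by (auto simp: test_fun_def)
      obtain C where C: "compact C" "C \<subseteq> \<Omega>" "\<And>x. x \<notin> C \<Longrightarrow> \<psi> x = 0"
        using T unfolding test_fun_def by blast
      have "continuous_on UNIV \<psi>"
        by (simp add: continuous_at_imp_continuous_on d differentiable_imp_continuous_within)
      then show "\<psi> \<in> borel_measurable borel" by (rule borel_measurable_continuous_onI)
      show "partial k \<psi> \<in> borel_measurable borel" using c by (rule borel_measurable_continuous_onI)
      show "\<psi> x = 0" if "x \<notin> \<Omega>" for x
        using C(3)[of x] subsetD[OF C(2), of x] that by metis
      show "partial k \<psi> x = 0" if "x \<notin> \<Omega>" for x
      proof -
        have "x \<notin> C" using that subsetD[OF C(2), of x] by metis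
        then show ?thesis using partial_eq_0_outside[of C \<psi> x k, OF compact_imp_closed[OF C(1)] C(3)] by simp
      qed
    qed
    have lebm: "\<psi> \<in> borel_measurable (lebesgue_on \<Omega>)" if "\<psi> \<in> borel_measurable borel" for \<psi> :: "real^'n \<Rightarrow> real"
      using that by (intro measurable_restrict_space1 measurable_completion) simp
    have weakU: "(\<integral>x. U x * partial k \<psi> x \<partial>lborel) = - (\<integral>x. g x * \<psi> x \<partial>lborel)" if "test_fun \<Omega> \<psi>" for \<psi>
    proof -
      note t = test[OF that]
      note [measurable] = lebm[OF t(1)] lebm[OF t(2)]
      have "(\<integral>x. u x * partial k \<psi> x \<partial>lebesgue_on \<Omega>) = (\<integral>x. U x * partial k \<psi> x \<partial>lborel)"
        by (rule integral_borel_version[OF ls _ Um t(2)], measurable) (use U(2) in \<open>eventually_elim, simp\<close>)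
      moreover have "(\<integral>x. G x $ k * \<psi> x \<partial>lebesgue_on \<Omega>) = (\<integral>x. g x * \<psi> x \<partial>lborel)"
        by (rule integral_borel_version[OF ls _ gm t(1)], measurable) (use g(2) in \<open>eventually_elim, simp\<close>)
      ultimately show ?thesis using weak[OF that, of k] by simp
    qed
    note t = test[OF \<eta>]
    note [measurable] = lebm[OF t(1)] lebm[OF t(2)] t(1) t(2)
    have 1: "(\<integral>x. \<phi> (u x) * partial k \<eta> x \<partial>lebesgue_on \<Omega>) = (\<integral>x. \<phi> (U x) * partial k \<eta> x \<partial>lborel)"
    proof (rule integral_borel_version[OF ls])
      show "AE x in lebesgue. indicator \<Omega> x * (\<phi> (u x) * partial k \<eta> x) = \<phi> (U x) * partial k \<eta> x"
        using U(2)
      proof eventually_elim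
        case (elim x)
        \<comment> \<open>Outside \<open>\<Omega>\<close> the extension is 0 and
          \<open>\<phi> 0\<close> may be nonzero; equality holds there because the partial
          derivative of \<open>\<eta>\<close> vanishes.\<close>
        then show ?case using t(4)[of x] by (cases "x \<in> \<Omega>") auto
      qed
    qed measurable
    have 2: "(\<integral>x. \<phi>' (u x) * G x $ k * \<eta> x \<partial>lebesgue_on \<Omega>) = (\<integral>x. (\<phi>' (U x) * g x) * \<eta> x \<partial>lborel)"
    proof (rule integral_borel_version[OF ls])
      show "AE x in lebesgue. indicator \<Omega> x * (\<phi>' (u x) * G x $ k * \<eta> x) = \<phi>' (U x) * g x * \<eta> x"
        using U(2) g(2)
      proof eventually_elim
        case (elim x)
        then show ?case using t(3)[of x] by (cases "x \<in> \<Omega>") auto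
      qed
    qed measurable
    show ?thesis
      unfolding 1 2 by (rule weak_derivative_compose_lborel[OF U(1) g(1) \<Omega>(1) weakU \<phi> B \<eta>])
  qed
  then show ?thesis unfolding weak_grad_def using L2\<phi> L2\<phi>' by simp
qed

section \<open>Square integrable functions and time derivatives\<close>

lemma L2sq_nonneg: "0 \<le> L2sq \<Omega> f"
  unfolding L2sq_def by (rule Bochner_Integration.integral_nonneg) simp

lemma L2_Cauchy_Schwarz:
  assumes f: "L2 \<Omega> f" and g: "L2 \<Omega> g"
  shows "\<bar>\<integral>x. f x * g x \<partial>lebesgue_on \<Omega>\<bar> \<le> sqrt (L2sq \<Omega> f) * sqrt (L2sq \<Omega> g)"
proof -
  define A B C where "A = L2sq \<Omega> f" and "B = L2sq \<Omega> g" and "C = (\<integral>x. f x * g x \<partial>lebesgue_on \<Omega>)"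
  have AB: "A \<ge> 0" "B \<ge> 0" by (simp_all add: A_def B_def L2sq_nonneg)
  note int = L2_integrable_power2[OF f] L2_integrable_power2[OF g] L2_integrable_mult[OF f g]
  have quad: "0 \<le> s^2 * A + 2 * s * t * C + t^2 * B" for s t
  proof -
    have "0 \<le> (\<integral>x. (s * f x + t * g x)^2 \<partial>lebesgue_on \<Omega>)"
      by (rule Bochner_Integration.integral_nonneg) simp
    also have "(\<lambda>x. (s * f x + t * g x)^2) = (\<lambda>x. s^2 * (f x)^2 + 2 * s * t * (f x * g x) + t^2 * (g x)^2)"
      by (simp add: power2_eq_square algebra_simps)
    also have "(\<integral>x. s^2 * (f x)^2 + 2 * s * t * (f x * g x) + t^2 * (g x)^2 \<partial>lebesgue_on \<Omega>)
        = s^2 * A + 2 * s * t * C + t^2 * B"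
      using int by (simp add: A_def B_def C_def L2sq_def)
    finally show ?thesis .
  qed
  have "C^2 \<le> A * B"
  proof (cases "B = 0")
    case True
    have "C = 0"
    proof (rule ccontr)
      assume "C \<noteq> 0"
      \<comment> \<open>For \<open>B = 0\<close> the form with \<open>s = 1\<close> is affine in
        \<open>t\<close>; this value of \<open>t\<close> makes it equal to -1.\<close>
      have "0 \<le> A + 2 * (- (A + 1) / (2 * C)) * C"
        using quad[of 1 "- (A + 1) / (2 * C)"] True by simp
      then show False using \<open>C \<noteq> 0\<close> by (simp add: field_simps)
    qed
    then show ?thesis using AB by simp
  next
    case False
    then have "B > 0" using AB by simp
    have "0 \<le> B * (A * B - C^2)"
      using quad[of B "- C"] by (simp add: power2_eq_square algebra_simps)
    then show ?thesis using \<open>B > 0\<close> by (simp add: zero_le_mult_iff)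
  qed
  then have "sqrt (C^2) \<le> sqrt (A * B)" by (rule real_sqrt_le_mono)
  then show ?thesis by (simp add: A_def B_def C_def real_sqrt_mult)
qed

text \<open>Continuity of the L2 pairing. The filter is arbitrary, since both two-sided limits at
  positive times and one-sided limits at time 0 occur.\<close>

lemma L2sq_tendsto_integral_mult:
  assumes ev: "\<forall>\<^sub>F s in F. L2 \<Omega> (f s)" "\<forall>\<^sub>F s in F. L2 \<Omega> (g s)" and L2: "L2 \<Omega> f0" "L2 \<Omega> g0"
    and f: "((\<lambda>s. L2sq \<Omega> (\<lambda>x. f s x - f0 x)) \<longlongrightarrow> 0) F"
    and g: "((\<lambda>s. L2sq \<Omega> (\<lambda>x. g s x - g0 x)) \<longlongrightarrow> 0) F"
  shows "((\<lambda>s. \<integral>x. f s x * g s x \<partial>lebesgue_on \<Omega>) \<longlongrightarrow> (\<integral>x. f0 x * g0 x \<partial>lebesgue_on \<Omega>)) F"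
proof -
  let ?a = "\<lambda>s. sqrt (L2sq \<Omega> (\<lambda>x. f s x - f0 x))" and ?b = "\<lambda>s. sqrt (L2sq \<Omega> (\<lambda>x. g s x - g0 x))"
  have a: "(?a \<longlongrightarrow> 0) F" and b: "(?b \<longlongrightarrow> 0) F"
    using tendsto_real_sqrt[OF f] tendsto_real_sqrt[OF g] by simp_all
  have "((\<lambda>s. (\<integral>x. f s x * g s x \<partial>lebesgue_on \<Omega>) - (\<integral>x. f0 x * g0 x \<partial>lebesgue_on \<Omega>)) \<longlongrightarrow> 0) F"
  proof (rule Lim_null_comparison)
    show "\<forall>\<^sub>F s in F. norm ((\<integral>x. f s x * g s x \<partial>lebesgue_on \<Omega>) - (\<integral>x. f0 x * g0 x \<partial>lebesgue_on \<Omega>))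
        \<le> ?a s * ?b s + ?a s * sqrt (L2sq \<Omega> g0) + sqrt (L2sq \<Omega> f0) * ?b s"
      using ev
    proof eventually_elim
      case (elim s)
      have df: "L2 \<Omega> (\<lambda>x. f s x - f0 x)" and dg: "L2 \<Omega> (\<lambda>x. g s x - g0 x)"
        using elim L2 by (auto intro: L2_diff)
      note int = L2_integrable_mult[OF df dg] L2_integrable_mult[OF df L2(2)] L2_integrable_mult[OF L2(1) dg]
      have "(\<integral>x. f s x * g s x \<partial>lebesgue_on \<Omega>) - (\<integral>x. f0 x * g0 x \<partial>lebesgue_on \<Omega>)
          = (\<integral>x. f s x * g s x - f0 x * g0 x \<partial>lebesgue_on \<Omega>)"
        using L2_integrable_mult[OF elim] L2_integrable_mult[OF L2] by simp
      also have "(\<lambda>x. f s x * g s x - f0 x * g0 x)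
          = (\<lambda>x. (f s x - f0 x) * (g s x - g0 x) + (f s x - f0 x) * g0 x + f0 x * (g s x - g0 x))"
        by (simp add: algebra_simps)
      also have "(\<integral>x. (f s x - f0 x) * (g s x - g0 x) + (f s x - f0 x) * g0 x + f0 x * (g s x - g0 x) \<partial>lebesgue_on \<Omega>)
          = (\<integral>x. (f s x - f0 x) * (g s x - g0 x) \<partial>lebesgue_on \<Omega>)
            + (\<integral>x. (f s x - f0 x) * g0 x \<partial>lebesgue_on \<Omega>) + (\<integral>x. f0 x * (g s x - g0 x) \<partial>lebesgue_on \<Omega>)"
        unfolding Bochner_Integration.integral_add[OF Bochner_Integration.integrable_add[OF int(1,2)] int(3)]
          Bochner_Integration.integral_add[OF int(1,2)] ..
      finally show ?case
        using L2_Cauchy_Schwarz[OF df dg] L2_Cauchy_Schwarz[OF df L2(2)] L2_Cauchy_Schwarz[OF L2(1) dg]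
        by (simp only: real_norm_def)
    qed
    show "((\<lambda>s. ?a s * ?b s + ?a s * sqrt (L2sq \<Omega> g0) + sqrt (L2sq \<Omega> f0) * ?b s) \<longlongrightarrow> 0) F"
      by (intro tendsto_add_zero tendsto_mult_zero tendsto_mult_left_zero tendsto_mult_right_zero a b)
  qed
  then show ?thesis by (rule LIM_zero_cancel)
qed

section \<open>Strong differentiation in time\<close>

text \<open>Membership in L2 for all nearby times is demanded because \<open>L2sq\<close> of a
  function outside L2 is a Bochner integral with default value 0; the limit alone would then carry
  no information.\<close>

definition L2_deriv :: "(real^'n) set \<Rightarrow> (real \<Rightarrow> real^'n \<Rightarrow> real) \<Rightarrow> (real^'n \<Rightarrow> real) \<Rightarrow> real \<Rightarrow> bool" where
  "L2_deriv \<Omega> f f' t \<longleftrightarrow> (\<forall>\<^sub>F s in nhds t. L2 \<Omega> (f s)) \<and> L2 \<Omega> f' \<and>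
     ((\<lambda>s. L2sq \<Omega> (\<lambda>x. (f s x - f t x) / (s - t) - f' x)) \<longlongrightarrow> 0) (at t)"

text \<open>The squared L2 norm of the difference quotient converges, so multiplying it by
  \<open>(s - t)^2\<close> gives 0 in the limit.\<close>

lemma L2_deriv_continuous:
  assumes "L2_deriv \<Omega> f f' t"
  shows "((\<lambda>s. L2sq \<Omega> (\<lambda>x. f s x - f t x)) \<longlongrightarrow> 0) (at t)"
proof -
  have ev: "\<forall>\<^sub>F s in at t. L2 \<Omega> (f s)" and ft: "L2 \<Omega> (f t)" and f': "L2 \<Omega> f'"
    and lim: "((\<lambda>s. L2sq \<Omega> (\<lambda>x. (f s x - f t x) / (s - t) - f' x)) \<longlongrightarrow> 0) (at t)"
    using assms by (auto simp: L2_deriv_def eventually_at_filter elim: eventually_mono dest: eventually_nhds_x_imp_x)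
  let ?d = "\<lambda>s x. (f s x - f t x) / (s - t)"
  have ev2: "\<forall>\<^sub>F s in at t. L2 \<Omega> (?d s)"
    using ev
  proof eventually_elim
    case (elim s)
    show ?case using L2_cmult[OF L2_diff[OF elim ft], of "1 / (s - t)"] by simp
  qed
  have "((\<lambda>s. \<integral>x. ?d s x * ?d s x \<partial>lebesgue_on \<Omega>) \<longlongrightarrow> (\<integral>x. f' x * f' x \<partial>lebesgue_on \<Omega>)) (at t)"
    by (rule L2sq_tendsto_integral_mult[OF ev2 ev2 f' f' lim lim])
  then have "((\<lambda>s. (s - t)^2 * (\<integral>x. ?d s x * ?d s x \<partial>lebesgue_on \<Omega>)) \<longlongrightarrow> (t - t)^2 * (\<integral>x. f' x * f' x \<partial>lebesgue_on \<Omega>)) (at t)"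
    by (intro tendsto_intros)
  then have "((\<lambda>s. (s - t)^2 * (\<integral>x. ?d s x * ?d s x \<partial>lebesgue_on \<Omega>)) \<longlongrightarrow> 0) (at t)" by simp
  moreover have "\<forall>\<^sub>F s in at t. (s - t)^2 * (\<integral>x. ?d s x * ?d s x \<partial>lebesgue_on \<Omega>) = L2sq \<Omega> (\<lambda>x. f s x - f t x)"
    unfolding eventually_at_filter
  proof (rule always_eventually, intro allI impI)
    fix s assume "s \<noteq> t"
    have "(s - t)^2 * (\<integral>x. ?d s x * ?d s x \<partial>lebesgue_on \<Omega>) = (\<integral>x. (s - t)^2 * (?d s x * ?d s x) \<partial>lebesgue_on \<Omega>)"
      by simp
    also have "(\<lambda>x. (s - t)^2 * (?d s x * ?d s x)) = (\<lambda>x. (f s x - f t x)^2)"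
      using \<open>s \<noteq> t\<close> by (auto simp: power2_eq_square)
    finally show "(s - t)^2 * (\<integral>x. ?d s x * ?d s x \<partial>lebesgue_on \<Omega>) = L2sq \<Omega> (\<lambda>x. f s x - f t x)"
      by (simp add: L2sq_def)
  qed
  ultimately show ?thesis by (rule Lim_transform_eventually)
qed

text \<open>In the product rule the quotient of \<open>f\<close> is paired with the moving
  \<open>g s\<close> and the quotient of \<open>g\<close> with the fixed \<open>f t\<close>.
  Continuity of \<open>g\<close> comes from its differentiability.\<close>

lemma L2_deriv_integral_mult:
  assumes f: "L2_deriv \<Omega> f f' t" and g: "L2_deriv \<Omega> g g' t"
  shows "((\<lambda>s. \<integral>x. f s x * g s x \<partial>lebesgue_on \<Omega>) has_real_derivative
      (\<integral>x. f' x * g t x \<partial>lebesgue_on \<Omega>) + (\<integral>x. f t x * g' x \<partial>lebesgue_on \<Omega>)) (at t)"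
proof -
  have ev: "\<forall>\<^sub>F s in at t. L2 \<Omega> (f s)" "\<forall>\<^sub>F s in at t. L2 \<Omega> (g s)"
    and ft: "L2 \<Omega> (f t)" "L2 \<Omega> (g t)" and f': "L2 \<Omega> f'" "L2 \<Omega> g'"
    and lim: "((\<lambda>s. L2sq \<Omega> (\<lambda>x. (f s x - f t x) / (s - t) - f' x)) \<longlongrightarrow> 0) (at t)"
      "((\<lambda>s. L2sq \<Omega> (\<lambda>x. (g s x - g t x) / (s - t) - g' x)) \<longlongrightarrow> 0) (at t)"
    using f g by (auto simp: L2_deriv_def eventually_at_filter elim: eventually_mono dest: eventually_nhds_x_imp_x)
  let ?d = "\<lambda>f s x. (f s x - f t x) / (s - t)"
  have dL2: "L2 \<Omega> (?d h s)" if "L2 \<Omega> (h s)" "L2 \<Omega> (h t)" for h s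
    using L2_cmult[OF L2_diff[OF that], of "1 / (s - t)"] by simp
  have ev2: "\<forall>\<^sub>F s in at t. L2 \<Omega> (?d f s)" "\<forall>\<^sub>F s in at t. L2 \<Omega> (?d g s)"
    by (rule eventually_mono[OF ev(1)], erule dL2[of f, OF _ ft(1)])
       (rule eventually_mono[OF ev(2)], erule dL2[of g, OF _ ft(2)])
  have 1: "((\<lambda>s. \<integral>x. ?d f s x * g s x \<partial>lebesgue_on \<Omega>) \<longlongrightarrow> (\<integral>x. f' x * g t x \<partial>lebesgue_on \<Omega>)) (at t)"
    by (rule L2sq_tendsto_integral_mult[OF ev2(1) ev(2) f'(1) ft(2) lim(1) L2_deriv_continuous[OF g]])
  have zero: "((\<lambda>s. L2sq \<Omega> (\<lambda>x. f t x - f t x)) \<longlongrightarrow> 0) (at t)" by (simp add: L2sq_def)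
  have 2: "((\<lambda>s. \<integral>x. f t x * ?d g s x \<partial>lebesgue_on \<Omega>) \<longlongrightarrow> (\<integral>x. f t x * g' x \<partial>lebesgue_on \<Omega>)) (at t)"
    by (rule L2sq_tendsto_integral_mult[OF _ ev2(2) ft(1) f'(2) zero lim(2)]) (simp add: ft)
  have "\<forall>\<^sub>F s in at t. (\<integral>x. ?d f s x * g s x \<partial>lebesgue_on \<Omega>) + (\<integral>x. f t x * ?d g s x \<partial>lebesgue_on \<Omega>)
      = ((\<integral>x. f s x * g s x \<partial>lebesgue_on \<Omega>) - (\<integral>x. f t x * g t x \<partial>lebesgue_on \<Omega>)) / (s - t)"
    using ev
  proof eventually_elim
    case (elim s)
    note int = L2_integrable_mult[OF elim] L2_integrable_mult[OF ft]
      L2_integrable_mult[OF dL2[OF elim(1) ft(1)] elim(2)] L2_integrable_mult[OF ft(1) dL2[OF elim(2) ft(2)]]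
    have "(\<integral>x. ?d f s x * g s x \<partial>lebesgue_on \<Omega>) + (\<integral>x. f t x * ?d g s x \<partial>lebesgue_on \<Omega>)
        = (\<integral>x. ?d f s x * g s x + f t x * ?d g s x \<partial>lebesgue_on \<Omega>)"
      by (rule Bochner_Integration.integral_add[OF int(3,4), symmetric])
    also have "(\<lambda>x. ?d f s x * g s x + f t x * ?d g s x) = (\<lambda>x. (f s x * g s x - f t x * g t x) / (s - t))"
      by (simp add: algebra_simps flip: add_divide_distrib diff_divide_distrib)
    also have "(\<integral>x. (f s x * g s x - f t x * g t x) / (s - t) \<partial>lebesgue_on \<Omega>)
        = ((\<integral>x. f s x * g s x \<partial>lebesgue_on \<Omega>) - (\<integral>x. f t x * g t x \<partial>lebesgue_on \<Omega>)) / (s - t)"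
      using int by (simp only: integral_divide_zero Bochner_Integration.integral_diff)
    finally show ?case .
  qed
  from Lim_transform_eventually[OF tendsto_add[OF 1 2] this]
  show ?thesis by (simp only: has_field_derivative_iff)
qed

lemma L2_deriv_L2sq:
  assumes "L2_deriv \<Omega> f f' t"
  shows "((\<lambda>s. L2sq \<Omega> (f s)) has_real_derivative 2 * (\<integral>x. f t x * f' x \<partial>lebesgue_on \<Omega>)) (at t)"
  using L2_deriv_integral_mult[OF assms assms] by (simp add: L2sq_def power2_eq_square mult.commute)

lemma L2_deriv_affine:
  assumes "L2_deriv \<Omega> f f' t" "\<Omega> \<in> lmeasurable"
  shows "L2_deriv \<Omega> (\<lambda>s x. k * f s x + d) (\<lambda>x. k * f' x) t"
proof -
  have "((\<lambda>s. k^2 * L2sq \<Omega> (\<lambda>x. (f s x - f t x) / (s - t) - f' x)) \<longlongrightarrow> k^2 * 0) (at t)"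
    using assms by (intro tendsto_intros) (simp add: L2_deriv_def)
  moreover have "k^2 * L2sq \<Omega> (\<lambda>x. (f s x - f t x) / (s - t) - f' x)
      = L2sq \<Omega> (\<lambda>x. (k * f s x + d - (k * f t x + d)) / (s - t) - k * f' x)" for s
    unfolding L2sq_def by (subst integral_mult_right_zero[symmetric], rule Bochner_Integration.integral_cong)
      (auto simp: power_mult_distrib[symmetric] right_diff_distrib)
  ultimately show ?thesis
    using assms unfolding L2_deriv_def
    by (auto elim!: eventually_mono intro!: L2_add L2_cmult L2_const)
qed

text \<open>A solution is differentiable at positive times and only continuous at 0. The integrating
  factor gives a function with nonpositive derivative on the open interval and continuous on the
  closed one, hence nonincreasing.\<close>

lemma gronwall_linear:
  fixes y :: "real \<Rightarrow> real"
  assumes k: "k > 0" and cont: "continuous_on {0..} y"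
    and der: "\<And>t. t > 0 \<Longrightarrow> \<exists>d. (y has_real_derivative d) (at t) \<and> d \<le> - k * y t + R"
    and t: "t \<ge> 0"
  shows "y t \<le> exp (- k * t) * (y 0 - R / k) + R / k"
proof -
  let ?z = "\<lambda>s. exp (k * s) * (y s - R / k)"
  have "?z t \<le> ?z 0"
  proof (rule DERIV_nonpos_imp_decreasing_open[OF t])
    fix s assume s: "0 < s" "s < t"
    then obtain d where d: "(y has_real_derivative d) (at s)" "d \<le> - k * y s + R" using der by blast
    have "(?z has_real_derivative exp (k * s) * k * (y s - R / k) + exp (k * s) * d) (at s)"
      by (auto intro!: derivative_eq_intros d(1))
    moreover have "exp (k * s) * k * (y s - R / k) + exp (k * s) * d = exp (k * s) * (d + k * y s - R)"
      using k by (simp add: algebra_simps)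
    moreover have "\<dots> \<le> 0" using d(2) by (intro mult_nonneg_nonpos) auto
    ultimately show "\<exists>D. (?z has_real_derivative D) (at s) \<and> D \<le> 0" by metis
  next
    show "continuous_on {0..t} ?z"
      by (intro continuous_intros continuous_on_subset[OF cont]) auto
  qed
  then have *: "exp (- k * t) * ?z t \<le> exp (- k * t) * ?z 0"
    by (intro mult_left_mono) auto
  have "exp (- k * t) * ?z t = y t - R / k" "?z 0 = y 0 - R / k" by (simp_all add: exp_minus)
  from *[unfolded this] show ?thesis by linarith
qed

section \<open>Integrability of the absorption term\<close>

lemma L2_cong_AE:
  assumes f: "L2 \<Omega> f" and g: "g \<in> borel_measurable (lebesgue_on \<Omega>)" and ae: "AE x in lebesgue_on \<Omega>. f x = g x"
  shows "L2 \<Omega> g"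
proof -
  have "integrable (lebesgue_on \<Omega>) (\<lambda>x. (g x)^2)"
    by (rule integrable_cong_AE_imp[OF L2_integrable_power2[OF f]])
       (use g ae in \<open>auto elim: eventually_mono\<close>)
  then show ?thesis using g by (simp add: L2_def)
qed

lemma weak_grad_integrable_norm_power2:
  assumes "weak_grad \<Omega> u G"
  shows "integrable (lebesgue_on \<Omega>) (\<lambda>x. (norm (G x))^2)"
proof -
  have "(\<lambda>x. (norm (G x))^2) = (\<lambda>x. \<Sum>k\<in>UNIV. (G x $ k)^2)"
    by (rule ext, subst power2_norm_eq_inner) (simp add: inner_vec_def power2_eq_square)
  then show ?thesis
    using assms by (simp add: weak_grad_def L2_def)
qed

text \<open>The test functions \<open>s / (1 + e s\<^sup>2)\<close> of \<open>u\<close> keep the absorption term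
  integrable; Fatou's lemma for \<open>e \<rightarrow> 0\<close> then gives its integrability against \<open>u\<close> itself.
  Without this the Bochner integral in the weak equation tested with \<open>u\<close> might be the junk value 0.\<close>

lemma absorption_term_integrable:
  fixes u u' R N :: "real^'n \<Rightarrow> real"
  assumes \<Omega>: "open \<Omega>" "bounded \<Omega>" and u: "weak_grad \<Omega> u G" and u': "L2 \<Omega> u'" and "\<eta> \<ge> 0"
    and R: "R \<in> borel_measurable (lebesgue_on \<Omega>)" "integrable (lebesgue_on \<Omega>) (\<lambda>x. R x * u x)"
    and N: "integrable (lebesgue_on \<Omega>) N" "\<And>x. N x \<ge> 0"
    and weak: "\<And>\<psi> G\<psi>. weak_grad \<Omega> \<psi> G\<psi> \<Longrightarrow> (\<integral>x. u' x * \<psi> x \<partial>lebesgue_on \<Omega>)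
        = - \<eta> * (\<integral>x. G x \<bullet> G\<psi> x \<partial>lebesgue_on \<Omega>) + (\<integral>x. (R x - N x * u x) * \<psi> x \<partial>lebesgue_on \<Omega>)"
  shows "integrable (lebesgue_on \<Omega>) (\<lambda>x. N x * (u x)^2)"
proof -
  have uL2: "L2 \<Omega> u" using u by (simp add: weak_grad_def)
  have [measurable]: "u \<in> borel_measurable (lebesgue_on \<Omega>)" "N \<in> borel_measurable (lebesgue_on \<Omega>)"
    "u' \<in> borel_measurable (lebesgue_on \<Omega>)"
    using uL2 N(1) u' by (auto simp: L2_def)
  note R(1)[measurable]
  define \<phi> where "\<phi> = (\<lambda>(n::nat) s::real. s / (1 + s^2 / real (Suc n)))"
  define \<phi>' where "\<phi>' = (\<lambda>(n::nat) s::real. (1 - s^2 / real (Suc n)) / (1 + s^2 / real (Suc n))^2)"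
  have den: "1 + s^2 / real (Suc n) \<ge> 1" for s n by simp
  have denp: "1 + s^2 / real (Suc n) > 0" for s n using den[of s n] by linarith
  have den0: "1 + s^2 / real (Suc n) \<noteq> 0" for s n using den[of s n] by linarith
  have \<phi>der: "(\<phi> n has_real_derivative \<phi>' n s) (at s)" for n s
  proof -
    have "((\<lambda>s. s / (1 + s^2 / real (Suc n))) has_real_derivative
        (1 * (1 + s^2 / real (Suc n)) - s * (2 * s / real (Suc n))) / ((1 + s^2 / real (Suc n)) * (1 + s^2 / real (Suc n)))) (at s)"
      by (rule DERIV_divide) (use den0[of s n] in \<open>auto intro!: derivative_eq_intros\<close>)
    moreover have "1 * (1 + s^2 / real (Suc n)) - s * (2 * s / real (Suc n)) = 1 - s^2 / real (Suc n)"
      by (simp add: power2_eq_square)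
    ultimately show ?thesis by (simp only: \<phi>_def \<phi>'_def power2_eq_square[of "1 + s^2 / real (Suc n)"])
  qed
  have \<phi>'cont: "continuous_on UNIV (\<phi>' n)" for n
    unfolding \<phi>'_def using den0[of _ n] by (intro continuous_intros) auto
  have \<phi>_le: "\<bar>\<phi> n s\<bar> \<le> \<bar>s\<bar>" for n s
  proof -
    have "\<bar>\<phi> n s\<bar> = \<bar>s\<bar> / (1 + s^2 / real (Suc n))"
      unfolding \<phi>_def abs_divide abs_of_pos[OF denp] ..
    also have "\<dots> \<le> \<bar>s\<bar>"
      unfolding pos_divide_le_eq[OF denp] using mult_left_mono[OF den[of s n], of "\<bar>s\<bar>"] by simp
    finally show ?thesis .
  qed
  have \<phi>'_le: "\<bar>\<phi>' n s\<bar> \<le> 1" for n s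
  proof -
    have "\<bar>1 - s^2 / real (Suc n)\<bar> \<le> 1 + s^2 / real (Suc n)"
      using zero_le_divide_iff[of "s^2" "real (Suc n)"] by (auto simp: abs_le_iff)
    also have "\<dots> \<le> (1 + s^2 / real (Suc n))^2"
      using den[of s n] self_le_power[of "1 + s^2 / real (Suc n)" 2] by simp
    finally show ?thesis using den[of s n] by (simp add: \<phi>'_def abs_divide divide_le_eq)
  qed
  have \<phi>u: "s * \<phi> n s = s^2 / (1 + s^2 / real (Suc n))" for n s
    by (simp add: \<phi>_def power2_eq_square)
  have s\<phi>0: "s * \<phi> n s \<ge> 0" for n s unfolding \<phi>u by (intro divide_nonneg_pos denp) simp
  \<comment> \<open>For fixed \<open>n\<close> this makes
    \<open>N x * (u x * \<phi> n (u x))\<close> integrable although \<open>N\<close> is merely in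
    L1. The growth in \<open>n\<close> is harmless, since this bound does not enter the estimate by
    \<open>K\<close>.\<close>
  have s\<phi>: "s * \<phi> n s \<le> real (Suc n)" for n s
  proof -
    have "s^2 \<le> real (Suc n) * (1 + s^2 / real (Suc n))" by (simp add: distrib_left)
    then show ?thesis unfolding \<phi>u pos_divide_le_eq[OF denp] .
  qed
  have \<phi>B: "\<bar>\<phi> n s\<bar> \<le> real (Suc n)" for n s
  proof (cases "\<bar>s\<bar> \<le> 1")
    case True
    then show ?thesis using \<phi>_le[of n s] by simp
  next
    case False
    then have "\<bar>\<phi> n s\<bar> \<le> \<bar>s\<bar> * \<bar>\<phi> n s\<bar>" using mult_right_mono[of 1 "\<bar>s\<bar>" "\<bar>\<phi> n s\<bar>"] by simp
    also have "\<dots> = s * \<phi> n s" using s\<phi>0[of s n] by (simp flip: abs_mult)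
    finally show ?thesis using s\<phi>[of s n] by linarith
  qed
  have \<phi>'B: "\<bar>\<phi>' n s\<bar> \<le> real (Suc n)" for n s using \<phi>'_le[of n s] by simp
  have [measurable]: "\<phi> n \<in> borel_measurable borel" for n
    using \<phi>der by (intro borel_measurable_continuous_onI) (meson DERIV_isCont continuous_at_imp_continuous_on)
  have [measurable]: "\<phi>' n \<in> borel_measurable borel" for n
    using \<phi>'cont by (rule borel_measurable_continuous_onI)
  \<comment> \<open>\<open>K\<close> is independent of \<open>n\<close>: in every term
    \<open>\<phi> n\<close> is replaced using
    \<open>\<bar>\<phi> n s\<bar> \<le> \<bar>s\<bar>\<close> and
    \<open>\<bar>\<phi>' n s\<bar> \<le> 1\<close>.\<close>
  define K where "K = (\<integral>x. \<bar>u' x * u x\<bar> \<partial>lebesgue_on \<Omega>) + \<eta> * (\<integral>x. (norm (G x))^2 \<partial>lebesgue_on \<Omega>)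
      + (\<integral>x. \<bar>R x * u x\<bar> \<partial>lebesgue_on \<Omega>)"
  have G2: "integrable (lebesgue_on \<Omega>) (\<lambda>x. (norm (G x))^2)"
    by (rule weak_grad_integrable_norm_power2[OF u])
  have u'u: "integrable (lebesgue_on \<Omega>) (\<lambda>x. u' x * u x)" by (rule L2_integrable_mult[OF u' uL2])
  have le: "\<bar>f * \<phi> n s\<bar> \<le> \<bar>f * s\<bar>" for f s n
    using \<phi>_le[of n s] by (simp add: abs_mult mult_left_mono)
  have iN: "integrable (lebesgue_on \<Omega>) (\<lambda>x. N x * (u x * \<phi> n (u x)))" for n
  proof (rule Bochner_Integration.integrable_bound[where f = "\<lambda>x. N x * real (Suc n)"])
    show "integrable (lebesgue_on \<Omega>) (\<lambda>x. N x * real (Suc n))" using N(1) by (rule integrable_mult_left)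
    show "AE x in lebesgue_on \<Omega>. norm (N x * (u x * \<phi> n (u x))) \<le> norm (N x * real (Suc n))"
    proof (rule AE_I2)
      fix x
      have "N x * (u x * \<phi> n (u x)) \<le> N x * real (Suc n)" using s\<phi> N(2) by (rule mult_left_mono)
      moreover have "0 \<le> N x * (u x * \<phi> n (u x))" using N(2) s\<phi>0 by (rule mult_nonneg_nonneg)
      ultimately show "norm (N x * (u x * \<phi> n (u x))) \<le> norm (N x * real (Suc n))"
        unfolding real_norm_def by linarith
    qed
  qed measurable
  have bound: "(\<integral>x. N x * (u x * \<phi> n (u x)) \<partial>lebesgue_on \<Omega>) \<le> K" for n
  proof -
    have iR: "integrable (lebesgue_on \<Omega>) (\<lambda>x. R x * \<phi> n (u x))"
      by (rule Bochner_Integration.integrable_bound[OF R(2)]) (use le in auto)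
    have iu: "integrable (lebesgue_on \<Omega>) (\<lambda>x. u' x * \<phi> n (u x))"
      by (rule Bochner_Integration.integrable_bound[OF u'u]) (use le in auto)
    have leG: "\<bar>\<phi>' n (u x) * (norm (G x))^2\<bar> \<le> (norm (G x))^2" for x
      using mult_right_mono[OF \<phi>'_le[of n "u x"], of "(norm (G x))^2"] by (simp add: abs_mult)
    have iG: "integrable (lebesgue_on \<Omega>) (\<lambda>x. \<phi>' n (u x) * (norm (G x))^2)"
    proof (rule Bochner_Integration.integrable_bound[OF G2])
      have [measurable]: "(\<lambda>x. (norm (G x))^2) \<in> borel_measurable (lebesgue_on \<Omega>)" using G2 by auto
      show "(\<lambda>x. \<phi>' n (u x) * (norm (G x))^2) \<in> borel_measurable (lebesgue_on \<Omega>)" by measurable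
    qed (use leG in auto)
    have "(\<integral>x. u' x * \<phi> n (u x) \<partial>lebesgue_on \<Omega>)
        = - \<eta> * (\<integral>x. G x \<bullet> (\<phi>' n (u x) *\<^sub>R G x) \<partial>lebesgue_on \<Omega>)
          + (\<integral>x. (R x - N x * u x) * \<phi> n (u x) \<partial>lebesgue_on \<Omega>)"
      by (rule weak[OF weak_grad_compose[OF \<Omega> u \<phi>der \<phi>'cont \<phi>B \<phi>'B]])
    also have "(\<lambda>x. (R x - N x * u x) * \<phi> n (u x)) = (\<lambda>x. R x * \<phi> n (u x) - N x * (u x * \<phi> n (u x)))"
      by (simp add: algebra_simps)
    also have "(\<integral>x. R x * \<phi> n (u x) - N x * (u x * \<phi> n (u x)) \<partial>lebesgue_on \<Omega>)
        = (\<integral>x. R x * \<phi> n (u x) \<partial>lebesgue_on \<Omega>) - (\<integral>x. N x * (u x * \<phi> n (u x)) \<partial>lebesgue_on \<Omega>)"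
      by (rule Bochner_Integration.integral_diff[OF iR iN])
    also have "(\<lambda>x. G x \<bullet> (\<phi>' n (u x) *\<^sub>R G x)) = (\<lambda>x. \<phi>' n (u x) * (norm (G x))^2)"
      by (simp add: power2_norm_eq_inner)
    finally have eq: "(\<integral>x. N x * (u x * \<phi> n (u x)) \<partial>lebesgue_on \<Omega>) = (\<integral>x. R x * \<phi> n (u x) \<partial>lebesgue_on \<Omega>)
        - \<eta> * (\<integral>x. \<phi>' n (u x) * (norm (G x))^2 \<partial>lebesgue_on \<Omega>) - (\<integral>x. u' x * \<phi> n (u x) \<partial>lebesgue_on \<Omega>)"
      by simp
    have "\<bar>\<integral>x. R x * \<phi> n (u x) \<partial>lebesgue_on \<Omega>\<bar> \<le> (\<integral>x. \<bar>R x * u x\<bar> \<partial>lebesgue_on \<Omega>)"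
      by (rule order_trans[OF integral_abs_bound integral_mono]) (use iR R(2) le in auto)
    moreover have "\<bar>\<integral>x. u' x * \<phi> n (u x) \<partial>lebesgue_on \<Omega>\<bar> \<le> (\<integral>x. \<bar>u' x * u x\<bar> \<partial>lebesgue_on \<Omega>)"
      by (rule order_trans[OF integral_abs_bound integral_mono]) (use iu u'u le in auto)
    moreover have "\<bar>\<integral>x. \<phi>' n (u x) * (norm (G x))^2 \<partial>lebesgue_on \<Omega>\<bar> \<le> (\<integral>x. (norm (G x))^2 \<partial>lebesgue_on \<Omega>)"
      by (rule order_trans[OF integral_abs_bound integral_mono]) (use iG G2 leG in auto)
    then have "\<eta> * \<bar>\<integral>x. \<phi>' n (u x) * (norm (G x))^2 \<partial>lebesgue_on \<Omega>\<bar> \<le> \<eta> * (\<integral>x. (norm (G x))^2 \<partial>lebesgue_on \<Omega>)"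
      using \<open>\<eta> \<ge> 0\<close> by (rule mult_left_mono)
    moreover have "- (\<eta> * (\<integral>x. \<phi>' n (u x) * (norm (G x))^2 \<partial>lebesgue_on \<Omega>))
        \<le> \<eta> * \<bar>\<integral>x. \<phi>' n (u x) * (norm (G x))^2 \<partial>lebesgue_on \<Omega>\<bar>"
      using mult_left_mono[OF abs_ge_minus_self \<open>\<eta> \<ge> 0\<close>] by simp
    ultimately show ?thesis unfolding eq K_def by linarith
  qed
  have lim: "(\<lambda>n. N x * (u x * \<phi> n (u x))) \<longlonglongrightarrow> N x * (u x)^2" for x
  proof -
    have "(\<lambda>n. (u x)^2 * (1 / real (Suc n))) \<longlonglongrightarrow> (u x)^2 * 0"
      by (intro tendsto_intros LIMSEQ_Suc[OF lim_1_over_n])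
    then have "(\<lambda>n. N x * ((u x)^2 / (1 + (u x)^2 / real (Suc n)))) \<longlonglongrightarrow> N x * ((u x)^2 / (1 + (u x)^2 * 0))"
      by (intro tendsto_intros) auto
    then show ?thesis unfolding \<phi>u by simp
  qed
  have "(\<integral>\<^sup>+x. ennreal (N x * (u x)^2) \<partial>lebesgue_on \<Omega>)
      = (\<integral>\<^sup>+x. liminf (\<lambda>n. ennreal (N x * (u x * \<phi> n (u x)))) \<partial>lebesgue_on \<Omega>)"
    by (rule nn_integral_cong, rule lim_imp_Liminf[symmetric], simp, rule tendsto_ennrealI[OF lim])
  also have "\<dots> \<le> liminf (\<lambda>n. \<integral>\<^sup>+x. ennreal (N x * (u x * \<phi> n (u x))) \<partial>lebesgue_on \<Omega>)"
    by (rule nn_integral_liminf) measurable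
  also have "\<dots> \<le> ennreal K"
  proof (rule Liminf_le)
    show "\<forall>\<^sub>F n in sequentially. (\<integral>\<^sup>+x. ennreal (N x * (u x * \<phi> n (u x))) \<partial>lebesgue_on \<Omega>) \<le> ennreal K"
    proof (rule always_eventually, rule allI)
      fix n
      have "(\<integral>\<^sup>+x. ennreal (N x * (u x * \<phi> n (u x))) \<partial>lebesgue_on \<Omega>)
          = ennreal (\<integral>x. N x * (u x * \<phi> n (u x)) \<partial>lebesgue_on \<Omega>)"
        using N(2) s\<phi>0 by (intro nn_integral_eq_integral[OF iN] AE_I2) (rule mult_nonneg_nonneg)
      then show "(\<integral>\<^sup>+x. ennreal (N x * (u x * \<phi> n (u x))) \<partial>lebesgue_on \<Omega>) \<le> ennreal K"
        using ennreal_leI[OF bound[of n]] by simp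
    qed
  qed simp
  finally have "(\<integral>\<^sup>+x. ennreal (N x * (u x)^2) \<partial>lebesgue_on \<Omega>) < \<infinity>"
    by (rule le_less_trans) simp
  moreover have "ennreal (norm (N x * (u x)^2)) = ennreal (N x * (u x)^2)" for x
    using N(2)[of x] by simp
  ultimately show ?thesis by (intro integrableI_bounded) simp_all
qed

section \<open>Energy estimate\<close>

text \<open>Four times the difference of the two sides factors as \<open>(u - y)^2\<close> times a
  positive definite quadratic form. The inequality thus holds for all signs, as \<open>u\<close> may
  be negative.\<close>

lemma young_power4:
  fixes u y :: real
  shows "y * u^3 \<le> 3/4 * u^4 + 1/4 * y^4"
proof -
  have "0 \<le> (u - y)^2 * (3 * u^2 + 2 * u * y + y^2)"
  proof (rule mult_nonneg_nonneg)
    have "3 * u^2 + 2 * u * y + y^2 = 2 * u^2 + (u + y)^2" by (simp add: power2_eq_square algebra_simps)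
    also have "\<dots> \<ge> 0" by simp
    finally show "3 * u^2 + 2 * u * y + y^2 \<ge> 0" .
  qed simp
  also have "\<dots> = 3 * u^4 + y^4 - 4 * (y * u^3)"
    by (simp add: power2_eq_square power3_eq_cube power4_eq_xxxx algebra_simps)
  finally show ?thesis by simp
qed

lemma young_weighted:
  fixes s a b :: real
  assumes "s > 0"
  shows "a * b \<le> s * a^2 + b^2 / (4 * s)"
proof -
  have "0 \<le> (2 * s * a - b)^2 / (4 * s)" using assms by simp
  also have "\<dots> = s * a^2 - a * b + b^2 / (4 * s)"
    using assms by (simp add: power2_eq_square field_simps)
  finally show ?thesis by simp
qed

text \<open>The left side is half the time derivative of the energy density, without diffusion and
  network coupling. Weighted Young inequalities are tuned so that several budgets close exactly. For
  \<open>u^4\<close>, apart from the parts with \<open>\<beta>\<close> and \<open>k2\<close>: 9/8 +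
  9/4 + 49/64 + 119/64 = 6, where 6 is 3/2 times the 4 in \<open>C1\<close>. For
  \<open>\<nu>^2\<close>: 1/3 + 1/6 + 1/2 = 1. For \<open>q^2 * ue^2 / r\<close>: 7/10 + 3/10 = 1.
  Only 3/2 of the available \<open>2 * \<alpha>^2\<close> is spent; the rest is the reserve
  \<open>\<alpha>^2 / 2\<close>.\<close>

lemma reaction_energy_pointwise:
  fixes u v w \<rho> a b \<alpha> \<beta> q r \<delta> k1 k2 Je ue c \<gamma> :: real
  assumes pos: "a > 0" "b > 0" "\<alpha> > 0" "\<beta> > 0" "q > 0" "r > 0" "\<delta> > 0" "k1 > 0" "k2 > 0" "Je > 0"
    and C1: "C1 = (1 / b) * (\<beta>^2 / 2 + 1 / (2 * k2^3) + 4)"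
    and C2: "C2 = (1/4) * (C1 * k1 * (\<bar>c\<bar> + \<gamma>^2 / \<delta>) + 1/4)^2"
    and lam: "lam = (1/2) * min 1 (min r k2)"
    and c0: "c0 = min C1 1"
    and \<nu>: "\<nu> = \<alpha> - v" and \<omega>: "\<omega> = w + q * ue / r"
  shows "3/2 * C1 * u * (a * u^2 - b * u^3 + v - w + Je - k1 * (c + \<gamma> * \<rho> + \<delta> * \<rho>^2) * u)
      - \<nu> * (\<alpha> - \<beta> * u^2 - v) + w * (q * (u - ue) - r * w) + 3 * C1 / (2 * q) * \<omega> * (q * (u - ue) - r * w)
      + c0 * \<rho> * (u - k2 * \<rho>)
    \<le> - lam * (3/2 * C1 * u^2 + \<nu>^2 + w^2 + 3 * C1 / (2 * q) * \<omega>^2 + c0 * \<rho>^2)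
      + (C2 + (C1 * a)^4 + C1 * Je^2 + (C1^2 * (2 + 1 / r) + C1)^2
         + 2 * \<alpha>^2 + q^2 * ue^2 / r + q^4 / r^2 - \<alpha>^2 / 2)"
proof -
  have C1pos: "C1 > 0" unfolding C1 using pos by (simp add: add_pos_pos)
  have c0pos: "c0 > 0" "c0 \<le> C1" using C1pos by (auto simp: c0)
  have lampos: "lam > 0" "lam \<le> 1/2" "lam \<le> r/2" "lam \<le> k2/2" using pos by (auto simp: lam)
  define x where "x = 1 / k2"
  have x: "x > 0" using pos by (simp add: x_def)
  have bC1: "b * C1 = \<beta>^2 / 2 + x^3 / 2 + 4" using pos by (simp add: C1 x_def power_divide)
  define X where "X = C1^2 * (2 + 1 / r) + C1"
  have X: "X \<ge> C1" "X > 0" using C1pos pos by (auto simp: X_def intro: add_nonneg_pos)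

  have P1: "C1 * a * u^3 \<le> 3/4 * u^4 + 1/4 * (C1 * a)^4"
    by (rule young_power4)
  define Z where "Z = C1 * k1 * (\<bar>c\<bar> + \<gamma>^2 / \<delta>)"
  have Z0: "Z \<ge> 0" using C1pos pos by (simp add: Z_def)
  \<comment> \<open>The term \<open>\<delta> * \<rho>^2\<close> absorbs
    \<open>\<gamma> * \<rho>\<close>, so the memristor costs at most a multiple of
    \<open>u^2\<close>. The weight 9/4 makes the constant produced by \<open>3/2 * Z\<close> equal
    to \<open>Z^2 / 4\<close>.\<close>
  have P2: "- (3/2 * C1 * k1 * (c + \<gamma> * \<rho> + \<delta> * \<rho>^2) * u^2) \<le> 9/4 * u^4 + C2"
  proof -
    have "- (\<gamma> * \<rho> + \<delta> * \<rho>^2) \<le> \<gamma>^2 / \<delta>"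
    proof -
      have "\<rho> * (-\<gamma>) \<le> \<delta> * \<rho>^2 + (-\<gamma>)^2 / (4 * \<delta>)" using pos by (intro young_weighted) simp
      moreover have "\<gamma>^2 / (4 * \<delta>) \<le> \<gamma>^2 / \<delta>" using pos by (intro divide_left_mono) auto
      ultimately show ?thesis by (simp add: mult.commute)
    qed
    then have "- (c + \<gamma> * \<rho> + \<delta> * \<rho>^2) \<le> \<bar>c\<bar> + \<gamma>^2 / \<delta>" by linarith
    then have "C1 * k1 * u^2 * (- (c + \<gamma> * \<rho> + \<delta> * \<rho>^2)) \<le> C1 * k1 * u^2 * (\<bar>c\<bar> + \<gamma>^2 / \<delta>)"
      using C1pos pos by (intro mult_left_mono) auto
    then have 1: "- (C1 * k1 * (c + \<gamma> * \<rho> + \<delta> * \<rho>^2) * u^2) \<le> Z * u^2"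
      by (simp add: Z_def algebra_simps)
    have 2: "u^2 * (3/2 * Z) \<le> 9/4 * (u^2)^2 + (3/2 * Z)^2 / (4 * (9/4))" by (rule young_weighted) simp
    have "Z^2 \<le> (Z + 1/4)^2" using Z0 by (intro power_mono) auto
    then have 3: "Z^2 / 4 \<le> C2" by (simp add: C2 Z_def)
    have 4: "(u^2)^2 = u^4" by simp
    have "3/2 * (Z * u^2) \<le> 9/4 * u^4 + Z^2 / 4"
      using 2 unfolding 4 by (simp add: power_mult_distrib power_divide mult_ac)
    moreover have "- (3/2 * C1 * k1 * (c + \<gamma> * \<rho> + \<delta> * \<rho>^2) * u^2)
        = 3/2 * (- (C1 * k1 * (c + \<gamma> * \<rho> + \<delta> * \<rho>^2) * u^2))"
      by simp
    ultimately show ?thesis using 1 3 by linarith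
  qed
  \<comment> \<open>The weight 3/4 is 3/2 times the coefficient 1/2 of \<open>\<beta>^2\<close> in
    \<open>b * C1\<close>. \<open>P4\<close> and \<open>P5\<close> spend the remaining two thirds of
    the damping of \<open>\<nu>\<close>.\<close>
  have P3: "\<nu> * (\<beta> * u^2) \<le> 3/4 * \<beta>^2 * u^4 + \<nu>^2 / 3"
    using young_weighted[of "3/4" "\<beta> * u^2" \<nu>] by (simp add: power_mult_distrib mult_ac)
  have P4: "- (3/2 * C1 * u * \<nu>) \<le> \<nu>^2 / 6 + 27/8 * C1^2 * u^2"
    using young_weighted[of "1/6" \<nu> "- (3/2 * C1 * u)"] by (simp add: power_mult_distrib power_divide mult_ac)
  have P5: "lam * \<nu>^2 \<le> \<nu>^2 / 2" using mult_right_mono[OF lampos(2), of "\<nu>^2"] by simp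
  \<comment> \<open>Replacing \<open>v\<close> by \<open>\<alpha> - \<nu>\<close> in the equation of
    \<open>u\<close> creates this term.\<close>
  have P6: "3/2 * C1 * \<alpha> * u \<le> 3/2 * \<alpha>^2 + 3/8 * C1^2 * u^2"
    using young_weighted[of "3/2" \<alpha> "3/2 * C1 * u"] by (simp add: power_mult_distrib power_divide mult_ac)
  have P7: "3/2 * C1 * Je * u \<le> C1 * Je^2 + 9/16 * C1 * u^2"
    using mult_left_mono[OF young_weighted[of 1 Je "3/2 * u"], of C1] C1pos
    by (simp add: power_mult_distrib power_divide algebra_simps)
  have P8: "lam * (3/2 * C1 * u^2) \<le> 3/4 * C1 * u^2"
    using mult_right_mono[OF lampos(2), of "3/2 * C1 * u^2"] C1pos by simp
  \<comment> \<open>The slack between the two quadratics in \<open>u\<close> and \<open>ue\<close>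
    is the perfect square \<open>5 * (u / 2 + ue / 5)^2\<close>. The coefficient 7/10 leaves 3/10
    for \<open>P10\<close>, and 7/4 produces the 49/64 in \<open>P11\<close>.\<close>
  have P9: "w * (q * (u - ue) - r * w) + lam * w^2 \<le> 7/4 * (q^2 * u^2 / r) + 7/10 * (q^2 * ue^2 / r)"
  proof -
    have "w * (q * (u - ue)) \<le> r/2 * w^2 + (q * (u - ue))^2 / (4 * (r/2))"
      using pos by (intro young_weighted) simp
    moreover have "lam * w^2 \<le> r/2 * w^2" using lampos(3) by (intro mult_right_mono) auto
    moreover have "(q * (u - ue))^2 / (4 * (r/2)) \<le> 7/4 * (q^2 * u^2 / r) + 7/10 * (q^2 * ue^2 / r)"
    proof -
      have "0 \<le> 5 * (u / 2 + ue / 5)^2" by simp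
      then have "(u - ue)^2 / 2 \<le> 7/4 * u^2 + 7/10 * ue^2"
        by (simp add: power2_eq_square algebra_simps)
      then have "(q^2 / r) * ((u - ue)^2 / 2) \<le> (q^2 / r) * (7/4 * u^2 + 7/10 * ue^2)"
        using pos by (intro mult_left_mono) auto
      moreover have "(q * (u - ue))^2 / (4 * (r/2)) = (q^2 / r) * ((u - ue)^2 / 2)"
        by (simp add: power_mult_distrib)
      moreover have "(q^2 / r) * (7/4 * u^2 + 7/10 * ue^2) = 7/4 * (q^2 * u^2 / r) + 7/10 * (q^2 * ue^2 / r)"
        by (simp add: distrib_left)
      ultimately show ?thesis by linarith
    qed
    moreover have "w * (q * (u - ue) - r * w) = w * (q * (u - ue)) - 2 * (r/2 * w^2)"
      by (simp add: algebra_simps power2_eq_square)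
    ultimately show ?thesis by linarith
  qed
  \<comment> \<open>Replacing \<open>w\<close> by \<open>\<omega> - q * ue / r\<close> in the
    equation of \<open>u\<close> creates this term.\<close>
  have P10: "3/2 * C1 * u * (q * ue / r) \<le> 3/10 * (q^2 * ue^2 / r) + 15/8 * (C1^2 * u^2 / r)"
  proof -
    have "(q * ue) * (3/2 * C1 * u) \<le> 3/10 * (q * ue)^2 + (3/2 * C1 * u)^2 / (4 * (3/10))"
      by (rule young_weighted) simp
    then have "(q * ue) * (3/2 * C1 * u) / r \<le> (3/10 * (q * ue)^2 + (3/2 * C1 * u)^2 / (4 * (3/10))) / r"
      using pos by (intro divide_right_mono) auto
    moreover have "(3/10 * (q * ue)^2 + (3/2 * C1 * u)^2 / (4 * (3/10))) / r
        = 3/10 * (q^2 * ue^2 / r) + 15/8 * (C1^2 * u^2 / r)"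
      by (simp add: power_mult_distrib power_divide add_divide_distrib)
    moreover have "(q * ue) * (3/2 * C1 * u) / r = 3/2 * C1 * u * (q * ue / r)" by simp
    ultimately show ?thesis by linarith
  qed
  have P11: "7/4 * (q^2 * u^2 / r) \<le> q^4 / r^2 + 49/64 * u^4"
  proof -
    have "(q^2 / r) * (7/4 * u^2) \<le> 1 * (q^2 / r)^2 + (7/4 * u^2)^2 / (4 * 1)" by (rule young_weighted) simp
    then show ?thesis by (simp add: power_mult_distrib power_divide mult_ac)
  qed
  \<comment> \<open>Half of the damping of \<open>\<rho>\<close> pays for \<open>lam\<close>, the
    other half for the product with \<open>u\<close>. Then \<open>c0 \<le> C1\<close> expresses the
    cost through \<open>C1\<close>, so that it can join the other quadratic terms in
    \<open>P14\<close>.\<close>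
  have P12: "c0 * \<rho> * (u - k2 * \<rho>) + lam * (c0 * \<rho>^2) \<le> C1 * u^2 * (x / 2)"
  proof -
    have "\<rho> * u \<le> k2/2 * \<rho>^2 + u^2 / (4 * (k2/2))" using pos by (intro young_weighted) simp
    moreover have "lam * \<rho>^2 \<le> k2/2 * \<rho>^2" using lampos by (intro mult_right_mono) auto
    ultimately have "\<rho> * (u - k2 * \<rho>) + lam * \<rho>^2 \<le> u^2 * (x / 2)"
      by (simp add: x_def algebra_simps power2_eq_square)
    then have "c0 * (\<rho> * (u - k2 * \<rho>) + lam * \<rho>^2) \<le> c0 * (u^2 * (x / 2))"
      using c0pos by (intro mult_left_mono) auto
    also have "\<dots> \<le> C1 * (u^2 * (x / 2))" using c0pos x by (intro mult_right_mono) auto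
    finally show ?thesis by (simp add: algebra_simps)
  qed
  \<comment> \<open>Once the product of \<open>u\<close> and \<open>\<omega>\<close> has cancelled,
    the damping \<open>r\<close> of \<open>\<omega>\<close> only has to dominate the rate
    \<open>lam\<close>, which is at most \<open>r / 2\<close>.\<close>
  have P13: "(3 * C1 / (2 * q)) * (r - lam) * \<omega>^2 \<ge> 0"
    using C1pos pos lampos by (intro mult_nonneg_nonneg) auto

  \<comment> \<open>All terms quadratic in \<open>u\<close> are collected here. The number 119/64 is
    what \<open>P1\<close>, \<open>P2\<close> and \<open>P11\<close> leave of the 6; the cubic in
    \<open>x = 1 / k2\<close> stems from the summand \<open>1 / (2 * k2^3)\<close> of
    \<open>C1\<close>.\<close>
  have P14: "15/4 * (C1^2 * u^2) + 15/8 * (C1^2 * u^2 / r) + 21/16 * (C1 * u^2) + C1 * u^2 * (x / 2)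
      \<le> X^2 + (119/64 + 3/4 * x^3) * u^4"
  proof -
    define T where "T = 15/8 + x/2"
    have "15/4 * C1^2 + 15/8 * (C1^2 / r) + 21/16 * C1 + C1 * (x/2) \<le> 15/8 * X + X * (x/2)"
    proof -
      have "15/8 * X = 15/4 * C1^2 + 15/8 * (C1^2 / r) + 15/8 * C1" by (simp add: X_def algebra_simps)
      moreover have "C1 * (x/2) \<le> X * (x/2)" using X x by (intro mult_right_mono) auto
      ultimately show ?thesis using C1pos by linarith
    qed
    then have "u^2 * (15/4 * C1^2 + 15/8 * (C1^2 / r) + 21/16 * C1 + C1 * (x/2)) \<le> u^2 * (15/8 * X + X * (x/2))"
      by (rule mult_left_mono) simp
    also have "\<dots> = X * (T * u^2)" by (simp add: T_def algebra_simps)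
    also have "\<dots> \<le> 1 * X^2 + (T * u^2)^2 / (4 * 1)" by (rule young_weighted) simp
    also have "\<dots> = X^2 + T^2 / 4 * u^4" by (simp add: power_mult_distrib)
    also have "T^2 / 4 * u^4 \<le> (119/64 + 3/4 * x^3) * u^4"
    proof (rule mult_right_mono)
      \<comment> \<open>A certificate of positivity on \<open>x > 0\<close>: \<open>x\<close> times
        a square, plus a square, plus a positive constant.\<close>
      have "3/4 * x^3 - x^2 / 16 - 15/32 * x + 251/256 = 3/4 * (x * (x - 1/2)^2) + (11/16) * (x - 21/44)^2 + (251/256 - 11/16 * (21/44)^2)"
        by (simp add: power2_eq_square power3_eq_cube field_simps)
      moreover have "3/4 * (x * (x - 1/2)^2) \<ge> 0" "(11/16) * (x - 21/44)^2 \<ge> 0" using x by auto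
      moreover have "251/256 - 11/16 * (21/44)^2 \<ge> (0::real)" by (simp add: power2_eq_square)
      ultimately have "3/4 * x^3 - x^2 / 16 - 15/32 * x + 251/256 \<ge> 0" by linarith
      then show "T^2 / 4 \<le> 119/64 + 3/4 * x^3"
        by (simp add: T_def power2_eq_square algebra_simps)
    qed simp
    finally show ?thesis by (simp add: algebra_simps)
  qed

  have Pb: "3/2 * (C1 * b) * u^4 = 3/4 * \<beta>^2 * u^4 + 3/4 * x^3 * u^4 + 6 * u^4"
    unfolding mult.commute[of C1 b] bC1 by (simp add: algebra_simps)
  have cancel: "3 * C1 / (2 * q) * \<omega> * (q * (u - ue) - r * w)
      = 3/2 * C1 * u * \<omega> - (3 * C1 / (2 * q)) * r * \<omega>^2"
  proof -
    have "r * (q * ue / r) = q * ue" using pos by simp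
    then have 1: "q * (u - ue) - r * w = q * u - r * \<omega>" unfolding \<omega> distrib_left right_diff_distrib by linarith
    have 2: "K * \<omega> * (q * u - r * \<omega>) = (K * q) * u * \<omega> - K * r * \<omega>^2" for K
      by (simp add: algebra_simps power2_eq_square)
    have "3 * C1 / (2 * q) * q = 3/2 * C1" using pos by simp
    then show ?thesis unfolding 1 2 by simp
  qed
  have expand: "3/2 * C1 * u * (a * u^2 - b * u^3 + v - w + Je - k1 * (c + \<gamma> * \<rho> + \<delta> * \<rho>^2) * u)
      = 3/2 * (C1 * a * u^3) - 3/2 * (C1 * b) * u^4 + 3/2 * C1 * \<alpha> * u - 3/2 * C1 * u * \<nu>
        - 3/2 * C1 * u * \<omega> + 3/2 * C1 * u * (q * ue / r) + 3/2 * C1 * Je * u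
        - 3/2 * C1 * k1 * (c + \<gamma> * \<rho> + \<delta> * \<rho>^2) * u^2"
  proof -
    have "A * u * (a * u^2 - b * u^3 + v - w + Je - k1 * R * u) = A * a * u^3 - A * b * u^4
      + A * \<alpha> * u - A * u * (\<alpha> - v) - A * u * (w + y) + A * u * y + A * Je * u - A * k1 * R * u^2" for A R y
      by (simp add: algebra_simps power2_eq_square power3_eq_cube power4_eq_xxxx)
    from this[of "3/2 * C1" "c + \<gamma> * \<rho> + \<delta> * \<rho>^2" "q * ue / r"] show ?thesis
      unfolding \<nu> \<omega> by (simp only: mult.assoc)
  qed
  have vterm: "- \<nu> * (\<alpha> - \<beta> * u^2 - v) = \<nu> * (\<beta> * u^2) - \<nu>^2"
    by (simp add: \<nu> algebra_simps power2_eq_square)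
  have C1a: "1/4 * (C1 * a)^4 * (3/2) \<le> (C1 * a)^4" by simp
  have om: "K * (r - lam) * \<omega>^2 = K * r * \<omega>^2 - lam * (K * \<omega>^2)" for K
    by (simp add: algebra_simps)
  have lamsum: "lam * (3/2 * C1 * u^2 + \<nu>^2 + w^2 + 3 * C1 / (2 * q) * \<omega>^2 + c0 * \<rho>^2)
    = lam * (3/2 * C1 * u^2) + lam * \<nu>^2 + lam * w^2 + lam * ((3 * C1 / (2 * q)) * \<omega>^2) + lam * (c0 * \<rho>^2)"
    by (simp only: distrib_left)
  have x3u: "(119/64 + 3/4 * x^3) * u^4 = 119/64 * u^4 + 3/4 * x^3 * u^4" by (simp add: algebra_simps)
  show ?thesis
    unfolding expand cancel X_def[symmetric] mult_minus_left lamsum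
    using P1 P2 P3 P4 P5 P6 P7 P8 P9 P10 P11 P12 P13[unfolded om] P14[unfolded x3u] Pb vterm[unfolded mult_minus_left] C1a
    by linarith
qed

section \<open>Summation over the network and integration over the domain\<close>

text \<open>Exchanging \<open>i\<close> and \<open>j\<close> in one of two copies of the double sum
  turns their total into minus a sum of squares.\<close>

lemma coupling_nonpos:
  fixes y :: "nat \<Rightarrow> real"
  assumes "P \<ge> 0"
  shows "(\<Sum>i<m. (\<Sum>j<m. P * (y j - y i)) * y i) \<le> 0"
proof -
  have "2 * (\<Sum>i<m. (\<Sum>j<m. P * (y j - y i)) * y i)
      = (\<Sum>i<m. \<Sum>j<m. P * (y j - y i) * y i) + (\<Sum>i<m. \<Sum>j<m. P * (y j - y i) * y i)"
    by (simp add: sum_distrib_right)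
  also have "(\<Sum>i<m. \<Sum>j<m. P * (y j - y i) * y i) + (\<Sum>i<m. \<Sum>j<m. P * (y j - y i) * y i)
      = (\<Sum>i<m. \<Sum>j<m. P * (y j - y i) * y i) + (\<Sum>i<m. \<Sum>j<m. P * (y i - y j) * y j)"
    by (subst (2) sum.swap) (rule refl)
  also have "\<dots> = (\<Sum>i<m. \<Sum>j<m. - (P * (y j - y i)^2))"
    by (simp add: sum.distrib[symmetric] power2_eq_square algebra_simps)
  also have "\<dots> \<le> 0" using assms by (intro sum_nonpos) auto
  finally show ?thesis by simp
qed

text \<open>Formulated at one fixed time. A Bochner integral may be split only into integrable
  parts, so every product is first shown to be integrable; then diffusion drops out by sign, the
  network coupling by symmetry, and the pointwise estimate is integrated.\<close>

lemma energy_dissipation: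
  fixes \<Omega> :: "(real^'n) set" and u v w \<rho> u' v' w' r' :: "nat \<Rightarrow> real^'n \<Rightarrow> real"
    and Gu Gr :: "nat \<Rightarrow> real^'n \<Rightarrow> real^'n"
    and a b \<eta>1 \<eta>2 \<alpha> \<beta> q r \<delta> k1 k2 P Q Je ue c \<gamma> :: real
  assumes \<Omega>: "open \<Omega>" "bounded \<Omega>"
    and pos: "a > 0" "b > 0" "\<eta>1 > 0" "\<eta>2 > 0" "\<alpha> > 0" "\<beta> > 0" "q > 0" "r > 0" "\<delta> > 0" "k1 > 0" "k2 > 0"
      "P > 0" "Q > 0" "Je > 0"
    and C1: "C1 = (1 / b) * (\<beta>^2 / 2 + 1 / (2 * k2^3) + 4)"
    and C2: "C2 = (1/4) * (C1 * k1 * (\<bar>c\<bar> + \<gamma>^2 / \<delta>) + 1/4)^2"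
    and lam: "lam = (1/2) * min 1 (min r k2)"
    and c0: "c0 = min C1 1"
    and gu: "\<And>i. i < m \<Longrightarrow> weak_grad \<Omega> (u i) (Gu i)" and gr: "\<And>i. i < m \<Longrightarrow> weak_grad \<Omega> (\<rho> i) (Gr i)"
    and vL2: "\<And>i. i < m \<Longrightarrow> L2 \<Omega> (v i)" and wL2: "\<And>i. i < m \<Longrightarrow> L2 \<Omega> (w i)"
    and u'L2: "\<And>i. i < m \<Longrightarrow> L2 \<Omega> (u' i)" and v'L2: "\<And>i. i < m \<Longrightarrow> L2 \<Omega> (v' i)"
    and w'L2: "\<And>i. i < m \<Longrightarrow> L2 \<Omega> (w' i)"
    and weak_u: "\<And>i \<psi> G\<psi>. i < m \<Longrightarrow> weak_grad \<Omega> \<psi> G\<psi> \<Longrightarrow>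
           (\<integral>x. u' i x * \<psi> x \<partial>lebesgue_on \<Omega>) =
             - \<eta>1 * (\<integral>x. Gu i x \<bullet> G\<psi> x \<partial>lebesgue_on \<Omega>)
             + (\<integral>x. (a * (u i x)^2 - b * (u i x)^3 + v i x - w i x + Je
                       - k1 * (c + \<gamma> * \<rho> i x + \<delta> * (\<rho> i x)^2) * u i x
                       + (\<Sum>j<m. P * (u j x - u i x))) * \<psi> x \<partial>lebesgue_on \<Omega>)"
    and v': "\<And>i. i < m \<Longrightarrow> AE x in lebesgue_on \<Omega>. v' i x = \<alpha> - \<beta> * (u i x)^2 - v i x"
    and w': "\<And>i. i < m \<Longrightarrow> AE x in lebesgue_on \<Omega>. w' i x = q * (u i x - ue) - r * w i x"
    and weak_r: "\<And>i \<psi> G\<psi>. i < m \<Longrightarrow> weak_grad \<Omega> \<psi> G\<psi> \<Longrightarrow>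
           (\<integral>x. r' i x * \<psi> x \<partial>lebesgue_on \<Omega>) =
             - \<eta>2 * (\<integral>x. Gr i x \<bullet> G\<psi> x \<partial>lebesgue_on \<Omega>)
             + (\<integral>x. (u i x - k2 * \<rho> i x + (\<Sum>j<m. Q * (\<rho> j x - \<rho> i x))) * \<psi> x \<partial>lebesgue_on \<Omega>)"
  shows "(\<Sum>i<m. 3/2 * C1 * (\<integral>x. u i x * u' i x \<partial>lebesgue_on \<Omega>)
        + (\<integral>x. (\<alpha> - v i x) * (- v' i x) \<partial>lebesgue_on \<Omega>) + (\<integral>x. w i x * w' i x \<partial>lebesgue_on \<Omega>)
        + 3 * C1 / (2 * q) * (\<integral>x. (w i x + q * ue / r) * w' i x \<partial>lebesgue_on \<Omega>)
        + c0 * (\<integral>x. \<rho> i x * r' i x \<partial>lebesgue_on \<Omega>))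
    \<le> - lam * (\<Sum>i<m. 3/2 * C1 * L2sq \<Omega> (u i) + L2sq \<Omega> (\<lambda>x. \<alpha> - v i x) + L2sq \<Omega> (w i)
        + 3 * C1 / (2 * q) * L2sq \<Omega> (\<lambda>x. w i x + q * ue / r) + c0 * L2sq \<Omega> (\<rho> i))
      + real m * (C2 + (C1 * a)^4 + C1 * Je^2 + (C1^2 * (2 + 1 / r) + C1)^2
         + 2 * \<alpha>^2 + q^2 * ue^2 / r + q^4 / r^2 - \<alpha>^2 / 2) * measure lebesgue \<Omega>"
    (is "?lhs \<le> - lam * ?\<Phi> + real m * ?M * _")
proof -
  let ?N = "lebesgue_on \<Omega>"
  have lm: "\<Omega> \<in> lmeasurable" using \<Omega> by (simp add: lmeasurable_open)
  then have ls: "\<Omega> \<in> sets lebesgue" by auto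
  interpret finite_measure ?N using lm by (rule finite_measure_lebesgue_on)
  have C1pos: "C1 > 0" unfolding C1 using pos by (simp add: add_pos_pos)
  have c0pos: "c0 > 0" using C1pos by (simp add: c0)
  have uL2: "L2 \<Omega> (u i)" and rL2: "L2 \<Omega> (\<rho> i)" if "i < m" for i
    using gu[OF that] gr[OF that] by (simp_all add: weak_grad_def)
  have cL2: "L2 \<Omega> (\<lambda>x. d)" for d by (rule L2_const[OF lm])
  have u2L2: "L2 \<Omega> (\<lambda>x. (u i x)^2)" if "i < m" for i
  proof (rule L2_cong_AE)
    show "L2 \<Omega> (\<lambda>x. (1 / \<beta>) * (\<alpha> - v i x - v' i x))"
      using that vL2 v'L2 by (intro L2_cmult L2_diff cL2) auto
    show "(\<lambda>x. (u i x)^2) \<in> borel_measurable ?N"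
      using L2_measurable[OF uL2[OF that]] by measurable
    show "AE x in ?N. (1 / \<beta>) * (\<alpha> - v i x - v' i x) = (u i x)^2"
      using v'[OF that] by eventually_elim (use pos in simp)
  qed
  define cu where "cu = (\<lambda>i x. \<Sum>j<m. P * (u j x - u i x))"
  define cr where "cr = (\<lambda>i x. \<Sum>j<m. Q * (\<rho> j x - \<rho> i x))"
  have cuL2: "L2 \<Omega> (cu i)" and crL2: "L2 \<Omega> (cr i)" if "i < m" for i
    unfolding cu_def cr_def using that uL2 rL2 by (auto intro!: L2_sum L2_cmult L2_diff)
  define f where "f = (\<lambda>i x. a * (u i x)^2 - b * (u i x)^3 + v i x - w i x + Je
      - k1 * (c + \<gamma> * \<rho> i x + \<delta> * (\<rho> i x)^2) * u i x)"
  have urL2: "L2 \<Omega> (\<lambda>x. \<rho> i x * u i x)" if i: "i < m" for i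
  proof -
    have [measurable]: "u i \<in> borel_measurable ?N" "\<rho> i \<in> borel_measurable ?N" "v i \<in> borel_measurable ?N"
      "w i \<in> borel_measurable ?N" "cu i \<in> borel_measurable ?N"
      using i uL2 rL2 vL2 wL2 cuL2 by (auto simp: L2_def)
    \<comment> \<open>Everything in the equation of \<open>u\<close> except the absorption
      \<open>k1 * \<delta> * \<rho>^2 * u\<close>. Multiplied by \<open>u\<close>, each of its terms
      is already integrable; the one with \<gamma> is the product of \<open>\<rho>\<close> and
      \<open>u^2\<close>, both in L2.\<close>
    let ?R = "\<lambda>x. a * (u i x)^2 - b * (u i x)^3 + v i x - w i x + Je - k1 * (c + \<gamma> * \<rho> i x) * u i x + cu i x"
    have "integrable ?N (\<lambda>x. k1 * \<delta> * (\<rho> i x)^2 * (u i x)^2)"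
    proof (rule absorption_term_integrable[OF \<Omega> gu[OF i] u'L2[OF i], where R = ?R and \<eta> = \<eta>1])
      show "?R \<in> borel_measurable ?N" by measurable
      have "?R x * u i x = a * ((u i x)^2 * u i x) - b * ((u i x)^2 * (u i x)^2) + v i x * u i x - w i x * u i x
          + Je * u i x - k1 * c * (u i x * u i x) - k1 * \<gamma> * (\<rho> i x * (u i x)^2) + cu i x * u i x" for x
        by (simp add: algebra_simps power2_eq_square power3_eq_cube)
      moreover have "integrable ?N (\<lambda>x. a * ((u i x)^2 * u i x) - b * ((u i x)^2 * (u i x)^2) + v i x * u i x - w i x * u i x
          + Je * u i x - k1 * c * (u i x * u i x) - k1 * \<gamma> * (\<rho> i x * (u i x)^2) + cu i x * u i x)"
        by (intro Bochner_Integration.integrable_add Bochner_Integration.integrable_diff integrable_mult_right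
            L2_integrable_mult u2L2 uL2 vL2 wL2 rL2 cuL2 L2_integrable[OF lm] i)
      ultimately show "integrable ?N (\<lambda>x. ?R x * u i x)" by simp
      show "integrable ?N (\<lambda>x. k1 * \<delta> * (\<rho> i x)^2)"
        using L2_integrable_power2[OF rL2[OF i]] by simp
      show "k1 * \<delta> * (\<rho> i x)^2 \<ge> 0" for x using pos by simp
      show "\<eta>1 \<ge> 0" using pos by simp
      fix \<psi> G\<psi> assume "weak_grad \<Omega> \<psi> G\<psi>"
      from weak_u[OF i this]
      show "(\<integral>x. u' i x * \<psi> x \<partial>?N) = - \<eta>1 * (\<integral>x. Gu i x \<bullet> G\<psi> x \<partial>?N)
          + (\<integral>x. (?R x - k1 * \<delta> * (\<rho> i x)^2 * u i x) * \<psi> x \<partial>?N)"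
        by (simp add: cu_def algebra_simps)
    qed
    then have "integrable ?N (\<lambda>x. (1 / (k1 * \<delta>)) * (k1 * \<delta> * (\<rho> i x)^2 * (u i x)^2))"
      by (rule integrable_mult_right)
    moreover have "(1 / (k1 * \<delta>)) * (k1 * \<delta> * (\<rho> i x)^2 * (u i x)^2) = (\<rho> i x * u i x)^2" for x
      using pos by (simp add: power_mult_distrib)
    ultimately show ?thesis unfolding L2_def by simp
  qed
  \<comment> \<open>Every monomial is grouped into a product of two L2 functions, or a single one,
    so that integrability follows term by term.\<close>
  have fu_eq: "f i x * u i x = a * ((u i x)^2 * u i x) - b * ((u i x)^2 * (u i x)^2) + v i x * u i x - w i x * u i x
          + Je * u i x - k1 * c * (u i x * u i x) - k1 * \<gamma> * (\<rho> i x * (u i x)^2)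
          - k1 * \<delta> * ((\<rho> i x * u i x) * (\<rho> i x * u i x))" for i x
    by (simp add: f_def algebra_simps power2_eq_square power3_eq_cube)
  have int_fu: "integrable ?N (\<lambda>x. f i x * u i x)" if "i < m" for i
    unfolding fu_eq
    by (intro Bochner_Integration.integrable_add Bochner_Integration.integrable_diff integrable_mult_right
            L2_integrable_mult u2L2 uL2 vL2 wL2 rL2 urL2 L2_integrable[OF lm] that)
  have int_cu: "integrable ?N (\<lambda>x. cu i x * u i x)" if "i < m" for i
    by (intro L2_integrable_mult cuL2 uL2 that)
  have int_cr: "integrable ?N (\<lambda>x. cr i x * \<rho> i x)" if "i < m" for i
    by (intro L2_integrable_mult crL2 rL2 that)
  have hL2: "L2 \<Omega> (\<lambda>x. u i x - k2 * \<rho> i x)" if "i < m" for i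
    by (intro L2_diff L2_cmult uL2 rL2 that)
  have grad: "(\<integral>x. G x \<bullet> G x \<partial>?N) \<ge> 0" for G :: "real^'n \<Rightarrow> real^'n"
    by (rule Bochner_Integration.integral_nonneg) simp
  have Iu: "(\<integral>x. u i x * u' i x \<partial>?N) \<le> (\<integral>x. f i x * u i x \<partial>?N) + (\<integral>x. cu i x * u i x \<partial>?N)" if i: "i < m" for i
  proof -
    have "(\<integral>x. u i x * u' i x \<partial>?N) = - \<eta>1 * (\<integral>x. Gu i x \<bullet> Gu i x \<partial>?N) + (\<integral>x. (f i x + cu i x) * u i x \<partial>?N)"
      using weak_u[OF i gu[OF i]] by (simp only: f_def cu_def mult.commute[of "u i _" "u' i _"])
    also have "(\<integral>x. (f i x + cu i x) * u i x \<partial>?N) = (\<integral>x. f i x * u i x \<partial>?N) + (\<integral>x. cu i x * u i x \<partial>?N)"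
      unfolding distrib_right by (rule Bochner_Integration.integral_add[OF int_fu[OF i] int_cu[OF i]])
    finally show ?thesis using mult_nonneg_nonneg[OF less_imp_le[OF pos(3)] grad[of "Gu i"]] by linarith
  qed
  have Ir: "(\<integral>x. \<rho> i x * r' i x \<partial>?N) \<le> (\<integral>x. (u i x - k2 * \<rho> i x) * \<rho> i x \<partial>?N) + (\<integral>x. cr i x * \<rho> i x \<partial>?N)" if i: "i < m" for i
  proof -
    have "(\<integral>x. \<rho> i x * r' i x \<partial>?N) = - \<eta>2 * (\<integral>x. Gr i x \<bullet> Gr i x \<partial>?N) + (\<integral>x. (u i x - k2 * \<rho> i x + cr i x) * \<rho> i x \<partial>?N)"
      using weak_r[OF i gr[OF i]] by (simp only: cr_def mult.commute[of "\<rho> i _" "r' i _"])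
    also have "(\<integral>x. (u i x - k2 * \<rho> i x + cr i x) * \<rho> i x \<partial>?N)
        = (\<integral>x. (u i x - k2 * \<rho> i x) * \<rho> i x \<partial>?N) + (\<integral>x. cr i x * \<rho> i x \<partial>?N)"
      unfolding distrib_right by (rule Bochner_Integration.integral_add[OF L2_integrable_mult[OF hL2[OF i] rL2[OF i]] int_cr[OF i]])
    finally show ?thesis using mult_nonneg_nonneg[OF less_imp_le[OF pos(4)] grad[of "Gr i"]] by linarith
  qed
  define gv where "gv = (\<lambda>i x. \<alpha> - \<beta> * (u i x)^2 - v i x)"
  define gw where "gw = (\<lambda>i x. q * (u i x - ue) - r * w i x)"
  have gvL2: "L2 \<Omega> (gv i)" and gwL2: "L2 \<Omega> (gw i)" if "i < m" for i
    unfolding gv_def gw_def by (intro L2_diff L2_cmult cL2 u2L2 uL2 vL2 wL2 that)+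
  have \<nu>L2: "L2 \<Omega> (\<lambda>x. \<alpha> - v i x)" and \<omega>L2: "L2 \<Omega> (\<lambda>x. w i x + q * ue / r)" if "i < m" for i
    by (intro L2_diff L2_add cL2 vL2 wL2 that)+
  have Iv: "(\<integral>x. (\<alpha> - v i x) * (- v' i x) \<partial>?N) = (\<integral>x. (\<alpha> - v i x) * (- gv i x) \<partial>?N)" if i: "i < m" for i
  proof (rule integral_cong_AE)
    show "AE x in ?N. (\<alpha> - v i x) * (- v' i x) = (\<alpha> - v i x) * (- gv i x)"
      using v'[OF i] by eventually_elim (simp add: gv_def)
  qed (use L2_measurable[OF v'L2[OF i]] L2_measurable[OF vL2[OF i]] L2_measurable[OF gvL2[OF i]] in measurable)
  have Iw: "(\<integral>x. (w i x + d) * w' i x \<partial>?N) = (\<integral>x. (w i x + d) * gw i x \<partial>?N)" if i: "i < m" for i d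
  proof (rule integral_cong_AE)
    show "AE x in ?N. (w i x + d) * w' i x = (w i x + d) * gw i x"
      using w'[OF i] by eventually_elim (simp add: gw_def)
  qed (use L2_measurable[OF w'L2[OF i]] L2_measurable[OF wL2[OF i]] L2_measurable[OF gwL2[OF i]] in measurable)
  let ?e = "\<lambda>i x. 3/2 * C1 * (f i x * u i x) + (\<alpha> - v i x) * (- gv i x) + w i x * gw i x
      + 3 * C1 / (2 * q) * ((w i x + q * ue / r) * gw i x) + c0 * ((u i x - k2 * \<rho> i x) * \<rho> i x)"
  let ?\<phi> = "\<lambda>i x. 3/2 * C1 * (u i x)^2 + (\<alpha> - v i x)^2 + (w i x)^2
      + 3 * C1 / (2 * q) * (w i x + q * ue / r)^2 + c0 * (\<rho> i x)^2"
  have i1: "integrable ?N (\<lambda>x. (\<alpha> - v i x) * (- gv i x))" "integrable ?N (\<lambda>x. w i x * gw i x)"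
    "integrable ?N (\<lambda>x. (w i x + q * ue / r) * gw i x)" "integrable ?N (\<lambda>x. (u i x - k2 * \<rho> i x) * \<rho> i x)" if "i < m" for i
    by (intro L2_integrable_mult \<nu>L2 \<omega>L2 L2_minus gvL2 gwL2 wL2 rL2 hL2 that)+
  have ie: "integrable ?N (?e i)" if "i < m" for i
    by (intro Bochner_Integration.integrable_add integrable_mult_right i1 int_fu that)
  have i\<phi>: "integrable ?N (?\<phi> i)" if "i < m" for i
    by (intro Bochner_Integration.integrable_add integrable_mult_right L2_integrable_power2 uL2 \<nu>L2 wL2 \<omega>L2 rL2 that)
  have int_e: "(\<integral>x. ?e i x \<partial>?N) = 3/2 * C1 * (\<integral>x. f i x * u i x \<partial>?N) + (\<integral>x. (\<alpha> - v i x) * (- gv i x) \<partial>?N)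
      + (\<integral>x. w i x * gw i x \<partial>?N) + 3 * C1 / (2 * q) * (\<integral>x. (w i x + q * ue / r) * gw i x \<partial>?N)
      + c0 * (\<integral>x. (u i x - k2 * \<rho> i x) * \<rho> i x \<partial>?N)" if i: "i < m" for i
    using i1[OF i] int_fu[OF i]
    by (simp only: Bochner_Integration.integral_add Bochner_Integration.integrable_add integrable_mult_right integral_mult_right_zero)
  have int_\<phi>: "(\<integral>x. ?\<phi> i x \<partial>?N) = 3/2 * C1 * L2sq \<Omega> (u i) + L2sq \<Omega> (\<lambda>x. \<alpha> - v i x) + L2sq \<Omega> (w i)
        + 3 * C1 / (2 * q) * L2sq \<Omega> (\<lambda>x. w i x + q * ue / r) + c0 * L2sq \<Omega> (\<rho> i)" if i: "i < m" for i
    using L2_integrable_power2[OF uL2[OF i]] L2_integrable_power2[OF \<nu>L2[OF i]] L2_integrable_power2[OF wL2[OF i]]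
      L2_integrable_power2[OF \<omega>L2[OF i]] L2_integrable_power2[OF rL2[OF i]]
    by (simp only: L2sq_def Bochner_Integration.integral_add Bochner_Integration.integrable_add integrable_mult_right integral_mult_right_zero)
  have pointwise: "?e i x \<le> - lam * ?\<phi> i x + ?M" for i x
    using reaction_energy_pointwise[OF pos(1,2,5,6,7,8,9,10,11,14) C1 C2 lam c0 refl refl,
        where u = "u i x" and v = "v i x" and w = "w i x" and ue = ue and \<rho> = "\<rho> i x"]
    by (simp only: f_def gv_def gw_def mult_ac mult_minus_right mult_minus_left add_uminus_conv_diff)
  have step: "(\<integral>x. ?e i x \<partial>?N) \<le> - lam * (\<integral>x. ?\<phi> i x \<partial>?N) + ?M * measure lebesgue \<Omega>" if i: "i < m" for i
  proof -
    have "(\<integral>x. ?e i x \<partial>?N) \<le> (\<integral>x. - lam * ?\<phi> i x + ?M \<partial>?N)"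
      by (rule integral_mono[OF ie[OF i] _ pointwise])
         (intro Bochner_Integration.integrable_add integrable_mult_right i\<phi> i integrable_const)
    also have "\<dots> = - lam * (\<integral>x. ?\<phi> i x \<partial>?N) + (\<integral>x. ?M \<partial>?N)"
      by (subst Bochner_Integration.integral_add[OF integrable_mult_right[OF i\<phi>[OF i]] integrable_const])
         (simp only: integral_mult_right_zero)
    also have "(\<integral>x. ?M \<partial>?N) = ?M * measure lebesgue \<Omega>"
      by (simp only: lebesgue_integral_const) (simp add: measure_restrict_space ls mult.commute)
    finally show ?thesis .
  qed
  \<comment> \<open>The coupling has a sign only after summation over all neurons, so it is kept
    apart until the sum is formed.\<close>
  have cu_le: "(\<Sum>i<m. \<integral>x. cu i x * u i x \<partial>?N) \<le> 0"
  proof -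
    have "(\<Sum>i<m. \<integral>x. cu i x * u i x \<partial>?N) = (\<integral>x. (\<Sum>i<m. cu i x * u i x) \<partial>?N)"
      by (rule Bochner_Integration.integral_sum[symmetric]) (use int_cu in auto)
    moreover have "0 \<le> (\<integral>x. - (\<Sum>i<m. cu i x * u i x) \<partial>?N)"
      unfolding cu_def by (rule Bochner_Integration.integral_nonneg) (use coupling_nonpos[of P _ m] pos in simp)
    ultimately show ?thesis by simp
  qed
  have cr_le: "(\<Sum>i<m. \<integral>x. cr i x * \<rho> i x \<partial>?N) \<le> 0"
  proof -
    have "(\<Sum>i<m. \<integral>x. cr i x * \<rho> i x \<partial>?N) = (\<integral>x. (\<Sum>i<m. cr i x * \<rho> i x) \<partial>?N)"
      by (rule Bochner_Integration.integral_sum[symmetric]) (use int_cr in auto)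
    moreover have "0 \<le> (\<integral>x. - (\<Sum>i<m. cr i x * \<rho> i x) \<partial>?N)"
      unfolding cr_def by (rule Bochner_Integration.integral_nonneg) (use coupling_nonpos[of Q _ m] pos in simp)
    ultimately show ?thesis by simp
  qed
  have "?lhs \<le> (\<Sum>i<m. (\<integral>x. ?e i x \<partial>?N) + 3/2 * C1 * (\<integral>x. cu i x * u i x \<partial>?N) + c0 * (\<integral>x. cr i x * \<rho> i x \<partial>?N))"
  proof (rule sum_mono)
    fix i assume "i \<in> {..<m}" then have i: "i < m" by simp
    have "3/2 * C1 * (\<integral>x. u i x * u' i x \<partial>?N) \<le> 3/2 * C1 * ((\<integral>x. f i x * u i x \<partial>?N) + (\<integral>x. cu i x * u i x \<partial>?N))"
      using Iu[OF i] C1pos by (intro mult_left_mono) auto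
    moreover have "c0 * (\<integral>x. \<rho> i x * r' i x \<partial>?N) \<le> c0 * ((\<integral>x. (u i x - k2 * \<rho> i x) * \<rho> i x \<partial>?N) + (\<integral>x. cr i x * \<rho> i x \<partial>?N))"
      using Ir[OF i] c0pos by (intro mult_left_mono) auto
    moreover have "(\<integral>x. w i x * w' i x \<partial>?N) = (\<integral>x. w i x * gw i x \<partial>?N)" using Iw[OF i, of 0] by simp
    ultimately show "3/2 * C1 * (\<integral>x. u i x * u' i x \<partial>?N)
        + (\<integral>x. (\<alpha> - v i x) * (- v' i x) \<partial>?N) + (\<integral>x. w i x * w' i x \<partial>?N)
        + 3 * C1 / (2 * q) * (\<integral>x. (w i x + q * ue / r) * w' i x \<partial>?N)
        + c0 * (\<integral>x. \<rho> i x * r' i x \<partial>?N)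
      \<le> (\<integral>x. ?e i x \<partial>?N) + 3/2 * C1 * (\<integral>x. cu i x * u i x \<partial>?N) + c0 * (\<integral>x. cr i x * \<rho> i x \<partial>?N)"
      unfolding int_e[OF i] Iv[OF i] Iw[OF i] distrib_left by linarith
  qed
  also have "\<dots> = (\<Sum>i<m. \<integral>x. ?e i x \<partial>?N) + 3/2 * C1 * (\<Sum>i<m. \<integral>x. cu i x * u i x \<partial>?N)
      + c0 * (\<Sum>i<m. \<integral>x. cr i x * \<rho> i x \<partial>?N)"
    by (simp only: sum.distrib sum_distrib_left)
  also have "\<dots> \<le> (\<Sum>i<m. \<integral>x. ?e i x \<partial>?N)"
    using mult_nonneg_nonpos[OF _ cu_le, of "3/2 * C1"] mult_nonneg_nonpos[OF _ cr_le, of c0] C1pos c0pos by simp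
  also have "\<dots> \<le> (\<Sum>i<m. - lam * (\<integral>x. ?\<phi> i x \<partial>?N) + ?M * measure lebesgue \<Omega>)"
    by (rule sum_mono, rule step) simp
  also have "\<dots> = - lam * (\<Sum>i<m. \<integral>x. ?\<phi> i x \<partial>?N) + real m * ?M * measure lebesgue \<Omega>"
    by (simp only: sum.distrib sum_distrib_left[symmetric] sum_constant card_lessThan mult.assoc mult.left_commute[of _ "real m"])
  also have "(\<Sum>i<m. \<integral>x. ?\<phi> i x \<partial>?N) = ?\<Phi>"
    by (rule sum.cong[OF refl], rule int_\<phi>) simp
  finally show ?thesis .
qed

section \<open>Absorbing ball\<close>

lemma inE_L2_component:
  assumes "inE \<Omega> m h" "i < m"
  shows "L2 \<Omega> (\<lambda>x. h i x $ k)"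
proof -
  have m: "h i \<in> borel_measurable (lebesgue_on \<Omega>)" and int: "integrable (lebesgue_on \<Omega>) (\<lambda>x. (norm (h i x))^2)"
    using assms by (auto simp: inE_def)
  have mk: "(\<lambda>x. h i x $ k) \<in> borel_measurable (lebesgue_on \<Omega>)"
    by (rule borel_measurable_continuous_on[OF _ m]) (intro continuous_intros)
  have "integrable (lebesgue_on \<Omega>) (\<lambda>x. (h i x $ k)^2)"
  proof (rule Bochner_Integration.integrable_bound[OF int])
    show "AE x in lebesgue_on \<Omega>. norm ((h i x $ k)^2) \<le> norm ((norm (h i x))^2)"
    proof (rule AE_I2)
      fix x
      have "\<bar>h i x $ k\<bar>^2 \<le> (norm (h i x))^2"
        by (rule power_mono[OF component_le_norm_cart]) simp
      then show "norm ((h i x $ k)^2) \<le> norm ((norm (h i x))^2)" by simp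
    qed
  qed (use mk in measurable)
  then show ?thesis using mk by (simp add: L2_def)
qed

lemma integral_norm_power2_components:
  fixes h :: "nat \<Rightarrow> real^'n \<Rightarrow> real^4"
  assumes "inE \<Omega> m h" "i < m"
  shows "(\<integral>x. (norm (h i x))^2 \<partial>lebesgue_on \<Omega>)
    = L2sq \<Omega> (\<lambda>x. h i x $ 1) + L2sq \<Omega> (\<lambda>x. h i x $ 2) + L2sq \<Omega> (\<lambda>x. h i x $ 3) + L2sq \<Omega> (\<lambda>x. h i x $ 4)"
proof -
  have "(norm (h i x))^2 = (h i x $ 1)^2 + (h i x $ 2)^2 + (h i x $ 3)^2 + (h i x $ 4)^2" for x
    by (subst power2_norm_eq_inner) (simp add: inner_vec_def sum_4 power2_eq_square)
  then show ?thesis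
    using L2_integrable_power2[OF inE_L2_component[OF assms]]
    by (simp add: L2sq_def)
qed

text \<open>Initial data are attained only in the L2 sense; this carries the bound on
  \<open>g0\<close> over to \<open>g 0\<close>. Integrability of the squared difference has to come
  first, since otherwise the value 0 might be the default of a nonexistent integral.\<close>

lemma inE_cong_integral_eq_0:
  assumes "inE \<Omega> m g" "inE \<Omega> m h" "i < m"
    and zero: "(\<integral>x. (norm (g i x - h i x))^2 \<partial>lebesgue_on \<Omega>) = 0"
  shows "(\<integral>x. (norm (g i x))^2 \<partial>lebesgue_on \<Omega>) = (\<integral>x. (norm (h i x))^2 \<partial>lebesgue_on \<Omega>)"
proof -
  have [measurable]: "g i \<in> borel_measurable (lebesgue_on \<Omega>)" "h i \<in> borel_measurable (lebesgue_on \<Omega>)"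
    and int: "integrable (lebesgue_on \<Omega>) (\<lambda>x. (norm (g i x))^2)" "integrable (lebesgue_on \<Omega>) (\<lambda>x. (norm (h i x))^2)"
    using assms by (auto simp: inE_def)
  have "integrable (lebesgue_on \<Omega>) (\<lambda>x. (norm (g i x - h i x))^2)"
  proof (rule Bochner_Integration.integrable_bound[where f = "\<lambda>x. 2 * (norm (g i x))^2 + 2 * (norm (h i x))^2"])
    show "integrable (lebesgue_on \<Omega>) (\<lambda>x. 2 * (norm (g i x))^2 + 2 * (norm (h i x))^2)" using int by simp
    have "(norm (y - z))^2 \<le> 2 * (norm y)^2 + 2 * (norm z)^2" for y z :: "real^4"
    proof -
      have "(norm (y - z))^2 \<le> (norm y + norm z)^2" by (intro power_mono norm_triangle_ineq4) simp
      also have "\<dots> \<le> 2 * (norm y)^2 + 2 * (norm z)^2"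
        using sum_squares_bound[of "norm y" "norm z"] by (simp add: power2_sum)
      finally show ?thesis .
    qed
    then show "AE x in lebesgue_on \<Omega>. norm ((norm (g i x - h i x))^2) \<le> norm (2 * (norm (g i x))^2 + 2 * (norm (h i x))^2)"
      by (intro AE_I2) simp
  qed measurable
  then have "AE x in lebesgue_on \<Omega>. (norm (g i x - h i x))^2 = 0"
    using zero by (subst integral_nonneg_eq_0_iff_AE[symmetric]) auto
  then have "AE x in lebesgue_on \<Omega>. (norm (g i x))^2 = (norm (h i x))^2"
    by eventually_elim simp
  then show ?thesis by (intro integral_cong_AE) auto
qed

section \<open>Continuity and differentiability in time of a solution\<close>

lemma cont_L2_affine:
  assumes "cont_L2 \<Omega> f"
  shows "cont_L2 \<Omega> (\<lambda>t x. k * f t x + d)"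
proof -
  have "L2sq \<Omega> (\<lambda>x. k * f s x + d - (k * f t x + d)) = k^2 * L2sq \<Omega> (\<lambda>x. f s x - f t x)" for s t
    unfolding L2sq_def
    by (subst integral_mult_right_zero[symmetric]) (simp add: power_mult_distrib[symmetric] right_diff_distrib)
  moreover have "((\<lambda>s. k^2 * L2sq \<Omega> (\<lambda>x. f s x - f t x)) \<longlongrightarrow> 0) (at t within {0..})" if "t \<ge> 0" for t
    using assms that by (intro tendsto_mult_right_zero) (auto simp: cont_L2_def)
  ultimately show ?thesis by (simp add: cont_L2_def)
qed

lemma cont_L2_continuous_on_integral_mult:
  assumes "cont_L2 \<Omega> f" "cont_L2 \<Omega> g" "\<And>t. t \<ge> 0 \<Longrightarrow> L2 \<Omega> (f t)" "\<And>t. t \<ge> 0 \<Longrightarrow> L2 \<Omega> (g t)"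
  shows "continuous_on {0..} (\<lambda>t. \<integral>x. f t x * g t x \<partial>lebesgue_on \<Omega>)"
  unfolding continuous_on_def
proof (intro ballI L2sq_tendsto_integral_mult)
  fix t :: real assume "t \<in> {0..}"
  then show "((\<lambda>s. L2sq \<Omega> (\<lambda>x. f s x - f t x)) \<longlongrightarrow> 0) (at t within {0..})"
    "((\<lambda>s. L2sq \<Omega> (\<lambda>x. g s x - g t x)) \<longlongrightarrow> 0) (at t within {0..})" "L2 \<Omega> (f t)" "L2 \<Omega> (g t)"
    using assms by (auto simp: cont_L2_def)
  show "\<forall>\<^sub>F s in at t within {0..}. L2 \<Omega> (f s)" "\<forall>\<^sub>F s in at t within {0..}. L2 \<Omega> (g s)"
    using assms(3,4) by (auto simp: eventually_at_filter)
qed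

lemma cont_L2_continuous_on_L2sq:
  assumes "cont_L2 \<Omega> f" "\<And>t. t \<ge> 0 \<Longrightarrow> L2 \<Omega> (f t)"
  shows "continuous_on {0..} (\<lambda>t. L2sq \<Omega> (f t))"
  using cont_L2_continuous_on_integral_mult[OF assms(1,1) assms(2,2)] by (simp add: L2sq_def power2_eq_square)

lemma cont_L2_continuous_on_integral:
  assumes "cont_L2 \<Omega> f" "\<And>t. t \<ge> 0 \<Longrightarrow> L2 \<Omega> (f t)" "\<Omega> \<in> lmeasurable"
  shows "continuous_on {0..} (\<lambda>t. \<integral>x. f t x \<partial>lebesgue_on \<Omega>)"
  using cont_L2_continuous_on_integral_mult[of \<Omega> f "\<lambda>t x. 1"] assms L2_const[OF assms(3)]
  by (simp add: cont_L2_def L2sq_def)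

lemma eventually_nhds_pos: "(t::real) > 0 \<Longrightarrow> (\<And>s. s > 0 \<Longrightarrow> P s) \<Longrightarrow> \<forall>\<^sub>F s in nhds t. P s"
  using eventually_nhds_in_open[of "{0<..}" t] by (auto elim: eventually_mono)

lemma C1_H1D:
  assumes "C1_H1 \<Omega> f G f' G'" "t > 0"
  shows "weak_grad \<Omega> (f t) (G t)" "L2 \<Omega> (f' t)"
  using assms by (simp_all add: C1_H1_def weak_grad_def)

lemma C1_L2D:
  assumes "C1_L2 \<Omega> f f'" "t > 0"
  shows "L2 \<Omega> (f t)" "L2 \<Omega> (f' t)"
  using assms by (simp_all add: C1_L2_def)

lemma C1_L2_imp_L2_deriv:
  assumes "C1_L2 \<Omega> f f'" "t > 0"
  shows "L2_deriv \<Omega> f (f' t) t"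
  using assms unfolding C1_L2_def L2_deriv_def by (auto intro: eventually_nhds_pos)

text \<open>The gradient part of the H1 quotient is nonnegative, so the L2 part is squeezed to 0
  along with the sum.\<close>

lemma C1_H1_imp_L2_deriv:
  assumes "C1_H1 \<Omega> f G f' G'" "t > 0"
  shows "L2_deriv \<Omega> f (f' t) t"
proof -
  have f: "L2 \<Omega> (f s)" "L2 \<Omega> (f' s)" if "s > 0" for s
    using assms(1) that by (auto simp: C1_H1_def weak_grad_def)
  have lim: "((\<lambda>s. L2sq \<Omega> (\<lambda>x. (f s x - f t x) / (s - t) - f' t x)
          + gradsq \<Omega> (\<lambda>x. (1 / (s - t)) *\<^sub>R (G s x - G t x) - G' t x)) \<longlongrightarrow> 0) (at t)"
    using assms by (simp add: C1_H1_def)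
  have "gradsq \<Omega> H \<ge> 0" for H
    unfolding gradsq_def by (rule Bochner_Integration.integral_nonneg) simp
  then have "((\<lambda>s. L2sq \<Omega> (\<lambda>x. (f s x - f t x) / (s - t) - f' t x)) \<longlongrightarrow> 0) (at t)"
    by (intro tendsto_sandwich[OF _ _ tendsto_const lim] always_eventually allI) (simp_all add: L2sq_nonneg)
  then show ?thesis
    using f assms(2) unfolding L2_deriv_def by (auto intro: eventually_nhds_pos)
qed

section \<open>Comparison of the energy with the norm on E, and the uniform bound\<close>

lemma L2sq_affine_le:
  assumes "\<Omega> \<in> lmeasurable" "L2 \<Omega> f"
  shows "L2sq \<Omega> (\<lambda>x. k * f x + d) \<le> 2 * k^2 * L2sq \<Omega> f + 2 * d^2 * measure lebesgue \<Omega>"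
proof -
  interpret finite_measure "lebesgue_on \<Omega>" using assms(1) by (rule finite_measure_lebesgue_on)
  have ls: "\<Omega> \<in> sets lebesgue" using assms(1) by auto
  note int = L2_integrable_power2[OF assms(2)]
  have "L2sq \<Omega> (\<lambda>x. k * f x + d) \<le> (\<integral>x. 2 * k^2 * (f x)^2 + 2 * d^2 \<partial>lebesgue_on \<Omega>)"
    unfolding L2sq_def
  proof (rule integral_mono)
    show "integrable (lebesgue_on \<Omega>) (\<lambda>x. (k * f x + d)^2)"
      by (intro L2_integrable_power2 L2_add L2_cmult L2_const assms)
    show "integrable (lebesgue_on \<Omega>) (\<lambda>x. 2 * k^2 * (f x)^2 + 2 * d^2)" using int by simp
    show "(k * f x + d)^2 \<le> 2 * k^2 * (f x)^2 + 2 * d^2" for x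
      using sum_squares_bound[of "k * f x" d] by (simp add: power2_sum power_mult_distrib)
  qed
  also have "\<dots> = 2 * k^2 * L2sq \<Omega> f + 2 * d^2 * measure lebesgue \<Omega>"
    using int by (simp add: L2sq_def measure_restrict_space ls)
  finally show ?thesis .
qed

text \<open>Used with \<open>d = \<alpha>\<close> to return from \<open>\<nu>\<close> to
  \<open>v\<close>. For positive \<open>d\<close> the linear term hurts only where the integral of
  \<open>d - f\<close> is negative.\<close>

lemma L2sq_shift:
  assumes "\<Omega> \<in> lmeasurable" "L2 \<Omega> f"
  shows "L2sq \<Omega> f = L2sq \<Omega> (\<lambda>x. d - f x) - 2 * d * (\<integral>x. d - f x \<partial>lebesgue_on \<Omega>) + d^2 * measure lebesgue \<Omega>"
proof -
  interpret finite_measure "lebesgue_on \<Omega>" using assms(1) by (rule finite_measure_lebesgue_on)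
  have ls: "\<Omega> \<in> sets lebesgue" using assms(1) by auto
  have n: "L2 \<Omega> (\<lambda>x. d - f x)" by (intro L2_diff L2_const assms)
  note int = L2_integrable_power2[OF n] L2_integrable[OF assms(1) n]
  have "(f x)^2 = (d - f x)^2 - 2 * d * (d - f x) + d^2" for x
    by (simp add: power2_eq_square algebra_simps)
  then have "L2sq \<Omega> f = (\<integral>x. (d - f x)^2 - 2 * d * (d - f x) + d^2 \<partial>lebesgue_on \<Omega>)"
    by (simp only: L2sq_def)
  also have "\<dots> = (\<integral>x. (d - f x)^2 \<partial>lebesgue_on \<Omega>) - 2 * d * (\<integral>x. d - f x \<partial>lebesgue_on \<Omega>) + (\<integral>x. d^2 \<partial>lebesgue_on \<Omega>)"
    using int by (simp only: Bochner_Integration.integral_add Bochner_Integration.integral_diff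
        Bochner_Integration.integrable_diff integrable_mult_right integrable_const integral_mult_right_zero)
  also have "(\<integral>x. d^2 \<partial>lebesgue_on \<Omega>) = d^2 * measure lebesgue \<Omega>"
    by (simp add: measure_restrict_space ls mult.commute)
  finally show ?thesis by (simp add: L2sq_def)
qed

text \<open>\<open>A\<close> and \<open>D\<close> are chosen before the solution and depend on it
  only through the bound \<open>R\<close>; this is what makes the entrance time uniform over a
  bounded set. The rate \<open>2 * lam\<close> belongs to the energy, the rate 1 to the integral of
  \<open>\<nu>\<close>.\<close>

lemma hr_normE2_bound:
  fixes \<Omega> :: "(real^'n) set" and m :: nat
    and a b \<eta>1 \<eta>2 \<alpha> \<beta> q r \<delta> k1 k2 P Q Je ue c \<gamma> R :: real
  assumes \<Omega>: "open \<Omega>" "bounded \<Omega>"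
    and pos: "a > 0" "b > 0" "\<eta>1 > 0" "\<eta>2 > 0" "\<alpha> > 0" "\<beta> > 0" "q > 0" "r > 0" "\<delta> > 0" "k1 > 0" "k2 > 0"
      "P > 0" "Q > 0" "Je > 0"
    and C1: "C1 = (1 / b) * (\<beta>^2 / 2 + 1 / (2 * k2^3) + 4)"
    and C2: "C2 = (1/4) * (C1 * k1 * (\<bar>c\<bar> + \<gamma>^2 / \<delta>) + 1/4)^2"
    and lam: "lam = (1/2) * min 1 (min r k2)"
    and c0: "c0 = min C1 1"
    and M1: "M1 = C2 + (C1 * a)^4 + C1 * Je^2 + (C1^2 * (2 + 1 / r) + C1)^2
                           + 2 * \<alpha>^2 + q^2 * ue^2 / r + q^4 / r^2"
  shows "\<exists>A D. \<forall>g0 g. inE \<Omega> m g0 \<longrightarrow> normE2 \<Omega> m g0 \<le> R \<longrightarrow>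
      hr_weak_solution \<Omega> m a b \<eta>1 \<eta>2 \<alpha> \<beta> q r \<delta> k1 k2 P Q Je ue c \<gamma> g0 g \<longrightarrow>
      (\<forall>t\<ge>0. normE2 \<Omega> m (g t) \<le> real m * M1 / (lam * c0) * measure lebesgue \<Omega>
        + A * exp (- (2 * lam) * t) + D * exp (- 1 * t))"
proof -
  let ?N = "lebesgue_on \<Omega>"
  define L where "L = measure lebesgue \<Omega>"
  have L0: "L \<ge> 0" by (simp add: L_def)
  have lm: "\<Omega> \<in> lmeasurable" using \<Omega> by (simp add: lmeasurable_open)
  have C1pos: "C1 > 0" unfolding C1 using pos by (simp add: add_pos_pos)
  have c0pos: "c0 > 0" "c0 \<le> C1" "c0 \<le> 1" using C1pos by (auto simp: c0)
  have lampos: "lam > 0" "lam \<le> 1/2" using pos by (auto simp: lam)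
  define K where "K = 3 * C1 / (2 * q)"
  have K0: "K > 0" using C1pos pos by (simp add: K_def)
  define d where "d = q * ue / r"
  \<comment> \<open>A common upper bound for the weights that the squared norm of \<open>g 0\<close>
    receives in the energy: \<open>3/2 * C1\<close>, 2, \<open>1 + 2 * K\<close> and
    \<open>c0\<close>. The factors 2 come from squaring the shifts by \<open>\<alpha>\<close> and
    \<open>d\<close>.\<close>
  define kk where "kk = 3/2 * C1 + 3 + 2 * K"
  define \<Phi>b where "\<Phi>b = kk * R + real m * (2 * \<alpha>^2 * L + K * (2 * d^2 * L))"
  define Sb where "Sb = 2 * R + real m * (2 * \<alpha>^2 * L + L)"
  \<comment> \<open>The equilibrium value of the linear differential inequality for the
    energy.\<close>
  define \<Phi>i where "\<Phi>i = real m * (M1 - \<alpha>^2 / 2) * L / lam"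
  define A where "A = (\<Phi>b - \<Phi>i) / c0"
  define D where "D = 2 * \<alpha> * Sb"
  have main: "normE2 \<Omega> m (g t) \<le> real m * M1 / (lam * c0) * L + A * exp (- (2 * lam) * t) + D * exp (- 1 * t)"
    if g0: "inE \<Omega> m g0" "normE2 \<Omega> m g0 \<le> R" and sol: "hr_weak_solution \<Omega> m a b \<eta>1 \<eta>2 \<alpha> \<beta> q r \<delta> k1 k2 P Q Je ue c \<gamma> g0 g"
      and t: "t \<ge> 0" for g0 g t
  proof -
    define u where "u = (\<lambda>i t x. g t i x $ 1)"
    define v where "v = (\<lambda>i t x. g t i x $ 2)"
    define w where "w = (\<lambda>i t x. g t i x $ 3)"
    define \<rho> where "\<rho> = (\<lambda>i t x. g t i x $ 4)"
    note sol' = sol[unfolded hr_weak_solution_def Let_def]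
    note s1 = conjunct1[OF sol'] and s2 = conjunct1[OF conjunct2[OF sol']]
      and s3 = conjunct1[OF conjunct2[OF conjunct2[OF sol']]] and s4 = conjunct2[OF conjunct2[OF conjunct2[OF sol']]]
    have inE: "inE \<Omega> m (g t)" if "t \<ge> 0" for t using s1 that by simp
    have cont: "cont_L2 \<Omega> (u i)" "cont_L2 \<Omega> (v i)" "cont_L2 \<Omega> (w i)" "cont_L2 \<Omega> (\<rho> i)" if "i < m" for i
      using s2[rule_format, OF that] by (simp_all add: u_def v_def w_def \<rho>_def)
    have init: "(\<integral>x. (norm (g 0 i x - g0 i x))^2 \<partial>?N) = 0" if "i < m" for i
      using s3[rule_format, OF that] .
    obtain Gu Gr u' v' w' r' Gu' Gr' where
      diff': "\<forall>i<m. C1_H1 \<Omega> (u i) (Gu i) (u' i) (Gu' i) \<and> C1_L2 \<Omega> (v i) (v' i) \<and>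
               C1_L2 \<Omega> (w i) (w' i) \<and> C1_H1 \<Omega> (\<rho> i) (Gr i) (r' i) (Gr' i)"
      and eu: "\<forall>i<m. \<forall>t>0. \<forall>\<psi> G\<psi>. weak_grad \<Omega> \<psi> G\<psi> \<longrightarrow>
           (\<integral>x. u' i t x * \<psi> x \<partial>lebesgue_on \<Omega>) =
             - \<eta>1 * (\<integral>x. Gu i t x \<bullet> G\<psi> x \<partial>lebesgue_on \<Omega>)
             + (\<integral>x. (a * (u i t x)^2 - b * (u i t x)^3 + v i t x - w i t x + Je
                       - k1 * (c + \<gamma> * \<rho> i t x + \<delta> * (\<rho> i t x)^2) * u i t x
                       + (\<Sum>j<m. P * (u j t x - u i t x))) * \<psi> x \<partial>lebesgue_on \<Omega>)"
      and ev: "\<forall>i<m. \<forall>t>0. AE x in lebesgue_on \<Omega>. v' i t x = \<alpha> - \<beta> * (u i t x)^2 - v i t x"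
      and ew: "\<forall>i<m. \<forall>t>0. AE x in lebesgue_on \<Omega>. w' i t x = q * (u i t x - ue) - r * w i t x"
      and er: "\<forall>i<m. \<forall>t>0. \<forall>\<psi> G\<psi>. weak_grad \<Omega> \<psi> G\<psi> \<longrightarrow>
           (\<integral>x. r' i t x * \<psi> x \<partial>lebesgue_on \<Omega>) =
             - \<eta>2 * (\<integral>x. Gr i t x \<bullet> G\<psi> x \<partial>lebesgue_on \<Omega>)
             + (\<integral>x. (u i t x - k2 * \<rho> i t x
                       + (\<Sum>j<m. Q * (\<rho> j t x - \<rho> i t x))) * \<psi> x \<partial>lebesgue_on \<Omega>)"
      using s4 by (elim exE conjE) (rule that[unfolded u_def v_def w_def \<rho>_def]; assumption)
    have diff: "C1_H1 \<Omega> (u i) (Gu i) (u' i) (Gu' i)" "C1_L2 \<Omega> (v i) (v' i)"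
      "C1_L2 \<Omega> (w i) (w' i)" "C1_H1 \<Omega> (\<rho> i) (Gr i) (r' i) (Gr' i)" if "i < m" for i
      using diff'[rule_format, OF that] by auto
    have L2c: "L2 \<Omega> (u i s)" "L2 \<Omega> (v i s)" "L2 \<Omega> (w i s)" "L2 \<Omega> (\<rho> i s)" if "i < m" "s \<ge> 0" for i s
      unfolding u_def v_def w_def \<rho>_def by (rule inE_L2_component[OF inE[OF that(2)] that(1)])+
    have nc: "(\<lambda>s x. \<alpha> - v i s x) = (\<lambda>s x. (-1) * v i s x + \<alpha>)" for i by simp
    have oc: "(\<lambda>s x. w i s x + d) = (\<lambda>s x. 1 * w i s x + d)" for i by simp
    have \<nu>L2: "L2 \<Omega> (\<lambda>x. \<alpha> - v i s x)" and \<omega>L2: "L2 \<Omega> (\<lambda>x. w i s x + d)" if "i < m" "s \<ge> 0" for i s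
      by (intro L2_diff L2_add L2_const lm L2c that)+
    have c\<nu>: "cont_L2 \<Omega> (\<lambda>s x. \<alpha> - v i s x)" and c\<omega>: "cont_L2 \<Omega> (\<lambda>s x. w i s x + d)" if "i < m" for i
      unfolding nc oc by (intro cont_L2_affine cont that)+
    define \<Phi> where "\<Phi> = (\<lambda>s. \<Sum>i<m. 3/2 * C1 * L2sq \<Omega> (u i s) + L2sq \<Omega> (\<lambda>x. \<alpha> - v i s x) + L2sq \<Omega> (w i s)
        + K * L2sq \<Omega> (\<lambda>x. w i s x + d) + c0 * L2sq \<Omega> (\<rho> i s))"
    \<comment> \<open>Minus the total integral of \<open>\<nu>\<close>; an upper bound on
      \<open>S\<close> is the required lower bound. Dropping \<open>\<beta> * u^2\<close> from the
      equation of \<open>v\<close> gives \<open>S' \<le> - S\<close>.\<close>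
    define S where "S = (\<lambda>s. \<Sum>i<m. - (\<integral>x. \<alpha> - v i s x \<partial>?N))"
    have cont\<Phi>: "continuous_on {0..} \<Phi>"
      unfolding \<Phi>_def
      by (intro continuous_on_sum continuous_on_add continuous_on_mult continuous_on_const
          cont_L2_continuous_on_L2sq cont c\<nu> c\<omega> L2c \<nu>L2 \<omega>L2) auto
    have contS: "continuous_on {0..} S"
      unfolding S_def
      by (intro continuous_on_sum continuous_on_minus cont_L2_continuous_on_integral c\<nu> \<nu>L2 lm) auto
    have ders: "L2_deriv \<Omega> (u i) (u' i s) s" "L2_deriv \<Omega> (v i) (v' i s) s" "L2_deriv \<Omega> (w i) (w' i s) s"
      "L2_deriv \<Omega> (\<rho> i) (r' i s) s" "L2_deriv \<Omega> (\<lambda>s x. \<alpha> - v i s x) (\<lambda>x. - v' i s x) s"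
      "L2_deriv \<Omega> (\<lambda>s x. w i s x + d) (w' i s) s" if "i < m" "s > 0" for i s
    proof -
      show 1: "L2_deriv \<Omega> (u i) (u' i s) s" "L2_deriv \<Omega> (v i) (v' i s) s" "L2_deriv \<Omega> (w i) (w' i s) s"
        "L2_deriv \<Omega> (\<rho> i) (r' i s) s"
        by (rule C1_H1_imp_L2_deriv[OF diff(1)] C1_L2_imp_L2_deriv[OF diff(2)] C1_L2_imp_L2_deriv[OF diff(3)]
            C1_H1_imp_L2_deriv[OF diff(4)], fact, fact)+
      show "L2_deriv \<Omega> (\<lambda>s x. \<alpha> - v i s x) (\<lambda>x. - v' i s x) s"
        using L2_deriv_affine[OF 1(2) lm, of "-1" \<alpha>] by simp
      show "L2_deriv \<Omega> (\<lambda>s x. w i s x + d) (w' i s) s"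
        using L2_deriv_affine[OF 1(3) lm, of 1 d] by simp
    qed
    \<comment> \<open>Differentiating squares doubles both the rate and the source of
      \<open>energy_dissipation\<close>, so their quotient \<open>\<Phi>i\<close> is
      unchanged.\<close>
    have der\<Phi>: "\<exists>y. (\<Phi> has_real_derivative y) (at s) \<and> y \<le> - (2 * lam) * \<Phi> s + 2 * (real m * (M1 - \<alpha>^2 / 2) * L)" if s: "s > 0" for s
    proof (intro exI conjI)
      let ?y = "\<Sum>i<m. 3/2 * C1 * (\<integral>x. u i s x * u' i s x \<partial>?N)
        + (\<integral>x. (\<alpha> - v i s x) * (- v' i s x) \<partial>?N) + (\<integral>x. w i s x * w' i s x \<partial>?N)
        + K * (\<integral>x. (w i s x + d) * w' i s x \<partial>?N) + c0 * (\<integral>x. \<rho> i s x * r' i s x \<partial>?N)"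
      have "(\<Phi> has_real_derivative (\<Sum>i<m. 3/2 * C1 * (2 * (\<integral>x. u i s x * u' i s x \<partial>?N))
        + 2 * (\<integral>x. (\<alpha> - v i s x) * (- v' i s x) \<partial>?N) + 2 * (\<integral>x. w i s x * w' i s x \<partial>?N)
        + K * (2 * (\<integral>x. (w i s x + d) * w' i s x \<partial>?N)) + c0 * (2 * (\<integral>x. \<rho> i s x * r' i s x \<partial>?N)))) (at s)"
        unfolding \<Phi>_def by (intro DERIV_sum DERIV_add DERIV_cmult L2_deriv_L2sq ders s) simp_all
      moreover have "(\<Sum>i<m. 3/2 * C1 * (2 * (\<integral>x. u i s x * u' i s x \<partial>?N))
        + 2 * (\<integral>x. (\<alpha> - v i s x) * (- v' i s x) \<partial>?N) + 2 * (\<integral>x. w i s x * w' i s x \<partial>?N)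
        + K * (2 * (\<integral>x. (w i s x + d) * w' i s x \<partial>?N)) + c0 * (2 * (\<integral>x. \<rho> i s x * r' i s x \<partial>?N))) = 2 * ?y"
        unfolding sum_distrib_left by (intro sum.cong refl) (simp only: distrib_left mult.left_commute[of _ 2])
      ultimately show "(\<Phi> has_real_derivative 2 * ?y) (at s)" by simp
      have "?y \<le> - lam * \<Phi> s + real m * (M1 - \<alpha>^2 / 2) * L"
        unfolding \<Phi>_def K_def d_def M1 L_def
      proof (rule energy_dissipation[OF \<Omega> pos C1 C2 lam c0, where Gu = "\<lambda>i. Gu i s" and Gr = "\<lambda>i. Gr i s"])
        fix i assume i: "i < m"
        show "weak_grad \<Omega> (u i s) (Gu i s)" "weak_grad \<Omega> (\<rho> i s) (Gr i s)" "L2 \<Omega> (v i s)" "L2 \<Omega> (w i s)"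
          "L2 \<Omega> (u' i s)" "L2 \<Omega> (v' i s)" "L2 \<Omega> (w' i s)"
          using C1_H1D[OF diff(1)[OF i] s] C1_H1D(1)[OF diff(4)[OF i] s] C1_L2D[OF diff(2)[OF i] s] C1_L2D[OF diff(3)[OF i] s]
          by blast+
        show "AE x in ?N. v' i s x = \<alpha> - \<beta> * (u i s x)^2 - v i s x" using ev[rule_format, OF i s] .
        show "AE x in ?N. w' i s x = q * (u i s x - ue) - r * w i s x" using ew[rule_format, OF i s] .
        fix \<psi> G\<psi> assume \<psi>: "weak_grad \<Omega> \<psi> G\<psi>"
        show "(\<integral>x. u' i s x * \<psi> x \<partial>lebesgue_on \<Omega>) =
             - \<eta>1 * (\<integral>x. Gu i s x \<bullet> G\<psi> x \<partial>lebesgue_on \<Omega>)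
             + (\<integral>x. (a * (u i s x)^2 - b * (u i s x)^3 + v i s x - w i s x + Je
                       - k1 * (c + \<gamma> * \<rho> i s x + \<delta> * (\<rho> i s x)^2) * u i s x
                       + (\<Sum>j<m. P * (u j s x - u i s x))) * \<psi> x \<partial>lebesgue_on \<Omega>)"
          using eu[rule_format, OF i s \<psi>] .
        show "(\<integral>x. r' i s x * \<psi> x \<partial>lebesgue_on \<Omega>) =
             - \<eta>2 * (\<integral>x. Gr i s x \<bullet> G\<psi> x \<partial>lebesgue_on \<Omega>)
             + (\<integral>x. (u i s x - k2 * \<rho> i s x
                       + (\<Sum>j<m. Q * (\<rho> j s x - \<rho> i s x))) * \<psi> x \<partial>lebesgue_on \<Omega>)"
          using er[rule_format, OF i s \<psi>] .
      qed
      moreover have "2 * y \<le> - (2 * lam) * p + 2 * z" if "y \<le> - lam * p + z" for y p z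
        using that by (simp add: algebra_simps)
      ultimately show "2 * ?y \<le> - (2 * lam) * \<Phi> s + 2 * (real m * (M1 - \<alpha>^2 / 2) * L)" by blast
    qed
    have derS: "\<exists>y. (S has_real_derivative y) (at s) \<and> y \<le> - 1 * S s + 0" if s: "s > 0" for s
    proof (intro exI conjI)
      have "((\<lambda>s. \<integral>x. \<alpha> - v i s x \<partial>?N) has_real_derivative (\<integral>x. - v' i s x \<partial>?N)) (at s)" if i: "i < m" for i
      proof -
        \<comment> \<open>The integral is differentiated as a pairing with the constant function
          1.\<close>
        have "L2_deriv \<Omega> (\<lambda>s x. 1) (\<lambda>x. 0) s"
          using L2_const[OF lm, of 1] by (simp add: L2_deriv_def L2_zero L2sq_def)
        from L2_deriv_integral_mult[OF ders(5)[OF i s] this] show ?thesis by simp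
      qed
      then show "(S has_real_derivative (\<Sum>i<m. - (\<integral>x. - v' i s x \<partial>?N))) (at s)"
        unfolding S_def by (intro DERIV_sum DERIV_minus) simp
      have "- (\<integral>x. - v' i s x \<partial>?N) \<le> (\<integral>x. \<alpha> - v i s x \<partial>?N)" if i: "i < m" for i
      proof -
        have v'L2: "L2 \<Omega> (v' i s)" using C1_L2D(2)[OF diff(2)[OF i] s] .
        have "- (\<integral>x. - v' i s x \<partial>?N) = (\<integral>x. v' i s x \<partial>?N)" by simp
        also have "\<dots> \<le> (\<integral>x. \<alpha> - v i s x \<partial>?N)"
        proof (rule integral_mono_AE)
          show "integrable ?N (v' i s)" by (rule L2_integrable[OF lm v'L2])
          show "integrable ?N (\<lambda>x. \<alpha> - v i s x)" using \<nu>L2[OF i] s by (intro L2_integrable[OF lm]) simp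
          show "AE x in ?N. v' i s x \<le> \<alpha> - v i s x"
            using ev[rule_format, OF i s] by eventually_elim (use pos in simp)
        qed
        finally show ?thesis .
      qed
      then show "(\<Sum>i<m. - (\<integral>x. - v' i s x \<partial>?N)) \<le> - 1 * S s + 0"
        unfolding S_def by (simp add: sum_negf[symmetric] del: integral_minus) (intro sum_mono, simp)
    qed
    have G\<Phi>: "\<Phi> t \<le> exp (- (2 * lam) * t) * (\<Phi> 0 - \<Phi>i) + \<Phi>i"
    proof -
      have eq: "2 * (real m * (M1 - \<alpha>^2 / 2) * L) / (2 * lam) = \<Phi>i" unfolding \<Phi>i_def by simp
      show ?thesis
        using gronwall_linear[OF _ cont\<Phi> der\<Phi> t] lampos(1) unfolding eq by simp
    qed
    have GS: "S t \<le> exp (- 1 * t) * S 0"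
      using gronwall_linear[OF _ contS derS t] by simp
    have comps: "(\<integral>x. (norm (g s i x))^2 \<partial>?N) = L2sq \<Omega> (u i s) + L2sq \<Omega> (v i s) + L2sq \<Omega> (w i s) + L2sq \<Omega> (\<rho> i s)"
      if "i < m" "s \<ge> 0" for i s
      unfolding u_def v_def w_def \<rho>_def by (rule integral_norm_power2_components[OF inE[OF that(2)] that(1)])
    have n0: "normE2 \<Omega> m (g 0) \<le> R"
    proof -
      have "normE2 \<Omega> m (g 0) = normE2 \<Omega> m g0"
        unfolding normE2_def by (intro sum.cong refl inE_cong_integral_eq_0[OF inE g0(1)] init) auto
      then show ?thesis using g0(2) by simp
    qed
    have \<nu>0: "L2sq \<Omega> (\<lambda>x. \<alpha> - v i 0 x) \<le> 2 * L2sq \<Omega> (v i 0) + 2 * \<alpha>^2 * L"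
      and \<omega>0: "L2sq \<Omega> (\<lambda>x. w i 0 x + d) \<le> 2 * L2sq \<Omega> (w i 0) + 2 * d^2 * L" if "i < m" for i
      using L2sq_affine_le[OF lm L2c(2)[OF that, of 0], of "-1" \<alpha>] L2sq_affine_le[OF lm L2c(3)[OF that, of 0], of 1 d]
      by (simp_all add: L_def)
    have \<Phi>0: "\<Phi> 0 \<le> \<Phi>b"
    proof -
      have "\<Phi> 0 \<le> (\<Sum>i<m. kk * (\<integral>x. (norm (g 0 i x))^2 \<partial>?N) + (2 * \<alpha>^2 * L + K * (2 * d^2 * L)))"
        unfolding \<Phi>_def
      proof (rule sum_mono)
        fix i assume "i \<in> {..<m}" then have i: "i < m" by simp
        have nn: "0 \<le> L2sq \<Omega> (u i 0)" "0 \<le> L2sq \<Omega> (v i 0)" "0 \<le> L2sq \<Omega> (w i 0)" "0 \<le> L2sq \<Omega> (\<rho> i 0)"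
          by (rule L2sq_nonneg)+
        have 1: "K * L2sq \<Omega> (\<lambda>x. w i 0 x + d) \<le> 2 * K * L2sq \<Omega> (w i 0) + K * (2 * d^2 * L)"
          using mult_left_mono[OF \<omega>0[OF i] less_imp_le[OF K0]] by (simp add: distrib_left)
        have 2: "3/2 * C1 * L2sq \<Omega> (u i 0) \<le> kk * L2sq \<Omega> (u i 0)"
          using nn K0 by (intro mult_right_mono) (auto simp: kk_def)
        have 3: "2 * L2sq \<Omega> (v i 0) \<le> kk * L2sq \<Omega> (v i 0)"
          using nn K0 C1pos by (intro mult_right_mono) (auto simp: kk_def)
        have 4: "(1 + 2 * K) * L2sq \<Omega> (w i 0) \<le> kk * L2sq \<Omega> (w i 0)"
          using nn K0 C1pos by (intro mult_right_mono) (auto simp: kk_def)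
        have 5: "c0 * L2sq \<Omega> (\<rho> i 0) \<le> kk * L2sq \<Omega> (\<rho> i 0)"
          using nn K0 C1pos c0pos by (intro mult_right_mono) (auto simp: kk_def)
        show "3/2 * C1 * L2sq \<Omega> (u i 0) + L2sq \<Omega> (\<lambda>x. \<alpha> - v i 0 x) + L2sq \<Omega> (w i 0)
            + K * L2sq \<Omega> (\<lambda>x. w i 0 x + d) + c0 * L2sq \<Omega> (\<rho> i 0)
          \<le> kk * (\<integral>x. (norm (g 0 i x))^2 \<partial>?N) + (2 * \<alpha>^2 * L + K * (2 * d^2 * L))"
          unfolding comps[OF i order_refl] distrib_left
          using 1 2 3 4 5 \<nu>0[OF i] by (simp only: distrib_right mult_1_left)
      qed
      also have "\<dots> = kk * normE2 \<Omega> m (g 0) + real m * (2 * \<alpha>^2 * L + K * (2 * d^2 * L))"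
        by (simp only: normE2_def sum.distrib sum_distrib_left sum_constant card_lessThan distrib_left)
      also have "\<dots> \<le> \<Phi>b"
        unfolding \<Phi>b_def using n0 K0 C1pos by (intro add_right_mono mult_left_mono) (auto simp: kk_def)
      finally show ?thesis .
    qed
    have S0: "S 0 \<le> Sb"
    proof -
      interpret finite_measure ?N using lm by (rule finite_measure_lebesgue_on)
      have "S 0 \<le> (\<Sum>i<m. 2 * (\<integral>x. (norm (g 0 i x))^2 \<partial>?N) + (2 * \<alpha>^2 * L + L))"
        unfolding S_def
      proof (rule sum_mono)
        fix i assume "i \<in> {..<m}" then have i: "i < m" by simp
        note n = \<nu>L2[OF i order_refl]
        have "- (\<integral>x. \<alpha> - v i 0 x \<partial>?N) = (\<integral>x. - (\<alpha> - v i 0 x) \<partial>?N)"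
          by (rule integral_minus[symmetric])
        also have "\<dots> \<le> (\<integral>x. (\<alpha> - v i 0 x)^2 + 1 \<partial>?N)"
        proof (rule integral_mono)
          show "integrable ?N (\<lambda>x. - (\<alpha> - v i 0 x))" by (intro L2_integrable[OF lm] L2_minus n)
          show "integrable ?N (\<lambda>x. (\<alpha> - v i 0 x)^2 + 1)" using L2_integrable_power2[OF n] by simp
          have "- y \<le> y^2 + 1" for y :: real
          proof -
            have "0 \<le> (y + 1/2)^2" by simp
            also have "\<dots> = y^2 + y + 1/4" by (simp add: power2_sum power_divide)
            finally show ?thesis by linarith
          qed
          then show "- (\<alpha> - v i 0 x) \<le> (\<alpha> - v i 0 x)^2 + 1" for x .
        qed
        also have "\<dots> = L2sq \<Omega> (\<lambda>x. \<alpha> - v i 0 x) + L"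
          using L2_integrable_power2[OF n] fmeasurableD[OF lm] by (simp add: L2sq_def L_def measure_restrict_space)
        finally show "- (\<integral>x. \<alpha> - v i 0 x \<partial>?N) \<le> 2 * (\<integral>x. (norm (g 0 i x))^2 \<partial>?N) + (2 * \<alpha>^2 * L + L)"
          unfolding comps[OF i order_refl]
          using \<nu>0[OF i] L2sq_nonneg[of \<Omega> "u i 0"] L2sq_nonneg[of \<Omega> "w i 0"] L2sq_nonneg[of \<Omega> "\<rho> i 0"] by simp
      qed
      also have "\<dots> = 2 * normE2 \<Omega> m (g 0) + real m * (2 * \<alpha>^2 * L + L)"
        by (simp only: normE2_def sum.distrib sum_distrib_left sum_constant card_lessThan distrib_left)
      also have "\<dots> \<le> Sb" unfolding Sb_def using n0 by simp
      finally show ?thesis .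
    qed
    \<comment> \<open>Since \<open>c0\<close> is at most both \<open>C1\<close> and 1, each weight
      of \<open>u\<close>, \<open>\<nu>\<close>, \<open>w\<close> and \<open>\<rho>\<close> in the
      energy is at least \<open>c0\<close>; the nonnegative \<open>\<omega>\<close> part is
      discarded. The last two summands come from \<open>L2sq_shift\<close>.\<close>
    have "normE2 \<Omega> m (g t) \<le> \<Phi> t / c0 + 2 * \<alpha> * S t + real m * \<alpha>^2 * L"
    proof -
      have "normE2 \<Omega> m (g t) \<le> (\<Sum>i<m. (3/2 * C1 * L2sq \<Omega> (u i t) + L2sq \<Omega> (\<lambda>x. \<alpha> - v i t x) + L2sq \<Omega> (w i t)
        + K * L2sq \<Omega> (\<lambda>x. w i t x + d) + c0 * L2sq \<Omega> (\<rho> i t)) / c0 + 2 * \<alpha> * (- (\<integral>x. \<alpha> - v i t x \<partial>?N)) + \<alpha>^2 * L)"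
        unfolding normE2_def
      proof (rule sum_mono)
        fix i assume "i \<in> {..<m}" then have i: "i < m" by simp
        have nn: "0 \<le> L2sq \<Omega> (u i t)" "0 \<le> L2sq \<Omega> (\<lambda>x. \<alpha> - v i t x)" "0 \<le> L2sq \<Omega> (w i t)"
          "0 \<le> L2sq \<Omega> (\<lambda>x. w i t x + d)" by (rule L2sq_nonneg)+
        have "c0 * L2sq \<Omega> (u i t) \<le> 3/2 * C1 * L2sq \<Omega> (u i t)"
          using nn c0pos C1pos by (intro mult_right_mono) auto
        moreover have "c0 * L2sq \<Omega> (\<lambda>x. \<alpha> - v i t x) \<le> L2sq \<Omega> (\<lambda>x. \<alpha> - v i t x)"
          using mult_right_mono[OF c0pos(3) nn(2)] by simp
        moreover have "c0 * L2sq \<Omega> (w i t) \<le> L2sq \<Omega> (w i t)"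
          using mult_right_mono[OF c0pos(3) nn(3)] by simp
        moreover have "0 \<le> K * L2sq \<Omega> (\<lambda>x. w i t x + d)" using K0 nn by simp
        ultimately have "(L2sq \<Omega> (u i t) + L2sq \<Omega> (\<lambda>x. \<alpha> - v i t x) + L2sq \<Omega> (w i t) + L2sq \<Omega> (\<rho> i t)) * c0
          \<le> 3/2 * C1 * L2sq \<Omega> (u i t) + L2sq \<Omega> (\<lambda>x. \<alpha> - v i t x) + L2sq \<Omega> (w i t)
            + K * L2sq \<Omega> (\<lambda>x. w i t x + d) + c0 * L2sq \<Omega> (\<rho> i t)"
          unfolding mult.commute[of _ c0] distrib_left by linarith
        then have "L2sq \<Omega> (u i t) + L2sq \<Omega> (\<lambda>x. \<alpha> - v i t x) + L2sq \<Omega> (w i t) + L2sq \<Omega> (\<rho> i t)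
          \<le> (3/2 * C1 * L2sq \<Omega> (u i t) + L2sq \<Omega> (\<lambda>x. \<alpha> - v i t x) + L2sq \<Omega> (w i t)
            + K * L2sq \<Omega> (\<lambda>x. w i t x + d) + c0 * L2sq \<Omega> (\<rho> i t)) / c0"
          by (simp only: pos_le_divide_eq[OF c0pos(1)])
        then show "(\<integral>x. (norm (g t i x))^2 \<partial>?N) \<le> (3/2 * C1 * L2sq \<Omega> (u i t) + L2sq \<Omega> (\<lambda>x. \<alpha> - v i t x) + L2sq \<Omega> (w i t)
            + K * L2sq \<Omega> (\<lambda>x. w i t x + d) + c0 * L2sq \<Omega> (\<rho> i t)) / c0 + 2 * \<alpha> * (- (\<integral>x. \<alpha> - v i t x \<partial>?N)) + \<alpha>^2 * L"
          using L2sq_shift[OF lm L2c(2)[OF i t], of \<alpha>] unfolding comps[OF i t] L_def mult_minus_right by linarith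
      qed
      also have "\<dots> = \<Phi> t / c0 + 2 * \<alpha> * S t + real m * \<alpha>^2 * L"
        unfolding \<Phi>_def S_def
        by (simp only: sum.distrib sum_distrib_left sum_divide_distrib add_divide_distrib sum_constant card_lessThan mult.assoc)
      finally show ?thesis .
    qed
    also have "\<Phi> t / c0 \<le> (exp (- (2 * lam) * t) * (\<Phi>b - \<Phi>i) + \<Phi>i) / c0"
    proof -
      have "exp (- (2 * lam) * t) * (\<Phi> 0 - \<Phi>i) \<le> exp (- (2 * lam) * t) * (\<Phi>b - \<Phi>i)"
        using \<Phi>0 by (intro mult_left_mono) auto
      then have "\<Phi> t \<le> exp (- (2 * lam) * t) * (\<Phi>b - \<Phi>i) + \<Phi>i" using G\<Phi> by linarith
      then show ?thesis by (rule divide_right_mono) (use c0pos in simp)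
    qed
    also have "2 * \<alpha> * S t \<le> 2 * \<alpha> * (exp (- 1 * t) * Sb)"
    proof (rule mult_left_mono)
      have "exp (- 1 * t) * S 0 \<le> exp (- 1 * t) * Sb" using S0 by (rule mult_left_mono) simp
      then show "S t \<le> exp (- 1 * t) * Sb" using GS by linarith
    qed (use pos in simp)
    also have "(exp (- (2 * lam) * t) * (\<Phi>b - \<Phi>i) + \<Phi>i) / c0 = A * exp (- (2 * lam) * t) + \<Phi>i / c0"
      by (simp add: A_def add_divide_distrib)
    also have "2 * \<alpha> * (exp (- 1 * t) * Sb) = D * exp (- 1 * t)" by (simp add: D_def)
    finally have "normE2 \<Omega> m (g t) \<le> A * exp (- (2 * lam) * t) + \<Phi>i / c0 + D * exp (- 1 * t) + real m * \<alpha>^2 * L"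
      by simp
    \<comment> \<open>Here the reserve \<open>\<alpha>^2 / 2\<close> is spent: divided by
      \<open>lam * c0 \<le> 1/2\<close> it is at least \<open>\<alpha>^2\<close>.\<close>
    moreover have "\<Phi>i / c0 + real m * \<alpha>^2 * L \<le> real m * M1 / (lam * c0) * L"
    proof -
      have "lam * c0 \<le> 1/2" using mult_mono[of lam "1/2" c0 1] lampos c0pos by simp
      then have "\<alpha>^2 * (lam * c0) \<le> \<alpha>^2 * (1/2)" by (intro mult_left_mono) auto
      then have "\<alpha>^2 \<le> \<alpha>^2 / 2 / (lam * c0)" using lampos c0pos by (simp add: pos_le_divide_eq)
      then have "real m * L * \<alpha>^2 \<le> real m * L * (\<alpha>^2 / 2 / (lam * c0))"
        using L0 by (intro mult_left_mono) auto
      moreover have "\<Phi>i / c0 = real m * M1 / (lam * c0) * L - real m * L * (\<alpha>^2 / 2 / (lam * c0))"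
        using lampos c0pos by (simp add: \<Phi>i_def field_simps)
      ultimately show ?thesis by (simp add: mult_ac)
    qed
    ultimately show ?thesis by linarith
  qed
  show ?thesis unfolding L_def[symmetric] using main by blast
qed

theorem theorem3p2:
  fixes \<Omega> :: "(real^'n) set"
    and m :: nat
    and a b \<eta>1 \<eta>2 \<alpha> \<beta> q r \<delta> k1 k2 P Q Je ue c \<gamma> :: real
  assumes "m \<ge> 2" and "CARD('n) \<le> 3"
    and "bounded_lipschitz_domain \<Omega>"
    and "a > 0" "b > 0" "\<eta>1 > 0" "\<eta>2 > 0" "\<alpha> > 0" "\<beta> > 0" "q > 0" "r > 0"
        "\<delta> > 0" "k1 > 0" "k2 > 0" "P > 0" "Q > 0" "Je > 0"
  shows "let C1 = (1 / b) * (\<beta>^2 / 2 + 1 / (2 * k2^3) + 4);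
             C2 = (1/4) * (C1 * k1 * (\<bar>c\<bar> + \<gamma>^2 / \<delta>) + 1/4)^2;
             lam = (1/2) * min 1 (min r k2);
             M = real m * (C2 + (C1 * a)^4 + C1 * Je^2 + (C1^2 * (2 + 1 / r) + C1)^2
                           + 2 * \<alpha>^2 + q^2 * ue^2 / r + q^4 / r^2);
             K = (M / (lam * min C1 1) + sqrt (M / (lam * min C1 1))) * measure lebesgue \<Omega> + 1
         in \<forall>B. bounded_in_E \<Omega> m B \<longrightarrow>
              (\<exists>T\<ge>0. \<forall>g0\<in>B. \<forall>g. hr_weak_solution \<Omega> m a b \<eta>1 \<eta>2 \<alpha> \<beta> q r \<delta> k1 k2 P Q Je ue c \<gamma> g0 g
                        \<longrightarrow> (\<forall>t>T. inE \<Omega> m (g t) \<and> normE2 \<Omega> m (g t) \<le> K))"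
proof -
  define C1 where "C1 = (1 / b) * (\<beta>^2 / 2 + 1 / (2 * k2^3) + 4)"
  define C2 where "C2 = (1/4) * (C1 * k1 * (\<bar>c\<bar> + \<gamma>^2 / \<delta>) + 1/4)^2"
  define lam where "lam = (1/2) * min 1 (min r k2)"
  define M1 where "M1 = C2 + (C1 * a)^4 + C1 * Je^2 + (C1^2 * (2 + 1 / r) + C1)^2
                           + 2 * \<alpha>^2 + q^2 * ue^2 / r + q^4 / r^2"
  define K where "K = (real m * M1 / (lam * min C1 1) + sqrt (real m * M1 / (lam * min C1 1))) * measure lebesgue \<Omega> + 1"
  have \<Omega>: "open \<Omega>" "bounded \<Omega>" using assms(3) by (simp_all add: bounded_lipschitz_domain_def)
  have lam0: "lam > 0" using assms by (simp add: lam_def)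
  have C10: "C1 > 0" unfolding C1_def using assms by (simp add: add_pos_pos)
  have M10: "M1 \<ge> 0" unfolding M1_def C2_def using assms C10 by (intro add_nonneg_nonneg) auto
  have "\<exists>T\<ge>0. \<forall>g0\<in>B. \<forall>g. hr_weak_solution \<Omega> m a b \<eta>1 \<eta>2 \<alpha> \<beta> q r \<delta> k1 k2 P Q Je ue c \<gamma> g0 g
      \<longrightarrow> (\<forall>t>T. inE \<Omega> m (g t) \<and> normE2 \<Omega> m (g t) \<le> K)" if B: "bounded_in_E \<Omega> m B" for B
  proof -
    obtain R where R: "\<And>h. h \<in> B \<Longrightarrow> inE \<Omega> m h \<and> normE2 \<Omega> m h \<le> R"
      using B unfolding bounded_in_E_def by blast
    obtain A D where AD: "\<And>g0 g t. inE \<Omega> m g0 \<Longrightarrow> normE2 \<Omega> m g0 \<le> R \<Longrightarrow>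
        hr_weak_solution \<Omega> m a b \<eta>1 \<eta>2 \<alpha> \<beta> q r \<delta> k1 k2 P Q Je ue c \<gamma> g0 g \<Longrightarrow> t \<ge> 0 \<Longrightarrow>
        normE2 \<Omega> m (g t) \<le> real m * M1 / (lam * min C1 1) * measure lebesgue \<Omega>
          + A * exp (- (2 * lam) * t) + D * exp (- 1 * t)"
      using hr_normE2_bound[OF \<Omega> assms(4-17) C1_def C2_def lam_def refl M1_def, where m = m and R = R] by blast
    have decay: "((\<lambda>t. exp (- k * t)) \<longlongrightarrow> 0) at_top" if "k > 0" for k :: real
    proof -
      have "filterlim (\<lambda>t. - k * t) at_bot at_top"
        using that by (intro filterlim_tendsto_neg_mult_at_bot[OF tendsto_const _ filterlim_ident]) simp
      then show ?thesis by (rule filterlim_compose[OF exp_at_bot])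
    qed
    have "((\<lambda>t. A * exp (- (2 * lam) * t) + D * exp (- 1 * t)) \<longlongrightarrow> A * 0 + D * 0) at_top"
      by (intro tendsto_intros decay) (use lam0 in simp_all)
    \<comment> \<open>The summand 1 in \<open>K\<close> is the allowance for the decaying
      terms.\<close>
    then have "\<forall>\<^sub>F t in at_top. A * exp (- (2 * lam) * t) + D * exp (- 1 * t) < 1"
      by (intro order_tendstoD) auto
    then obtain T0 where T0: "\<And>t. t \<ge> T0 \<Longrightarrow> A * exp (- (2 * lam) * t) + D * exp (- 1 * t) < 1"
      by (auto simp: eventually_at_top_linorder)
    show ?thesis
    proof (intro exI[of _ "max T0 0"] conjI ballI allI impI)
      fix g0 g t
      assume "g0 \<in> B" and sol: "hr_weak_solution \<Omega> m a b \<eta>1 \<eta>2 \<alpha> \<beta> q r \<delta> k1 k2 P Q Je ue c \<gamma> g0 g"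
        and t: "max T0 0 < t"
      then have t0: "t \<ge> 0" "t \<ge> T0" by auto
      show "inE \<Omega> m (g t)" using conjunct1[OF sol[unfolded hr_weak_solution_def Let_def]] t0 by simp
      have "normE2 \<Omega> m (g t) \<le> real m * M1 / (lam * min C1 1) * measure lebesgue \<Omega>
          + A * exp (- (2 * lam) * t) + D * exp (- 1 * t)"
        using R[OF \<open>g0 \<in> B\<close>] by (intro AD[OF _ _ sol t0(1)]) simp_all
      also have "\<dots> \<le> real m * M1 / (lam * min C1 1) * measure lebesgue \<Omega> + 1"
        using T0[OF t0(2)] by linarith
      also have "\<dots> \<le> K"
      proof -
        have "0 \<le> sqrt (real m * M1 / (lam * min C1 1)) * measure lebesgue \<Omega>"
          using M10 lam0 C10 by (intro mult_nonneg_nonneg) auto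
        then show ?thesis unfolding K_def distrib_right by linarith
      qed
      finally show "normE2 \<Omega> m (g t) \<le> K" .
    qed simp
  qed
  then show ?thesis
    unfolding Let_def K_def M1_def lam_def C2_def C1_def by blast
qed

end
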